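(* The Pauli functional commitment scheme with classical keys $(\mathsf{Gen},\mathsf{Com},\mathsf{OpenZ},\mathsf{OpenX},\mathsf{DecZ},\mathsf{DecX})$ constructed in the context is correct: for every single-qubit (potentially mixed) state on a register $\mathcal B$, $$\mathrm{TV}\big(\mathsf Z(\mathcal B),\mathsf{PFCZ}(1^\lambda,\mathcal B)\big)=\mathrm{negl}(\lambda)\quad\text{and}\quad \mathrm{TV}\big(\mathsf X(\mathcal B),\mathsf{PFCX}(1^\lambda,\mathcal B)\big)=\mathrm{negl}(\lambda),$$ where $\mathrm{TV}$ is total variation distance; $\mathsf Z(\mathcal B)$ (resp. $\mathsf X(\mathcal B)$) is the outcome of measuring $\mathcal B$ in the standard (resp. Hadamard) basis; $\mathsf{PFCZ}(1^\lambda,\mathcal B)$ samples $(\mathsf{CK},\mathsf{dk})\leftarrow\mathsf{Gen}(1^\lambda)$, $(\mathcal B,\mathcal U,c)\leftarrow\mathsf{Com}^{\mathsf{CK}}(\mathcal B)$, $u\leftarrow\mathsf{OpenZ}(\mathcal B,\mathcal U)$ and outputs $\mathsf{DecZ}(\mathsf{dk},c,u)$; and $\mathsf{PFCX}$ is the same with $\mathsf{OpenX},\mathsf{DecX}$ in place of $\mathsf{OpenZ},\mathsf{DecZ}$.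
   Context: One-shot signatures (OSS). A tuple $(\mathsf{Setup},\mathsf{Gen},\mathsf{Sign},\mathsf{Ver})$: $\mathsf{Setup}(1^\lambda)$ is classical and outputs a classical deterministic circuit $\mathsf O$ (used as an oracle); $\mathsf{Gen}^{\mathsf O}$ outputs a classical key $\mathsf{vk}$ and a quantum key $|\mathsf{sk}\rangle$; $\mathsf{Sign}^{\mathsf O}(|\mathsf{sk}\rangle,m)$ outputs a classical signature; $\mathsf{Ver}^{\mathsf O}(\mathsf{vk},m,\sigma)\in\{\top,\bot\}$ is classical deterministic. Correctness: for every $m$, honest signatures verify with probability $1-\mathrm{negl}(\lambda)$. Strong unforgeability: no QPT $\mathcal A^{\mathsf O}$ outputs, with non-negligible probability, $(\mathsf{vk},m_0,m_1,\sigma_0,\sigma_1)$ with both $(m_i,\sigma_i)$ valid under $\mathsf{vk}$ and $\sigma_0\neq\sigma_1$. The specific scheme $\overline{\mathsf{OSS}}$ (Shmueli–Zhandry). Parameters $s=16\lambda$, $r=s(\lambda-1)$, $n=r+\tfrac32 s$, $k=n$. $\overline{\mathsf{OSS}}.\mathsf{Setup}(1^\lambda)$: sample a random permutation $\Pi$ of $\{0,1\}^n$, write $\Pi(x)=H(x)\|J(x)$ with $H(x)\in\{0,1\}^r$, $J(x)\in\mathbb Z_2^{n-r}$; for each $y\in\{0,1\}^r$ sample (via a random function) a full-rank $A_y\in\mathbb Z_2^{k\times(n-r)}$ and $b_y\in\mathbb Z_2^k$. Let $S_y=\{A_yx+b_y: x\in\mathbb Z_2^{n-r}\}$ and $S_{y,b}=\{u\in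 S_y:u_1=b\}$. Define $P(x)=(y,A_yJ(x)+b_y)$ with $y=H(x)$; $P^{-1}(y,u)=\Pi^{-1}(y,z)$ if $u=A_yz+b_y$ for some $z$, and $\bot$ otherwise; $D(y,v)=1$ if $v^{\top}A_y=0$, else $0$. Let $S_y^\perp=\{v:D(y,v)=1\}$. The output is $\overline{\mathsf O}=(P,P^{-1},D)$. $\overline{\mathsf{OSS}}.\mathsf{Gen}$ (uses only $P,P^{-1}$): prepare a uniform superposition over $x$, compute $P(x)=(y,u)$ on registers $\mathcal Y,\mathcal U$, measure $y$, uncompute $x$ with $P^{-1}$; output $\overline{\mathsf{vk}}=y$ and the state on $\mathcal U$, namely $|S_y\rangle$, the uniform superposition over $S_y$. Construction of the commitment. Ingredients: an OSS scheme $\mathsf{OSS}$ for one-bit messages, $\overline{\mathsf{OSS}}$, and a PRF $F$. - $\mathsf{Gen}(1^\lambda;R)$: parse $R=(R_1,R_2)$; $\mathsf O\leftarrow\mathsf{OSS}.\mathsf{Setup}(1^\lambda;R_1)$; sample a PRF key $\kappa$ using $R_2$. For each $\mathsf{vk}$ let $(P,P^{-1},D)=\overline{\mathsf{OSS}}.\mathsf{Setup}(1^\lambda;F_\kappa(\mathsf{vk}))$ (coins $F_\kappa(\mathsf{vk})$). Oracles: $\mathsf{CK}_P(\mathsf{vk},x)=P(x)$; $\mathsf{CK}_{P^{-1}}(\mathsf{vk},\overline{\mathsf{vk}},u)=P^{-1}(\overline{\mathsf{vk}},u)$; $\mathsf{CK}_D(\mathsf{vk},\sigma,\overline{\mathsf{vk}},u)=\bot$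 if $\mathsf{OSS}.\mathsf{Ver}^{\mathsf O}(\mathsf{vk},0,\sigma)=\bot$, and otherwise $0$ if $D(\overline{\mathsf{vk}},u)=1$ and $1$ if $D(\overline{\mathsf{vk}},u)=0$. Output $\mathsf{CK}=(\mathsf O,\mathsf{CK}_P,\mathsf{CK}_{P^{-1}},\mathsf{CK}_D)$ and $\mathsf{dk}=(R_1,\kappa)$. - $\mathsf{Com}^{\mathsf{CK}}(b)$: run $(\mathsf{vk},|\mathsf{sk}\rangle)\leftarrow\mathsf{OSS}.\mathsf{Gen}^{\mathsf O}$; coherently apply $\mathsf{OSS}.\mathsf{Sign}^{\mathsf O}(|\mathsf{sk}\rangle,0)$ to get a superposition of signatures of $0$ on register $\mathcal S$. Run $\overline{\mathsf{OSS}}.\mathsf{Gen}$ with $\mathsf{CK}_P(\mathsf{vk},\cdot),\mathsf{CK}_{P^{-1}}(\mathsf{vk},\cdot,\cdot)$ to get $\overline{\mathsf{vk}}=y$ and $|S_y\rangle$ on $\mathcal S'$. Measure the first qubit of $\mathcal S'$, obtaining $b'$. If $b'\neq b$, apply $(\mathsf H^{\otimes n}\otimes I)\circ\mathsf{Phase}\circ(\mathsf H^{\otimes n}\otimes I)$ to $(\mathcal S',\mathcal S)$, where $\mathsf H$ is the Hadamard gate and $\mathsf{Phase}:|u\rangle|\sigma\rangle\mapsto(-1)^{\mathsf{CK}_D(\mathsf{vk},\sigma,y,u)}|u\rangle|\sigma\rangle$. Undo the signing of $0$ to recover $|\mathsf{sk}\rangle$; sample $\sigma\leftarrow\mathsf{OSS}.\mathsf{Sign}^{\mathsf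 O}(|\mathsf{sk}\rangle,1)$. Output $c=(\mathsf{vk},\sigma,\overline{\mathsf{vk}})$ and $\mathcal U:=\mathcal S'$. On a single-qubit register $\mathcal B$, $\mathsf{Com}^{\mathsf{CK}}(\mathcal B)$ means $|0\rangle\langle0|\otimes\mathsf{Com}^{\mathsf{CK}}(0)+|1\rangle\langle1|\otimes\mathsf{Com}^{\mathsf{CK}}(1)$, i.e. $\mathsf{Com}$ run coherently controlled on $\mathcal B$ (with only its classical output register $c$ finally measured), outputting $(\mathcal B,\mathcal U,c)$. - $\mathsf{OpenZ}(\mathcal B,\mathcal U)$ (resp. $\mathsf{OpenX}$): measure all qubits in the standard (resp. Hadamard) basis. - $\mathsf{DecZ}(\mathsf{dk},c,d)$ with $c=(\mathsf{vk},\sigma,y)$, $d=(b,u)$, $u\in\{0,1\}^n$: recompute $\mathsf O$ and $\overline{\mathsf O}$ (from $R_1$ and $F_\kappa(\mathsf{vk})$); output $\bot$ unless $\mathsf{OSS}.\mathsf{Ver}^{\mathsf O}(\mathsf{vk},1,\sigma)=\top$; output $b$ if $u\in S_{y,b}$, else $\bot$. - $\mathsf{DecX}(\mathsf{dk},c,d)$ with $c=(\mathsf{vk},\sigma,y)$, $d=(b',u)$: same signature check; set $r=0$ if $u\in S_y^\perp$, $r=1$ if $u\oplus(1,0,\dots,0)\in S_y^\perp$, else output $\bot$; output $b'\oplus r$. *)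

theory Defs
  imports
    "HOL-Probability.Probability"
    "HOL-Library.Landau_Symbols"
    "HOL-Library.Monad_Syntax"
    "HOL-Library.Z2"
    "HOL-Combinatorics.Permutations"
    "Jordan_Normal_Form.Matrix"
    "Jordan_Normal_Form.DL_Rank"
begin

no_notation Finite_Cartesian_Product.vec_nth (infixl \<open>$\<close> 90)
hide_type (open) Finite_Cartesian_Product.vec

definition negl :: "(nat \<Rightarrow> real) \<Rightarrow> bool" where
  "negl f \<longleftrightarrow> (\<forall>c>0. f \<in> o(\<lambda>\<eta>. inverse (real \<eta> powr c)))"

definition poly_bounded :: "(nat \<Rightarrow> nat) \<Rightarrow> bool" where
  "poly_bounded f \<longleftrightarrow> (\<exists>c. \<forall>\<eta>. f \<eta> \<le> \<eta> ^ c + c)"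

definition tv_dist :: "'a pmf \<Rightarrow> 'a pmf \<Rightarrow> real" where
  "tv_dist p q = (SUP A. \<bar>measure_pmf.prob p A - measure_pmf.prob q A\<bar>)"

definition uniform_bits :: "nat \<Rightarrow> bool list pmf" where
  "uniform_bits l = pmf_of_set {xs. length xs = l}"

definition fit :: "nat \<Rightarrow> bool list \<Rightarrow> bool list" where
  "fit l xs = take l (xs @ replicate l False)"

type_synonym bitvec = "bit Matrix.vec"

definition bits_of_vec :: "bitvec \<Rightarrow> bool list" where
  "bits_of_vec v = map (\<lambda>a. a = 1) (list_of_vec v)"

definition vec_of_bits :: "bool list \<Rightarrow> bitvec" where
  "vec_of_bits xs = vec_of_list (map of_bool xs)"

text \<open>A circuit is a straight-line program: each gate appends its result to the list of wires,
  which initially holds the input. \<open>CQuery\<close> appends the answer of the oracle; circuits that are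
  meant to be oracle-free are run with the oracle that returns the empty string.\<close>

datatype cgate = Nand nat nat | CQuery "nat list"

record ccirc =
  cc_in :: nat
  cc_gates :: "cgate list"
  cc_out :: "nat list"

type_synonym bfun = "bool list \<Rightarrow> bool list"

definition wire :: "bool list \<Rightarrow> nat \<Rightarrow> bool" where
  "wire w i \<longleftrightarrow> i < length w \<and> w ! i"

primrec cgate_step :: "bfun \<Rightarrow> bool list \<Rightarrow> cgate \<Rightarrow> bool list" where
  "cgate_step O' w (Nand i j) = w @ [\<not> (wire w i \<and> wire w j)]"
| "cgate_step O' w (CQuery is) = w @ O' (map (wire w) is)"

definition ccirc_eval :: "bfun \<Rightarrow> ccirc \<Rightarrow> bfun" where
  "ccirc_eval O' C x =
     map (wire (foldl (cgate_step O') (fit (cc_in C) x) (cc_gates C))) (cc_out C)"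

definition ccirc_fun :: "ccirc \<Rightarrow> bfun" where
  "ccirc_fun C = ccirc_eval (\<lambda>_. []) C"

primrec cgate_size :: "cgate \<Rightarrow> nat" where
  "cgate_size (Nand i j) = 1"
| "cgate_size (CQuery is) = 1 + length is"

definition ccirc_size :: "ccirc \<Rightarrow> nat" where
  "ccirc_size C = cc_in C + sum_list (map cgate_size (cc_gates C)) + length (cc_out C)"

text \<open>A vector with computational basis \<open>'a\<close> is its amplitude function. A linear map is given by
  the images of the basis states, so that applying it is a monadic bind. A protocol written in
  this monad is its purification: a basis label that is still present in the final result has
  been kept in a register, whereas branches ending in equal labels interfere.\<close>

type_synonym 'a ket = "'a \<Rightarrow> complex"

definition qreturn :: "'a \<Rightarrow> 'a ket" where
  "qreturn a = (\<lambda>b. if b = a then 1 else 0)"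

definition qbind :: "'a ket \<Rightarrow> ('a \<Rightarrow> 'b ket) \<Rightarrow> 'b ket" where
  "qbind \<psi> V = (\<lambda>b. \<Sum>a | \<psi> a \<noteq> 0. \<psi> a * V a b)"

adhoc_overloading Monad_Syntax.bind \<rightleftharpoons> qbind

definition qphase :: "complex \<Rightarrow> 'a \<Rightarrow> 'a ket" where
  "qphase z a = (\<lambda>b. if b = a then z else 0)"

definition qadjoint :: "('a \<Rightarrow> 'b ket) \<Rightarrow> 'b \<Rightarrow> 'a ket" where
  "qadjoint V b = (\<lambda>a. cnj (V a b))"

definition measure_ket :: "'a ket \<Rightarrow> 'a pmf" where
  "measure_ket \<psi> = embed_pmf (\<lambda>a. (cmod (\<psi> a))\<^sup>2)"

definition density_qubit :: "complex mat \<Rightarrow> bool" where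
  "density_qubit \<rho> \<longleftrightarrow> \<rho> \<in> carrier_mat 2 2 \<and> \<rho> $$ (0, 0) + \<rho> $$ (1, 1) = 1
     \<and> (\<forall>v \<in> carrier_vec 2. 0 \<le> (\<rho> *\<^sub>v v) \<bullet>c v)"

text \<open>The outcome distribution of measuring \<open>V \<rho> V\<^sup>\<dagger>\<close> in the computational basis.\<close>

definition measure_qubit :: "complex mat \<Rightarrow> (bool \<Rightarrow> 'a ket) \<Rightarrow> 'a pmf" where
  "measure_qubit \<rho> V = embed_pmf (\<lambda>a.
     Re (\<Sum>b\<in>UNIV. \<Sum>b'\<in>UNIV. V b a * \<rho> $$ (of_bool b, of_bool b') * cnj (V b' a)))"

definition hadamard :: "bool \<Rightarrow> bool ket" where
  "hadamard b = (\<lambda>c. (if b \<and> c then - 1 else 1) / sqrt 2)"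

definition hadamard_vec :: "bitvec \<Rightarrow> bitvec ket" where
  "hadamard_vec u = (\<lambda>v. if v \<in> carrier_vec (dim_vec u)
     then (if u \<bullet> v = 1 then - 1 else 1) / sqrt (2 ^ dim_vec u) else 0)"

definition uniform_ket :: "nat \<Rightarrow> bitvec ket" where
  "uniform_ket l = (\<lambda>x. if x \<in> carrier_vec l then 1 / sqrt (2 ^ l) else 0)"

datatype qgate =
    GX nat | GH nat | GT nat | GCX nat nat | GCCX nat nat nat
  | GQuery "nat list" "nat list"

record qcirc =
  qc_wires :: nat
  qc_gates :: "qgate list"

primrec qgate_wires :: "qgate \<Rightarrow> nat list" where
  "qgate_wires (GX i) = [i]"
| "qgate_wires (GH i) = [i]"
| "qgate_wires (GT i) = [i]"
| "qgate_wires (GCX i j) = [i, j]"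
| "qgate_wires (GCCX i j l) = [i, j, l]"
| "qgate_wires (GQuery is os) = is @ os"

definition qcirc_wf :: "qcirc \<Rightarrow> bool" where
  "qcirc_wf C \<longleftrightarrow>
     (\<forall>g \<in> set (qc_gates C). distinct (qgate_wires g) \<and> set (qgate_wires g) \<subseteq> {..<qc_wires C})"

definition flip_wire :: "nat \<Rightarrow> bool \<Rightarrow> bool list \<Rightarrow> bool list" where
  "flip_wire i v w = w[i := (w ! i \<noteq> v)]"

primrec qgate_ket :: "bfun \<Rightarrow> qgate \<Rightarrow> bool list \<Rightarrow> bool list ket" where
  "qgate_ket O' (GX i) w = qreturn (flip_wire i True w)"
| "qgate_ket O' (GH i) w = do { v \<leftarrow> hadamard (w ! i); qreturn (w[i := v]) }"
| "qgate_ket O' (GT i) w = qphase (if w ! i then cis (pi / 4) else 1) w"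
| "qgate_ket O' (GCX i j) w = qreturn (flip_wire j (w ! i) w)"
| "qgate_ket O' (GCCX i j l) w = qreturn (flip_wire l (w ! i \<and> w ! j) w)"
| "qgate_ket O' (GQuery is os) w =
     qreturn (fold (\<lambda>(i, v). flip_wire i v) (zip os (O' (map ((!) w) is))) w)"

primrec qgates_ket :: "bfun \<Rightarrow> qgate list \<Rightarrow> bool list \<Rightarrow> bool list ket" where
  "qgates_ket O' [] w = qreturn w"
| "qgates_ket O' (g # gs) w = do { w' \<leftarrow> qgate_ket O' g w; qgates_ket O' gs w' }"

text \<open>Missing input wires are ancillas initialised to zero.\<close>

definition qcirc_ket :: "bfun \<Rightarrow> qcirc \<Rightarrow> bool list \<Rightarrow> bool list ket" where
  "qcirc_ket O' C w = qgates_ket O' (qc_gates C) (w @ replicate (qc_wires C - length w) False)"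

definition qcirc_run :: "bfun \<Rightarrow> qcirc \<Rightarrow> bool list pmf" where
  "qcirc_run O' C = measure_ket (qcirc_ket O' C [])"

text \<open>QPT is taken in the non-uniform sense. Gates act on distinct wires, so a query gate is never
  larger than the number of wires.\<close>

definition qpt :: "(nat \<Rightarrow> qcirc) \<Rightarrow> bool" where
  "qpt C \<longleftrightarrow> (\<forall>\<eta>. qcirc_wf (C \<eta>)) \<and> poly_bounded (\<lambda>\<eta>. qc_wires (C \<eta>) + length (qc_gates (C \<eta>)))"

text \<open>The first \<open>oss_vk_len\<close> output wires of \<open>oss_gen\<close> hold the verification key, the next
  \<open>oss_sk_len\<close> wires the quantum key; the remaining wires are discarded. The first
  \<open>oss_sig_len\<close> output wires of \<open>oss_sign\<close> hold the signature.\<close>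

record oss =
  oss_coins :: "nat \<Rightarrow> nat"
  oss_vk_len :: "nat \<Rightarrow> nat"
  oss_sk_len :: "nat \<Rightarrow> nat"
  oss_sig_len :: "nat \<Rightarrow> nat"
  oss_setup :: "nat \<Rightarrow> bool list \<Rightarrow> ccirc"
  oss_gen :: "nat \<Rightarrow> qcirc"
  oss_sign :: "nat \<Rightarrow> bool \<Rightarrow> qcirc"
  oss_ver :: "nat \<Rightarrow> ccirc"

definition oss_oracle :: "oss \<Rightarrow> nat \<Rightarrow> bool list \<Rightarrow> bfun" where
  "oss_oracle S \<eta> R1 = ccirc_fun (oss_setup S \<eta> R1)"

definition oss_gen_ket :: "oss \<Rightarrow> nat \<Rightarrow> bfun \<Rightarrow> (bool list \<times> bool list \<times> bool list) ket" where
  "oss_gen_ket S \<eta> O' = do {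
     w \<leftarrow> qcirc_ket O' (oss_gen S \<eta>) [];
     qreturn (take (oss_vk_len S \<eta>) w,
              take (oss_sk_len S \<eta>) (drop (oss_vk_len S \<eta>) w),
              drop (oss_vk_len S \<eta> + oss_sk_len S \<eta>) w)
   }"

definition oss_sign_init :: "oss \<Rightarrow> nat \<Rightarrow> bool \<Rightarrow> bool list \<Rightarrow> bool list" where
  "oss_sign_init S \<eta> m sk = sk @ replicate (qc_wires (oss_sign S \<eta> m) - length sk) False"

definition oss_sign_ket :: "oss \<Rightarrow> nat \<Rightarrow> bfun \<Rightarrow> bool \<Rightarrow> bool list \<Rightarrow> bool list ket" where
  "oss_sign_ket S \<eta> O' m = qgates_ket O' (qc_gates (oss_sign S \<eta> m))"

definition oss_accepts :: "oss \<Rightarrow> nat \<Rightarrow> bfun \<Rightarrow> bool list \<Rightarrow> bool \<Rightarrow> bool list \<Rightarrow> bool" where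
  "oss_accepts S \<eta> O' vk m \<sigma> \<longleftrightarrow> ccirc_eval O' (oss_ver S \<eta>) (vk @ [m] @ \<sigma>) = [True]"

definition oss_honest :: "oss \<Rightarrow> nat \<Rightarrow> bool \<Rightarrow> bool pmf" where
  "oss_honest S \<eta> m = do {
     R1 \<leftarrow> uniform_bits (oss_coins S \<eta>);
     let O' = oss_oracle S \<eta> R1;
     (vk, g, w) \<leftarrow> measure_ket (do {
       (vk, sk, g) \<leftarrow> oss_gen_ket S \<eta> O';
       w \<leftarrow> oss_sign_ket S \<eta> O' m (oss_sign_init S \<eta> m sk);
       qreturn (vk, g, w)
     });
     return_pmf (oss_accepts S \<eta> O' vk m (take (oss_sig_len S \<eta>) w))
   }"

text \<open>The adversary's output tuple is read off its first wires.\<close>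

definition oss_forge :: "oss \<Rightarrow> (nat \<Rightarrow> qcirc) \<Rightarrow> nat \<Rightarrow> bool pmf" where
  "oss_forge S \<A> \<eta> = do {
     R1 \<leftarrow> uniform_bits (oss_coins S \<eta>);
     let O' = oss_oracle S \<eta> R1;
     w \<leftarrow> qcirc_run O' (\<A> \<eta>);
     let out = fit (oss_vk_len S \<eta> + 2 + 2 * oss_sig_len S \<eta>) w;
     let vk = take (oss_vk_len S \<eta>) out;
     let m0 = out ! oss_vk_len S \<eta>;
     let m1 = out ! (oss_vk_len S \<eta> + 1);
     let \<sigma>0 = take (oss_sig_len S \<eta>) (drop (oss_vk_len S \<eta> + 2) out);
     let \<sigma>1 = drop (oss_vk_len S \<eta> + 2 + oss_sig_len S \<eta>) out;
     return_pmf (oss_accepts S \<eta> O' vk m0 \<sigma>0 \<and> oss_accepts S \<eta> O' vk m1 \<sigma>1 \<and> \<sigma>0 \<noteq> \<sigma>1)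
   }"

text \<open>Efficiency of \<open>oss_setup\<close> is expressed by its consequence that the oracle can be evaluated
  from the coins by polynomial-size circuits.\<close>

definition oss_efficient :: "oss \<Rightarrow> bool" where
  "oss_efficient S \<longleftrightarrow>
     poly_bounded (oss_coins S)
     \<and> (\<exists>p. poly_bounded p \<and>
          (\<forall>\<eta> R1. length R1 = oss_coins S \<eta> \<longrightarrow> ccirc_size (oss_setup S \<eta> R1) \<le> p \<eta>))
     \<and> (\<exists>C. poly_bounded (\<lambda>\<eta>. ccirc_size (C \<eta>)) \<and>
          (\<forall>\<eta> R1 q. length R1 = oss_coins S \<eta> \<longrightarrow> length q = cc_in (oss_setup S \<eta> R1) \<longrightarrow>
             ccirc_fun (C \<eta>) (R1 @ q) = oss_oracle S \<eta> R1 q))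
     \<and> qpt (oss_gen S) \<and> (\<forall>m. qpt (\<lambda>\<eta>. oss_sign S \<eta> m))
     \<and> poly_bounded (\<lambda>\<eta>. ccirc_size (oss_ver S \<eta>))
     \<and> (\<forall>\<eta>. oss_vk_len S \<eta> + oss_sk_len S \<eta> \<le> qc_wires (oss_gen S \<eta>))
     \<and> (\<forall>\<eta> m. max (oss_sk_len S \<eta>) (oss_sig_len S \<eta>) \<le> qc_wires (oss_sign S \<eta> m))"

definition oss_correct :: "oss \<Rightarrow> bool" where
  "oss_correct S \<longleftrightarrow> (\<forall>m. negl (\<lambda>\<eta>. 1 - pmf (oss_honest S \<eta> m) True))"

definition oss_strongly_unforgeable :: "oss \<Rightarrow> bool" where
  "oss_strongly_unforgeable S \<longleftrightarrow> (\<forall>\<A>. qpt \<A> \<longrightarrow> negl (\<lambda>\<eta>. pmf (oss_forge S \<A> \<eta>) True))"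

definition one_shot_signature :: "oss \<Rightarrow> bool" where
  "one_shot_signature S \<longleftrightarrow> oss_efficient S \<and> oss_correct S \<and> oss_strongly_unforgeable S"

definition par_s :: "nat \<Rightarrow> nat" where "par_s \<eta> = 16 * \<eta>"
definition par_r :: "nat \<Rightarrow> nat" where "par_r \<eta> = par_s \<eta> * (\<eta> - 1)"
definition par_n :: "nat \<Rightarrow> nat" where "par_n \<eta> = par_r \<eta> + 3 * par_s \<eta> div 2"
definition par_k :: "nat \<Rightarrow> nat" where "par_k \<eta> = par_n \<eta>"

text \<open>The coins of the setup are the permutation \<open>\<pi>\<close> and the functions \<open>y \<mapsto> A\<^sub>y\<close>, \<open>y \<mapsto> b\<^sub>y\<close>
  themselves, each uniform on its range.\<close>

type_synonym obar_coins =
  "(bitvec \<Rightarrow> bitvec) \<times> (bitvec \<Rightarrow> bit mat) \<times> (bitvec \<Rightarrow> bitvec)"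

definition full_rank_mats :: "nat \<Rightarrow> nat \<Rightarrow> bit mat set" where
  "full_rank_mats k l = {A \<in> carrier_mat k l. vec_space.rank k A = min k l}"

definition obar_coin_space :: "nat \<Rightarrow> obar_coins set" where
  "obar_coin_space \<eta> =
     {\<pi>. \<pi> permutes carrier_vec (par_n \<eta>)}
     \<times> (carrier_vec (par_r \<eta>) \<rightarrow>\<^sub>E full_rank_mats (par_k \<eta>) (par_n \<eta> - par_r \<eta>))
     \<times> (carrier_vec (par_r \<eta>) \<rightarrow>\<^sub>E carrier_vec (par_k \<eta>))"

record obar =
  obar_P :: "bitvec \<Rightarrow> bitvec \<times> bitvec"
  obar_Pinv :: "bitvec \<Rightarrow> bitvec \<Rightarrow> bitvec option"
  obar_D :: "bitvec \<Rightarrow> bitvec \<Rightarrow> bool"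

definition obar_setup :: "nat \<Rightarrow> obar_coins \<Rightarrow> obar" where
  "obar_setup \<eta> = (\<lambda>(\<pi>, A, b). \<lparr>
     obar_P = (\<lambda>x. let y = vec_first (\<pi> x) (par_r \<eta>);
                       z = vec_last (\<pi> x) (par_n \<eta> - par_r \<eta>)
                   in (y, A y *\<^sub>v z + b y)),
     obar_Pinv = (\<lambda>y u.
       let Z = {z \<in> carrier_vec (par_n \<eta> - par_r \<eta>). u = A y *\<^sub>v z + b y}
       in if Z = {} then None else Some (inv_into UNIV \<pi> (y @\<^sub>v (THE z. z \<in> Z)))),
     obar_D = (\<lambda>y v. transpose_mat (A y) *\<^sub>v v = 0\<^sub>v (par_n \<eta> - par_r \<eta>)) \<rparr>)"

definition coset_S :: "nat \<Rightarrow> obar_coins \<Rightarrow> bitvec \<Rightarrow> bitvec set" where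
  "coset_S \<eta> = (\<lambda>(\<pi>, A, b) y. (\<lambda>x. A y *\<^sub>v x + b y) ` carrier_vec (par_n \<eta> - par_r \<eta>))"

definition coset_S_bit :: "nat \<Rightarrow> obar_coins \<Rightarrow> bitvec \<Rightarrow> bool \<Rightarrow> bitvec set" where
  "coset_S_bit \<eta> \<omega> y b = {u \<in> coset_S \<eta> \<omega> y. u $ 0 = of_bool b}"

definition S_perp :: "nat \<Rightarrow> obar_coins \<Rightarrow> bitvec \<Rightarrow> bitvec set" where
  "S_perp \<eta> \<omega> y = {v \<in> carrier_vec (par_k \<eta>). obar_D (obar_setup \<eta> \<omega>) y v}"

text \<open>The register of \<open>x\<close> is uncomputed by adding \<open>P\<^sup>-\<^sup>1\<close>, and is kept as the third component.
  The measurement of \<open>y\<close> is deferred: \<open>y\<close> is part of the classical output.\<close>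

definition obar_gen_ket :: "nat \<Rightarrow> (bitvec \<Rightarrow> bitvec \<times> bitvec) \<Rightarrow>
    (bitvec \<Rightarrow> bitvec \<Rightarrow> bitvec option) \<Rightarrow> (bitvec \<times> bitvec \<times> bitvec) ket" where
  "obar_gen_ket \<eta> P Pinv = do {
     x \<leftarrow> uniform_ket (par_n \<eta>);
     let (y, u) = P x;
     qreturn (y, u, x + (case Pinv y u of None \<Rightarrow> 0\<^sub>v (par_n \<eta>) | Some x' \<Rightarrow> x'))
   }"

record prf_family =
  prf_key_len :: "nat \<Rightarrow> nat"
  prf_eval :: "nat \<Rightarrow> bool list \<Rightarrow> bool list \<Rightarrow> obar_coins"

text \<open>Since a coin value is exponentially long, access to a function \<open>f\<close> from \<open>l\<close>-bit strings to
  coins is random access: the query \<open>(vk, x, y)\<close> is answered by \<open>\<pi>(x)\<close>, \<open>A\<^sub>y\<close> (row by row) and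
  \<open>b\<^sub>y\<close>, where \<open>(\<pi>, A, b) = f vk\<close>.\<close>

definition coin_oracle :: "nat \<Rightarrow> nat \<Rightarrow> (bool list \<Rightarrow> obar_coins) \<Rightarrow> bfun" where
  "coin_oracle l \<eta> f q =
     (let q' = fit (l + par_n \<eta> + par_r \<eta>) q;
          x = vec_of_bits (take (par_n \<eta>) (drop l q'));
          y = vec_of_bits (drop (l + par_n \<eta>) q');
          (\<pi>, A, b) = f (take l q')
      in bits_of_vec (\<pi> x) @ concat (map bits_of_vec (rows (A y))) @ bits_of_vec (b y))"

definition prf_real :: "(nat \<Rightarrow> nat) \<Rightarrow> prf_family \<Rightarrow> (nat \<Rightarrow> qcirc) \<Rightarrow> nat \<Rightarrow> bool pmf" where
  "prf_real l F \<D> \<eta> = do {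
     \<kappa> \<leftarrow> uniform_bits (prf_key_len F \<eta>);
     w \<leftarrow> qcirc_run (coin_oracle (l \<eta>) \<eta> (prf_eval F \<eta> \<kappa>)) (\<D> \<eta>);
     return_pmf (take 1 w = [True])
   }"

definition prf_ideal :: "(nat \<Rightarrow> nat) \<Rightarrow> (nat \<Rightarrow> qcirc) \<Rightarrow> nat \<Rightarrow> bool pmf" where
  "prf_ideal l \<D> \<eta> = do {
     f \<leftarrow> pmf_of_set ({vk. length vk = l \<eta>} \<rightarrow>\<^sub>E obar_coin_space \<eta>);
     w \<leftarrow> qcirc_run (coin_oracle (l \<eta>) \<eta> f) (\<D> \<eta>);
     return_pmf (take 1 w = [True])
   }"

definition pseudorandom_function :: "(nat \<Rightarrow> nat) \<Rightarrow> prf_family \<Rightarrow> bool" where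
  "pseudorandom_function l F \<longleftrightarrow>
     (\<forall>\<eta> \<kappa> vk. length \<kappa> = prf_key_len F \<eta> \<longrightarrow> length vk = l \<eta> \<longrightarrow>
        prf_eval F \<eta> \<kappa> vk \<in> obar_coin_space \<eta>)
     \<and> poly_bounded (prf_key_len F)
     \<and> (\<exists>C. poly_bounded (\<lambda>\<eta>. ccirc_size (C \<eta>)) \<and>
          (\<forall>\<eta> \<kappa> q. length \<kappa> = prf_key_len F \<eta> \<longrightarrow> length q = l \<eta> + par_n \<eta> + par_r \<eta> \<longrightarrow>
             ccirc_fun (C \<eta>) (\<kappa> @ q) = coin_oracle (l \<eta>) \<eta> (prf_eval F \<eta> \<kappa>) q))
     \<and> (\<forall>\<D>. qpt \<D> \<longrightarrow>
          negl (\<lambda>\<eta>. \<bar>pmf (prf_real l F \<D> \<eta>) True - pmf (prf_ideal l \<D> \<eta>) True\<bar>))"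

record commitment_key =
  ck_O :: bfun
  ck_P :: "bool list \<Rightarrow> bitvec \<Rightarrow> bitvec \<times> bitvec"
  ck_Pinv :: "bool list \<Rightarrow> bitvec \<Rightarrow> bitvec \<Rightarrow> bitvec option"
  ck_D :: "bool list \<Rightarrow> bool list \<Rightarrow> bitvec \<Rightarrow> bitvec \<Rightarrow> bool option"

type_synonym decoding_key = "bool list \<times> bool list"
type_synonym commitment = "bool list \<times> bool list \<times> bitvec"

definition pfc_gen :: "oss \<Rightarrow> prf_family \<Rightarrow> nat \<Rightarrow> (bool list \<times> bool list) \<Rightarrow>
    commitment_key \<times> decoding_key" where
  "pfc_gen S F \<eta> = (\<lambda>(R1, R2).
     let O' = oss_oracle S \<eta> R1;
         \<kappa> = R2;
         ob = (\<lambda>vk. obar_setup \<eta> (prf_eval F \<eta> \<kappa> vk))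
     in (\<lparr> ck_O = O',
           ck_P = (\<lambda>vk x. obar_P (ob vk) x),
           ck_Pinv = (\<lambda>vk y u. obar_Pinv (ob vk) y u),
           ck_D = (\<lambda>vk \<sigma> y u. if oss_accepts S \<eta> O' vk False \<sigma>
                               then Some (\<not> obar_D (ob vk) y u) else None) \<rparr>,
         (R1, \<kappa>)))"

definition pfc_keys :: "oss \<Rightarrow> prf_family \<Rightarrow> nat \<Rightarrow> (commitment_key \<times> decoding_key) pmf" where
  "pfc_keys S F \<eta> = do {
     R1 \<leftarrow> uniform_bits (oss_coins S \<eta>);
     R2 \<leftarrow> uniform_bits (prf_key_len F \<eta>);
     return_pmf (pfc_gen S F \<eta> (R1, R2))
   }"

text \<open>\<open>(-1)\<^sup>\<bottom>\<close> is read as 1.\<close>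

definition phase_sign :: "bool option \<Rightarrow> complex" where
  "phase_sign d = (case d of Some True \<Rightarrow> - 1 | _ \<Rightarrow> 1)"

type_synonym garbage = "bool list \<times> bitvec \<times> bool \<times> bool list \<times> bool list"

text \<open>The purification of \<open>Com(b)\<close>. The components of \<open>c\<close> are never changed after they are
  produced, so their measurement is deferred to the end; the intermediate outcome \<open>b'\<close> and all
  other left-over registers are collected in the last component and are traced out.\<close>

definition com_ket :: "oss \<Rightarrow> nat \<Rightarrow> commitment_key \<Rightarrow> bool \<Rightarrow> (commitment \<times> bitvec \<times> garbage) ket"
  where
  "com_ket S \<eta> CK b = do {
     let sign = oss_sign_ket S \<eta> (ck_O CK);
     (vk, sk, g) \<leftarrow> oss_gen_ket S \<eta> (ck_O CK);
     w0 \<leftarrow> sign False (oss_sign_init S \<eta> False sk);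
     (y, u, x) \<leftarrow> obar_gen_ket \<eta> (ck_P CK vk) (ck_Pinv CK vk);
     let b' = (u $ 0 = 1);
     u' \<leftarrow> (if b' = b then qreturn u
            else do {
              v \<leftarrow> hadamard_vec u;
              v \<leftarrow> qphase (phase_sign (ck_D CK vk (take (oss_sig_len S \<eta>) w0) y v)) v;
              hadamard_vec v
            });
     w \<leftarrow> qadjoint (sign False) w0;
     w1 \<leftarrow> sign True (oss_sign_init S \<eta> True (take (oss_sk_len S \<eta>) w));
     qreturn ((vk, take (oss_sig_len S \<eta>) w1, y), u',
              (g, x, b', drop (oss_sk_len S \<eta>) w, drop (oss_sig_len S \<eta>) w1))
   }"

definition com_qubit_ket :: "oss \<Rightarrow> nat \<Rightarrow> commitment_key \<Rightarrow> bool \<Rightarrow>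
    (bool \<times> bitvec \<times> commitment \<times> garbage) ket" where
  "com_qubit_ket S \<eta> CK b = do {
     (c, u, g) \<leftarrow> com_ket S \<eta> CK b;
     qreturn (b, u, c, g)
   }"

definition decZ :: "oss \<Rightarrow> prf_family \<Rightarrow> nat \<Rightarrow> decoding_key \<Rightarrow> commitment \<Rightarrow> bool \<times> bitvec \<Rightarrow> bool option"
  where
  "decZ S F \<eta> = (\<lambda>(R1, \<kappa>) (vk, \<sigma>, y) (b, u).
     if \<not> oss_accepts S \<eta> (oss_oracle S \<eta> R1) vk True \<sigma> then None
     else if u \<in> coset_S_bit \<eta> (prf_eval F \<eta> \<kappa> vk) y b then Some b else None)"

definition decX :: "oss \<Rightarrow> prf_family \<Rightarrow> nat \<Rightarrow> decoding_key \<Rightarrow> commitment \<Rightarrow> bool \<times> bitvec \<Rightarrow> bool option"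
  where
  "decX S F \<eta> = (\<lambda>(R1, \<kappa>) (vk, \<sigma>, y) (b', u).
     let T = S_perp \<eta> (prf_eval F \<eta> \<kappa> vk) y in
     if \<not> oss_accepts S \<eta> (oss_oracle S \<eta> R1) vk True \<sigma> then None
     else if u \<in> T then Some b'
     else if u + unit_vec (par_n \<eta>) 0 \<in> T then Some (\<not> b')
     else None)"

definition measZ :: "complex mat \<Rightarrow> bool option pmf" where
  "measZ \<rho> = map_pmf Some (measure_qubit \<rho> qreturn)"

definition measX :: "complex mat \<Rightarrow> bool option pmf" where
  "measX \<rho> = map_pmf Some (measure_qubit \<rho> hadamard)"

definition PFCZ :: "oss \<Rightarrow> prf_family \<Rightarrow> nat \<Rightarrow> complex mat \<Rightarrow> bool option pmf" where
  "PFCZ S F \<eta> \<rho> = do {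
     (CK, dk) \<leftarrow> pfc_keys S F \<eta>;
     (b, u, c, g) \<leftarrow> measure_qubit \<rho> (com_qubit_ket S \<eta> CK);
     return_pmf (decZ S F \<eta> dk c (b, u))
   }"

definition PFCX :: "oss \<Rightarrow> prf_family \<Rightarrow> nat \<Rightarrow> complex mat \<Rightarrow> bool option pmf" where
  "PFCX S F \<eta> \<rho> = do {
     (CK, dk) \<leftarrow> pfc_keys S F \<eta>;
     (b, u, c, g) \<leftarrow> measure_qubit \<rho> (\<lambda>b. do {
       (b, u, c, g) \<leftarrow> com_qubit_ket S \<eta> CK b;
       b' \<leftarrow> hadamard b;
       u' \<leftarrow> hadamard_vec u;
       qreturn (b', u', c, g)
     });
     return_pmf (decX S F \<eta> dk c (b, u))
   }"

end

theory Submission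
  imports Defs "HOL-Real_Asymp.Real_Asymp"
begin

text \<open>Replace the phase in \<open>Com\<close> by the one that ignores the signature register. By correctness of the
  one-shot signature this moves the state by a negligible amount in norm, and then the signing of 0
  is undone exactly, so the signature of 1 is honest and accepted. If the first row of \<open>A\<^sub>y\<close> is
  nonzero, the Fourier transforms of the two halves of the coset \<open>S\<^sub>y\<close> agree on the dual, are
  opposite on the dual shifted by the first unit vector, and vanish elsewhere. Hence the phase
  exchanges the halves, \<open>Com(b)\<close> leaves the uniform superposition over the half \<open>S\<^bsub>y,b\<^esub>\<close>, and measuring in
  the Hadamard basis gives the Hadamard measurement of the qubit up to the flip that \<open>DecX\<close>
  undoes. The first row of a uniform full-rank matrix vanishes with exponentially small
  probability, and a distinguisher with \<open>vk\<close> and \<open>y\<close> hard-wired transfers this to the coins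
  produced by the pseudorandom function.\<close>

section \<open>Kets and isometries\<close>

text \<open>\<open>Com\<close> is run coherently on the qubit, so it is not enough that
  \<open>Com(0)\<close> and \<open>Com(1)\<close> each fail rarely: the off-diagonal entries of the
  density matrix make the two branches interfere. Hence errors are squared distances between states,
  bad branches are projected away instead of conditioned on, and what remains is factorised into an
  amplitude that does not know the bit and the amplitude of the direct measurement of the qubit. A
  distance enters outcome probabilities through cross terms, that is, through a square root, whereas
  correctness and pseudorandomness only control errors averaged over the keys. The cross terms are
  therefore split by \<open>2 * x * y \<le> t * x^2 + y^2 / t\<close> with one \<open>t\<close> for
  all keys. The bound is then affine in the squared errors, is averaged first, and only afterwards
  is \<open>t\<close> set to the root of the averaged error. Only lower bounds on decoding to each
  bit are proved. Direct measurement never yields \<open>None\<close>, so these already bound the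
  total variation distance.\<close>

definition qsupp :: "'a ket \<Rightarrow> 'a set" where
  "qsupp \<psi> = {a. \<psi> a \<noteq> 0}"

text \<open>Sums over an infinite set are 0 by convention, so \<open>qbind\<close>,
  \<open>qinner\<close> and \<open>qprob\<close> are meaningful only for finite support. Strings and
  vectors of fixed length keep the supports below finite.\<close>

abbreviation qfin :: "'a ket \<Rightarrow> bool" where
  "qfin \<psi> \<equiv> finite (qsupp \<psi>)"

definition qinner :: "'a ket \<Rightarrow> 'a ket \<Rightarrow> complex" where
  "qinner \<psi> \<phi> = (\<Sum>a\<in>qsupp \<psi>. \<psi> a * cnj (\<phi> a))"

definition qprob :: "'a ket \<Rightarrow> 'a set \<Rightarrow> real" where
  "qprob \<psi> A = (\<Sum>a\<in>qsupp \<psi> \<inter> A. (cmod (\<psi> a))\<^sup>2)"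

abbreviation qnorm2 :: "'a ket \<Rightarrow> real" where
  "qnorm2 \<psi> \<equiv> qprob \<psi> UNIV"

lemma not_in_qsupp: "a \<notin> qsupp \<psi> \<longleftrightarrow> \<psi> a = 0"
  by (simp add: qsupp_def)

text \<open>The sum in \<open>qbind\<close> ranges over a support that depends on the ket. Before
  two kets are subtracted or two sums exchanged, both are spread over a common finite set, where the
  extra terms vanish.\<close>

lemma qbind_superset:
  assumes "finite X" "qsupp \<psi> \<subseteq> X"
  shows "qbind \<psi> V b = (\<Sum>a\<in>X. \<psi> a * V a b)"
proof -
  have "qbind \<psi> V b = (\<Sum>a\<in>qsupp \<psi>. \<psi> a * V a b)"
    by (simp add: qbind_def qsupp_def)
  also have "\<dots> = (\<Sum>a\<in>X. \<psi> a * V a b)"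
    using assms by (intro sum.mono_neutral_left) (auto simp: qsupp_def)
  finally show ?thesis .
qed

lemma qbind_supp: "qbind \<psi> V b = (\<Sum>a\<in>qsupp \<psi>. \<psi> a * V a b)"
  by (simp add: qbind_def qsupp_def)

lemma qinner_superset:
  assumes "finite X" "qsupp \<psi> \<subseteq> X"
  shows "qinner \<psi> \<phi> = (\<Sum>a\<in>X. \<psi> a * cnj (\<phi> a))"
  unfolding qinner_def using assms
  by (intro sum.mono_neutral_left) (auto simp: qsupp_def)

lemma qprob_superset:
  assumes "finite X" "qsupp \<psi> \<inter> A \<subseteq> X" "X \<subseteq> A"
  shows "qprob \<psi> A = (\<Sum>a\<in>X. (cmod (\<psi> a))\<^sup>2)"
  unfolding qprob_def using assms
  by (intro sum.mono_neutral_left) (auto simp: qsupp_def)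

lemma qbind_cong:
  assumes "\<And>a. a \<in> qsupp \<psi> \<Longrightarrow> V a = W a"
  shows "qbind \<psi> V = qbind \<psi> W"
  by (rule ext) (simp add: qbind_supp assms)

lemma qsupp_bind: "qsupp (qbind \<psi> V) \<subseteq> (\<Union>a\<in>qsupp \<psi>. qsupp (V a))"
proof
  fix b assume "b \<in> qsupp (qbind \<psi> V)"
  then have "(\<Sum>a\<in>qsupp \<psi>. \<psi> a * V a b) \<noteq> 0"
    by (simp add: qsupp_def[of "qbind \<psi> V"] qbind_supp)
  then obtain a where "a \<in> qsupp \<psi>" "\<psi> a * V a b \<noteq> 0"
    by (rule sum.not_neutral_contains_not_neutral)
  then show "b \<in> (\<Union>a\<in>qsupp \<psi>. qsupp (V a))"
    by (auto simp: qsupp_def)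
qed

lemma qfin_bind:
  assumes "qfin \<psi>" "\<And>a. a \<in> qsupp \<psi> \<Longrightarrow> qfin (V a)"
  shows "qfin (qbind \<psi> V)"
  by (rule finite_subset[OF qsupp_bind]) (use assms in auto)

lemma qsupp_return [simp]: "qsupp (qreturn a) = {a}"
  by (auto simp: qsupp_def qreturn_def)

lemma qsupp_phase: "qsupp (qphase z a) \<subseteq> {a}"
  by (auto simp: qsupp_def qphase_def)

lemma qreturn_bind [simp]: "qbind (qreturn a) V = V a"
  by (rule ext) (simp add: qbind_supp, simp add: qreturn_def)

lemma qphase_bind: "qbind (qphase z a) V = (\<lambda>b. z * V a b)"
  by (rule ext, subst qbind_superset[of "{a}"]) (auto simp: qsupp_def qphase_def)

lemma qbind_assoc:
  assumes "qfin \<psi>" "\<And>a. a \<in> qsupp \<psi> \<Longrightarrow> qfin (V a)"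
  shows "qbind (qbind \<psi> V) W = qbind \<psi> (\<lambda>a. qbind (V a) W)"
proof (rule ext)
  fix c
  let ?X = "\<Union>a\<in>qsupp \<psi>. qsupp (V a)"
  have X: "finite ?X" using assms by auto
  have "qbind (qbind \<psi> V) W c = (\<Sum>b\<in>?X. (\<Sum>a\<in>qsupp \<psi>. \<psi> a * V a b) * W b c)"
    by (subst qbind_superset[OF X qsupp_bind]) (simp add: qbind_supp)
  also have "\<dots> = (\<Sum>a\<in>qsupp \<psi>. \<psi> a * (\<Sum>b\<in>?X. V a b * W b c))"
    by (simp add: sum_distrib_left sum_distrib_right mult.assoc) (rule sum.swap)
  also have "\<dots> = qbind \<psi> (\<lambda>a. qbind (V a) W) c"
    unfolding qbind_supp[of \<psi>]
    by (intro sum.cong refl arg_cong2[where f = "(*)"] qbind_superset[symmetric] X) auto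
  finally show "qbind (qbind \<psi> V) W c = qbind \<psi> (\<lambda>a. qbind (V a) W) c" .
qed

text \<open>Two preparations that do not depend on each other may be swapped. In
  \<open>ideal_ket_eq\<close> this brings the signing of 0 next to its inverse.\<close>

lemma qbind_commute:
  "qbind \<psi> (\<lambda>a. qbind \<phi> (\<lambda>b. V a b)) = qbind \<phi> (\<lambda>b. qbind \<psi> (\<lambda>a. V a b))"
  by (rule ext, simp add: qbind_supp sum_distrib_left)
    (subst sum.swap, simp add: mult.left_commute)

text \<open>The scalar \<open>z\<close> and the two maps let one statement serve twice: with
  \<open>z = 1\<close> an isometry preserves inner products, with \<open>z = 0\<close> differing
  labels make the images orthogonal whatever the amplitudes are.\<close>

lemma qinner_bind:
  assumes "qfin \<psi>" "qfin \<phi>"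
    and "\<And>a. a \<in> qsupp \<psi> \<Longrightarrow> qfin (V a)" "\<And>a. a \<in> qsupp \<phi> \<Longrightarrow> qfin (W a)"
    and eq: "\<And>a b. a \<in> qsupp \<psi> \<Longrightarrow> b \<in> qsupp \<phi> \<Longrightarrow>
        qinner (V a) (W b) = (if a = b then z else 0)"
  shows "qinner (qbind \<psi> V) (qbind \<phi> W) = z * qinner \<psi> \<phi>"
proof -
  let ?X = "(\<Union>a\<in>qsupp \<psi>. qsupp (V a))"
  have X: "finite ?X" using assms by auto
  have "qinner (qbind \<psi> V) (qbind \<phi> W)
      = (\<Sum>c\<in>?X. (\<Sum>a\<in>qsupp \<psi>. \<psi> a * V a c) * (\<Sum>b\<in>qsupp \<phi>. cnj (\<phi> b) * cnj (W b c)))"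
    by (subst qinner_superset[OF X qsupp_bind]) (simp add: qbind_supp)
  also have "\<dots> = (\<Sum>c\<in>?X. \<Sum>a\<in>qsupp \<psi>. \<Sum>b\<in>qsupp \<phi>.
        \<psi> a * cnj (\<phi> b) * (V a c * cnj (W b c)))"
    unfolding sum_product by (intro sum.cong refl) (simp add: algebra_simps)
  also have "\<dots> = (\<Sum>a\<in>qsupp \<psi>. \<Sum>b\<in>qsupp \<phi>. \<Sum>c\<in>?X.
        \<psi> a * cnj (\<phi> b) * (V a c * cnj (W b c)))"
    by (subst sum.swap) (intro sum.cong refl, rule sum.swap)
  also have "\<dots> = (\<Sum>a\<in>qsupp \<psi>. \<Sum>b\<in>qsupp \<phi>. \<psi> a * cnj (\<phi> b) * (if a = b then z else 0))"
    by (intro sum.cong refl, subst sum_distrib_left[symmetric], subst eq[symmetric], assumption+,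
        subst qinner_superset[OF X], auto)
  also have "\<dots> = (\<Sum>a\<in>qsupp \<psi>. z * (\<psi> a * cnj (\<phi> a)))"
    using assms(2)
    by (intro sum.cong refl, simp add: if_distrib if_distribR sum.delta cong: if_cong)
      (auto simp: not_in_qsupp)
  finally show ?thesis
    by (simp add: qinner_def sum_distrib_left)
qed

lemma qinner_return [simp]: "qinner (qreturn a) (qreturn b) = (if a = b then 1 else 0)"
  by (subst qinner_superset[of "{a}"]) (simp_all, simp add: qreturn_def)

lemma qinner_self: "qinner \<psi> \<psi> = of_real (qnorm2 \<psi>)"
  by (simp add: qinner_def qprob_def complex_norm_square del: of_real_power)

lemma qprob_nonneg [simp]: "0 \<le> qprob \<psi> A"
  by (simp add: qprob_def sum_nonneg)

lemma qprob_mono: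
  assumes "qfin \<psi>" "qsupp \<psi> \<inter> A \<subseteq> B"
  shows "qprob \<psi> A \<le> qprob \<psi> B"
  unfolding qprob_def using assms by (intro sum_mono2) auto

lemma qprob_disjoint:
  assumes "qfin \<psi>" "A \<inter> B = {}"
  shows "qprob \<psi> (A \<union> B) = qprob \<psi> A + qprob \<psi> B"
  unfolding qprob_def using assms
  by (subst sum.union_disjoint[symmetric]) (auto simp: Int_Un_distrib)

lemma qprob_compl:
  assumes "qfin \<psi>"
  shows "qprob \<psi> A = qnorm2 \<psi> - qprob \<psi> (- A)"
  using qprob_disjoint[OF assms, of A "- A"] by simp

text \<open>A projection without renormalisation: conditioning would break linearity, and the weight
  that is cut off is itself the error to be bounded.\<close>

definition qrestrict :: "'a set \<Rightarrow> 'a ket \<Rightarrow> 'a ket" where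
  "qrestrict A \<psi> = (\<lambda>a. if a \<in> A then \<psi> a else 0)"

lemma qsupp_restrict [simp]: "qsupp (qrestrict A \<psi>) = qsupp \<psi> \<inter> A"
  by (auto simp: qsupp_def qrestrict_def)

lemma qnorm2_restrict [simp]: "qnorm2 (qrestrict A \<psi>) = qprob \<psi> A"
  unfolding qprob_def qsupp_restrict by (auto intro!: sum.cong simp: qrestrict_def)

lemma qsupp_diff: "qsupp (\<lambda>a. \<psi> a - \<phi> a) \<subseteq> qsupp \<psi> \<union> qsupp \<phi>"
  by (auto simp: qsupp_def)

lemma cmod_diff_power2_le: "(cmod (x - y))\<^sup>2 \<le> 2 * (cmod x)\<^sup>2 + 2 * (cmod y)\<^sup>2"
proof -
  have "(cmod (x - y))\<^sup>2 \<le> (cmod x + cmod y)\<^sup>2"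
    by (intro power_mono norm_triangle_ineq4) auto
  also have "\<dots> \<le> 2 * (cmod x)\<^sup>2 + 2 * (cmod y)\<^sup>2"
    using zero_le_power2[of "cmod x - cmod y"] by (simp add: power2_eq_square algebra_simps)
  finally show ?thesis .
qed

lemma qnorm2_diff_le:
  assumes "qfin \<psi>" "qfin \<phi>"
  shows "qnorm2 (\<lambda>a. \<psi> a - \<phi> a) \<le> 2 * qnorm2 \<psi> + 2 * qnorm2 \<phi>"
proof -
  let ?X = "qsupp \<psi> \<union> qsupp \<phi>"
  have X: "finite ?X" using assms by simp
  have "qnorm2 (\<lambda>a. \<psi> a - \<phi> a) = (\<Sum>a\<in>?X. (cmod (\<psi> a - \<phi> a))\<^sup>2)"
    using X by (intro qprob_superset) (auto simp: qsupp_def)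
  also have "\<dots> \<le> (\<Sum>a\<in>?X. 2 * (cmod (\<psi> a))\<^sup>2 + 2 * (cmod (\<phi> a))\<^sup>2)"
    by (intro sum_mono cmod_diff_power2_le)
  also have "\<dots> = 2 * qnorm2 \<psi> + 2 * qnorm2 \<phi>"
    using qprob_superset[OF X, of \<psi> UNIV] qprob_superset[OF X, of \<phi> UNIV]
    by (simp add: sum.distrib sum_distrib_left)
  finally show ?thesis .
qed

lemma qnorm2_bind:
  assumes "qfin \<psi>" "\<And>a. a \<in> qsupp \<psi> \<Longrightarrow> qfin (V a)"
    and "\<And>a b. a \<in> qsupp \<psi> \<Longrightarrow> b \<in> qsupp \<psi> \<Longrightarrow> qinner (V a) (V b) = (if a = b then 1 else 0)"
  shows "qnorm2 (qbind \<psi> V) = qnorm2 \<psi>"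
proof -
  have "qinner (qbind \<psi> V) (qbind \<psi> V) = 1 * qinner \<psi> \<psi>"
    by (rule qinner_bind) (use assms in auto)
  then show ?thesis by (simp add: qinner_self)
qed

lemma qbind_restrict_diff:
  assumes "qfin \<psi>" "\<And>a. a \<in> qsupp \<psi> \<Longrightarrow> a \<notin> A \<Longrightarrow> V a = W a"
  shows "qbind \<psi> V b - qbind \<psi> W b = qbind (qrestrict A \<psi>) V b - qbind (qrestrict A \<psi>) W b"
proof -
  have *: "qbind (qrestrict A \<psi>) U b = (\<Sum>a\<in>qsupp \<psi>. (if a \<in> A then \<psi> a else 0) * U a b)" for U
    by (subst qbind_superset[OF assms(1)]) (auto simp: qrestrict_def qsupp_def)
  show ?thesis
    unfolding * qbind_supp[of \<psi>] sum_subtractf[symmetric]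
    by (intro sum.cong refl) (use assms(2) in auto)
qed

text \<open>Off \<open>A\<close> the two maps agree and their contributions cancel, so only the part
  of \<psi> inside \<open>A\<close> counts. Both isometries keep its weight, and the squared norm of
  a difference costs a factor 2 for each of the two.\<close>

lemma qnorm2_bind_diff_le:
  assumes "qfin \<psi>" "\<And>a. a \<in> qsupp \<psi> \<Longrightarrow> a \<notin> A \<Longrightarrow> V a = W a"
    and "\<And>a. a \<in> qsupp \<psi> \<Longrightarrow> qfin (V a)" "\<And>a. a \<in> qsupp \<psi> \<Longrightarrow> qfin (W a)"
    and "\<And>a b. a \<in> qsupp \<psi> \<Longrightarrow> b \<in> qsupp \<psi> \<Longrightarrow> qinner (V a) (V b) = (if a = b then 1 else 0)"
    and "\<And>a b. a \<in> qsupp \<psi> \<Longrightarrow> b \<in> qsupp \<psi> \<Longrightarrow> qinner (W a) (W b) = (if a = b then 1 else 0)"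
  shows "qnorm2 (\<lambda>b. qbind \<psi> V b - qbind \<psi> W b) \<le> 4 * qprob \<psi> A"
proof -
  have "qnorm2 (\<lambda>b. qbind \<psi> V b - qbind \<psi> W b)
      = qnorm2 (\<lambda>b. qbind (qrestrict A \<psi>) V b - qbind (qrestrict A \<psi>) W b)"
    using qbind_restrict_diff[of \<psi> A V W] assms(1,2) by simp
  also have "\<dots> \<le> 2 * qnorm2 (qbind (qrestrict A \<psi>) V) + 2 * qnorm2 (qbind (qrestrict A \<psi>) W)"
    by (intro qnorm2_diff_le qfin_bind) (use assms in auto)
  also have "\<dots> = 4 * qprob \<psi> A"
    using qnorm2_bind[of "qrestrict A \<psi>" V] qnorm2_bind[of "qrestrict A \<psi>" W] assms by simp
  finally show ?thesis .
qed

text \<open>Squared norms obey the triangle inequality up to a factor 2; roots are avoided so that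
  the errors can later be averaged.\<close>

lemma qnorm2_triangle:
  assumes "qfin \<psi>" "qfin \<phi>" "qfin \<xi>"
  shows "qnorm2 (\<lambda>a. \<psi> a - \<xi> a)
    \<le> 2 * qnorm2 (\<lambda>a. \<psi> a - \<phi> a) + 2 * qnorm2 (\<lambda>a. \<phi> a - \<xi> a)"
proof -
  have eq: "(\<lambda>a. \<psi> a - \<xi> a) = (\<lambda>a. (\<psi> a - \<phi> a) - (\<xi> a - \<phi> a))" by auto
  have "qnorm2 (\<lambda>a. \<psi> a - \<xi> a)
      \<le> 2 * qnorm2 (\<lambda>a. \<psi> a - \<phi> a) + 2 * qnorm2 (\<lambda>a. \<xi> a - \<phi> a)"
    unfolding eq using assms
    by (intro qnorm2_diff_le) (auto intro!: finite_subset[OF qsupp_diff])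
  moreover have "qnorm2 (\<lambda>a. \<xi> a - \<phi> a) = qnorm2 (\<lambda>a. \<phi> a - \<xi> a)"
    unfolding qprob_def qsupp_def
    by (intro sum.cong) (auto simp: norm_minus_commute)
  ultimately show ?thesis by simp
qed

lemma pmf_measure_ket:
  assumes "qfin \<psi>" "qnorm2 \<psi> = 1"
  shows "pmf (measure_ket \<psi>) a = (cmod (\<psi> a))\<^sup>2"
  unfolding measure_ket_def
proof (rule pmf_embed_pmf)
  have "(\<integral>\<^sup>+ a. ennreal ((cmod (\<psi> a))\<^sup>2) \<partial>count_space UNIV)
      = (\<Sum>a\<in>qsupp \<psi>. ennreal ((cmod (\<psi> a))\<^sup>2))"
    using assms(1) by (intro nn_integral_count_space'[of "qsupp \<psi>"]) (auto simp: not_in_qsupp)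
  also have "\<dots> = ennreal (qnorm2 \<psi>)"
    by (simp add: qprob_def sum_ennreal)
  finally show "(\<integral>\<^sup>+ a. ennreal ((cmod (\<psi> a))\<^sup>2) \<partial>count_space UNIV) = 1"
    using assms(2) by simp
qed simp

lemma prob_measure_ket:
  assumes "qfin \<psi>" "qnorm2 \<psi> = 1"
  shows "measure_pmf.prob (measure_ket \<psi>) A = qprob \<psi> A"
proof -
  have set: "set_pmf (measure_ket \<psi>) = qsupp \<psi>"
    by (auto simp: set_pmf_eq pmf_measure_ket[OF assms] qsupp_def)
  have "measure_pmf.prob (measure_ket \<psi>) A = measure_pmf.prob (measure_ket \<psi>) (qsupp \<psi> \<inter> A)"
    using measure_Int_set_pmf[of "measure_ket \<psi>" A] by (simp add: set Int_commute)
  also have "\<dots> = qprob \<psi> A"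
    using assms(1) by (subst measure_measure_pmf_finite) (auto simp: qprob_def pmf_measure_ket[OF assms])
  finally show ?thesis .
qed

lemma measure_ket_return [simp]: "measure_ket (qreturn a) = return_pmf a"
  by (rule pmf_eqI, subst pmf_measure_ket)
    (simp_all add: qprob_def, simp_all add: qreturn_def indicator_def)

section \<open>Unitarity of circuits\<close>

text \<open>Unitarity relative to a finite label set, since gates act sensibly only on strings with
  the right number of wires. The same conditions are imposed on the adjoint, so that undoing a
  circuit needs no argument that an isometry of a finite space is onto.\<close>

definition qunitary :: "'a set \<Rightarrow> ('a \<Rightarrow> 'a ket) \<Rightarrow> bool" where
  "qunitary A V \<longleftrightarrow> finite A
     \<and> (\<forall>a\<in>A. qsupp (V a) \<subseteq> A \<and> qsupp (qadjoint V a) \<subseteq> A)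
     \<and> (\<forall>a\<in>A. \<forall>b\<in>A. qinner (V a) (V b) = (if a = b then 1 else 0)
          \<and> qinner (qadjoint V a) (qadjoint V b) = (if a = b then 1 else 0))"

lemma qadjoint_qadjoint [simp]: "qadjoint (qadjoint V) = V"
  by (simp add: qadjoint_def fun_eq_iff)

lemma qunitary_adjoint: "qunitary A V \<Longrightarrow> qunitary A (qadjoint V)"
  by (simp add: qunitary_def)

lemma qunitaryD:
  assumes "qunitary A V"
  shows "finite A" "a \<in> A \<Longrightarrow> qsupp (V a) \<subseteq> A" "a \<in> A \<Longrightarrow> qfin (V a)"
    "a \<in> A \<Longrightarrow> b \<in> A \<Longrightarrow> qinner (V a) (V b) = (if a = b then 1 else 0)"
  using assms by (auto simp: qunitary_def dest: finite_subset)

lemma qadjoint_bind: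
  assumes V: "qunitary A V" and W: "qunitary A W" and c: "c \<in> A"
  shows "qadjoint (\<lambda>a. qbind (V a) W) c = qbind (qadjoint W c) (qadjoint V)"
proof (rule ext)
  fix a
  have fin: "finite A" using V by (rule qunitaryD)
  have r: "qbind (qadjoint W c) (qadjoint V) a = (\<Sum>b\<in>A. cnj (W b c) * cnj (V a b))"
    using qunitaryD(2)[OF qunitary_adjoint[OF W] c]
    by (subst qbind_superset[OF fin]) (auto simp: qadjoint_def)
  show "qadjoint (\<lambda>a. qbind (V a) W) c a = qbind (qadjoint W c) (qadjoint V) a"
  proof (cases "a \<in> A")
    case True
    then show ?thesis
      unfolding r using qunitaryD(2)[OF V True]
      by (simp add: qadjoint_def qbind_superset[OF fin] mult.commute)
  next
    \<comment> \<open>Amplitudes into \<open>c\<close> come only from inside \<open>A\<close>, and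
      no label outside \<open>A\<close> leads into \<open>A\<close>; so both sides are 0.\<close>
    case False
    have W0: "b \<in> A" if "W b c \<noteq> 0" for b
      using qunitaryD(2)[OF qunitary_adjoint[OF W] c] that by (auto simp: qadjoint_def qsupp_def)
    have V0: "V a b = 0" if "b \<in> A" for b
      using qunitaryD(2)[OF qunitary_adjoint[OF V] that] False by (auto simp: qadjoint_def qsupp_def)
    have "V a b * W b c = 0" for b
      using W0 V0 by (cases "W b c = 0") auto
    then have "qbind (V a) W c = 0"
      by (simp add: qbind_supp)
    moreover have "(\<Sum>b\<in>A. cnj (W b c) * cnj (V a b)) = 0"
      using V0 by simp
    ultimately show ?thesis
      unfolding r by (simp add: qadjoint_def)
  qed
qed

lemma qunitary_bind:
  assumes V: "qunitary A V" and W: "qunitary A W"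
  shows "qunitary A (\<lambda>a. qbind (V a) W)"
proof -
  have supp: "qsupp (qbind (V a) W) \<subseteq> A" if "a \<in> A" "qunitary A V" "qunitary A W" for a V W
    using qsupp_bind[of "V a" W] qunitaryD(2)[OF that(2,1)] qunitaryD(2)[OF that(3)] by blast
  have inner: "qinner (qbind (V a) W) (qbind (V b) W) = (if a = b then 1 else 0)"
    if "a \<in> A" "b \<in> A" and V: "qunitary A V" and W: "qunitary A W" for a b V W
  proof -
    have "qinner (qbind (V a) W) (qbind (V b) W) = 1 * qinner (V a) (V b)"
      using qunitaryD(2,3)[OF V] that(1,2) qunitaryD(3,4)[OF W]
      by (intro qinner_bind) blast+
    then show ?thesis using qunitaryD(4)[OF V] that by simp
  qed
  note adj = qunitary_adjoint[OF V] qunitary_adjoint[OF W]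
  show ?thesis
    unfolding qunitary_def
    using qunitaryD(1)[OF V] supp[OF _ V W] supp[OF _ adj(2,1)] inner[OF _ _ V W] inner[OF _ _ adj(2,1)]
    by (simp add: qadjoint_bind[OF V W])
qed

lemma qunitary_return: "finite A \<Longrightarrow> qunitary A qreturn"
proof -
  have "qadjoint qreturn = (qreturn :: 'a \<Rightarrow> 'a ket)"
    by (auto simp: qadjoint_def qreturn_def fun_eq_iff)
  then show "finite A \<Longrightarrow> qunitary A qreturn"
    by (simp add: qunitary_def)
qed

text \<open>The amplitude at \<open>b\<close> is the inner product of \<open>V a\<close> and
  \<open>V b\<close>, so this is orthonormality read as \<open>V\<close> followed by its adjoint. It
  makes the undoing of the signature exact.\<close>

lemma qunitary_bind_adjoint:
  assumes V: "qunitary A V" and a: "a \<in> A"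
  shows "qbind (V a) (qadjoint V) = qreturn a"
proof (rule ext)
  fix b
  have "qbind (V a) (qadjoint V) b = (\<Sum>c\<in>A. V a c * cnj (V b c))"
    using qunitaryD(1,2)[OF V] a by (subst qbind_superset[of A]) (auto simp: qadjoint_def)
  also have "\<dots> = qreturn a b"
  proof (cases "b \<in> A")
    case True
    have "(\<Sum>c\<in>A. V a c * cnj (V b c)) = qinner (V a) (V b)"
      using qunitaryD(1,2)[OF V] a by (subst qinner_superset[of A]) auto
    then show ?thesis
      using qunitaryD(4)[OF V a True] by (auto simp: qreturn_def)
  next
    case False
    have "V b c = 0" if "c \<in> A" for c
      using qunitaryD(2)[OF qunitary_adjoint[OF V] that] False by (auto simp: qadjoint_def qsupp_def)
    then show ?thesis using False a by (auto simp: qreturn_def)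
  qed
  finally show "qbind (V a) (qadjoint V) b = qreturn a b" .
qed

abbreviation bits_of_length :: "nat \<Rightarrow> bool list set" where
  "bits_of_length l \<equiv> {w. length w = l}"

lemma finite_bits_of_length [simp]: "finite (bits_of_length l)"
  using finite_lists_length_eq[of "UNIV :: bool set" l] by simp

text \<open>A permutation that is its own inverse is its own adjoint, so one half of
  \<open>qunitary\<close> gives the other. All gates but \<open>GH\<close> and \<open>GT\<close>
  have this shape.\<close>

lemma qunitary_involution:
  assumes len: "\<And>w. length (p w) = length w" and inv: "\<And>w. length w = l \<Longrightarrow> p (p w) = w"
  shows "qunitary (bits_of_length l) (\<lambda>w. qreturn (p w))"
proof -
  have adj: "qadjoint (\<lambda>w. qreturn (p w)) b = qreturn (p b)" if "length b = l" for b
  proof (rule ext)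
    fix a
    have "b = p a \<longleftrightarrow> a = p b"
      using that len inv by metis
    then show "qadjoint (\<lambda>w. qreturn (p w)) b a = qreturn (p b) a"
      by (simp add: qadjoint_def qreturn_def)
  qed
  have inj: "p a = p b \<longleftrightarrow> a = b" if "length a = l" "length b = l" for a b
    using that inv by metis
  show ?thesis
    unfolding qunitary_def using len by (auto simp: adj inj)
qed

lemma length_flip_wire [simp]: "length (flip_wire i v w) = length w"
  by (simp add: flip_wire_def)

lemma flip_wire_flip_wire [simp]: "flip_wire i v (flip_wire i v w) = w"
proof (cases "i < length w")
  case True
  have "((w ! i \<noteq> v) \<noteq> v) = w ! i" by auto
  then show ?thesis using True by (simp add: flip_wire_def del: not_iff)
qed (simp add: flip_wire_def list_update_beyond)

lemma nth_flip_wire: "i \<noteq> j \<Longrightarrow> flip_wire i v w ! j = w ! j"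
  by (simp add: flip_wire_def)

lemma flip_wire_commute: "flip_wire i v (flip_wire j v' w) = flip_wire j v' (flip_wire i v w)"
proof (cases "i = j \<and> i < length w")
  case True
  have "((w ! i \<noteq> v') \<noteq> v) = ((w ! i \<noteq> v) \<noteq> v')" by auto
  then show ?thesis using True by (simp add: flip_wire_def del: not_iff)
next
  case False
  then show ?thesis
    by (cases "i = j") (auto simp: flip_wire_def list_update_beyond list_update_swap)
qed

abbreviation flip_wires :: "(nat \<times> bool) list \<Rightarrow> bool list \<Rightarrow> bool list" where
  "flip_wires zs \<equiv> fold (\<lambda>(i, v). flip_wire i v) zs"

lemma length_flip_wires [simp]: "length (flip_wires zs w) = length w"
  by (induction zs arbitrary: w) auto

lemma flip_wires_flip_wire:
  "flip_wires zs (flip_wire i v w) = flip_wire i v (flip_wires zs w)"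
proof (induction zs arbitrary: w)
  case (Cons z zs)
  obtain j v' where "z = (j, v')" by (cases z)
  then show ?case by (simp add: flip_wire_commute[of j] Cons.IH)
qed simp

lemma flip_wires_flip_wires [simp]: "flip_wires zs (flip_wires zs w) = w"
  by (induction zs arbitrary: w) (auto simp: flip_wires_flip_wire)

lemma nth_flip_wires: "j \<notin> fst ` set zs \<Longrightarrow> flip_wires zs w ! j = w ! j"
  by (induction zs arbitrary: w) (auto simp: nth_flip_wire)

lemma qsupp_hadamard [simp]: "qsupp (hadamard b) = UNIV"
  by (auto simp: qsupp_def hadamard_def)

lemma qinner_hadamard: "qinner (hadamard a) (hadamard b) = (if a = b then 1 else 0)"
proof -
  have "complex_of_real (sqrt 2) * complex_of_real (sqrt 2) = 2"
    by (simp flip: of_real_mult)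
  then show ?thesis
    unfolding qinner_def qsupp_hadamard by (simp add: hadamard_def UNIV_bool)
qed

text \<open>Viewed as a matrix the gate is real and symmetric, hence its own adjoint, and only one
  half of \<open>qunitary\<close> has to be checked.\<close>

lemma qunitary_GH:
  assumes "i < l"
  shows "qunitary (bits_of_length l) (qgate_ket O' (GH i))"
proof -
  let ?V = "qgate_ket O' (GH i)"
  \<comment> \<open>Either end may be the one of length \<open>l\<close>, because in the adjoint the
    fixed label is the target.\<close>
  have amp: "?V w w' = (if w' = w[i := w' ! i] then hadamard (w ! i) (w' ! i) else 0)"
    if "length w = l \<or> length w' = l" for w w'
  proof -
    have iff: "w' = w[i := v] \<longleftrightarrow> w' = w[i := w' ! i] \<and> v = w' ! i" for v
      using that assms by (cases "length w = l") auto
    have "?V w w' = (\<Sum>v\<in>UNIV. hadamard (w ! i) v * of_bool (w' = w[i := v]))"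
      by (simp add: qbind_supp qreturn_def of_bool_def)
    also have "\<dots> = (\<Sum>v\<in>UNIV. if v = w' ! i
        then hadamard (w ! i) v * of_bool (w' = w[i := w' ! i]) else 0)"
    proof (rule sum.cong)
      fix v
      show "hadamard (w ! i) v * of_bool (w' = w[i := v])
          = (if v = w' ! i then hadamard (w ! i) v * of_bool (w' = w[i := w' ! i]) else 0)"
        by (subst iff) simp
    qed simp
    also have "\<dots> = hadamard (w ! i) (w' ! i) * of_bool (w' = w[i := w' ! i])"
      by (subst sum.delta) simp_all
    finally show ?thesis
      by (simp only: of_bool_def mult_1_right mult_zero_right if_distrib)
  qed
  have adj: "qadjoint ?V b = ?V b" if "length b = l" for b
  proof (rule ext)
    fix a
    have "b = a[i := b ! i] \<longleftrightarrow> a = b[i := a ! i]"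
      by (metis list_update_id list_update_overwrite)
    moreover have "cnj (hadamard (a ! i) (b ! i)) = hadamard (b ! i) (a ! i)"
      by (simp add: hadamard_def)
    ultimately show "qadjoint ?V b a = ?V b a"
      unfolding qadjoint_def using amp[of a b] amp[of b a] that by (simp del: qgate_ket.simps)
  qed
  have supp: "qsupp (?V a) \<subseteq> bits_of_length l" if "length a = l" for a
    using qsupp_bind[of "hadamard (a ! i)" "\<lambda>v. qreturn (a[i := v])"] that by auto
  have inner: "qinner (?V a) (?V b) = (if a = b then 1 else 0)"
    if "length a = l" "length b = l" for a b
  proof -
    \<comment> \<open>\<open>z\<close> records whether the other wires agree; wire \<open>i\<close>
      is blanked with \<open>False\<close> to leave it out of the comparison.\<close>
    define z :: complex where "z = (if a[i := False] = b[i := False] then 1 else 0)"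
    have eq_iff: "a[i := v] = b[i := v'] \<longleftrightarrow> v = v' \<and> a[i := False] = b[i := False]" for v v'
    proof
      assume eq: "a[i := v] = b[i := v']"
      then have "a[i := v] ! i = b[i := v'] ! i" "(a[i := v])[i := False] = (b[i := v'])[i := False]"
        by simp_all
      then show "v = v' \<and> a[i := False] = b[i := False]"
        using that assms by simp
    next
      assume "v = v' \<and> a[i := False] = b[i := False]"
      then have "(a[i := False])[i := v] = (b[i := False])[i := v']" by simp
      then show "a[i := v] = b[i := v']" by simp
    qed
    have "qinner (qreturn (a[i := v])) (qreturn (b[i := v'])) = (if v = v' then z else 0)" for v v'
      unfolding qinner_return eq_iff[of v v'] z_def by simp
    then have "qinner (?V a) (?V b) = z * qinner (hadamard (a ! i)) (hadamard (b ! i))"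
      unfolding qgate_ket.simps by (intro qinner_bind) simp_all
    moreover have "a = b \<longleftrightarrow> a[i := False] = b[i := False] \<and> a ! i = b ! i"
    proof
      assume *: "a[i := False] = b[i := False] \<and> a ! i = b ! i"
      then have "(a[i := False])[i := a ! i] = (b[i := False])[i := b ! i]" by simp
      then show "a = b" by simp
    qed simp
    ultimately show ?thesis
      by (simp add: qinner_hadamard z_def del: qgate_ket.simps)
  qed
  show ?thesis
    unfolding qunitary_def using supp inner by (auto simp: adj simp del: qgate_ket.simps)
qed

lemma qinner_phase: "qinner (qphase z a) (qphase z' b) = (if a = b then z * cnj z' else 0)"
  by (subst qinner_superset[of "{a}"]) (auto simp: qsupp_phase, auto simp: qphase_def)

lemma qunitary_GT: "qunitary (bits_of_length l) (qgate_ket O' (GT i))"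
proof -
  let ?z = "\<lambda>w. if w ! i then cis (pi / 4) else 1"
  have adj: "qadjoint (qgate_ket O' (GT i)) b = qphase (cnj (?z b)) b" for b
    by (auto simp: qadjoint_def qphase_def fun_eq_iff)
  have "qsupp (qphase z b) \<subseteq> bits_of_length l" if "length b = l" for z and b :: "bool list"
    using that qsupp_phase[of z b] by auto
  moreover have "cis (pi / 4) * cis (- (pi / 4)) = 1" "cis (- (pi / 4)) * cis (pi / 4) = 1"
    by (simp_all add: cis_mult)
  ultimately show ?thesis
    unfolding qunitary_def adj by (auto simp: qinner_phase cis_cnj)
qed

lemma qunitary_gate:
  assumes "distinct (qgate_wires g)" "set (qgate_wires g) \<subseteq> {..<l}"
  shows "qunitary (bits_of_length l) (qgate_ket O' g)"
proof (cases g)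
  case (GX i)
  have "qunitary (bits_of_length l) (\<lambda>w. qreturn (flip_wire i True w))"
    by (rule qunitary_involution) simp_all
  moreover have "qgate_ket O' g = (\<lambda>w. qreturn (flip_wire i True w))"
    using GX by auto
  ultimately show ?thesis by simp
next
  case (GH i)
  then show ?thesis using assms qunitary_GH by simp
next
  case (GT i)
  then show ?thesis using qunitary_GT by simp
next
  case (GCX i j)
  have "qunitary (bits_of_length l) (\<lambda>w. qreturn (flip_wire j (w ! i) w))"
    by (rule qunitary_involution) (use assms GCX in \<open>auto simp: nth_flip_wire\<close>)
  moreover have "qgate_ket O' g = (\<lambda>w. qreturn (flip_wire j (w ! i) w))"
    using GCX by auto
  ultimately show ?thesis by simp
next
  case (GCCX i j k)
  have "qunitary (bits_of_length l) (\<lambda>w. qreturn (flip_wire k (w ! i \<and> w ! j) w))"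
    by (rule qunitary_involution) (use assms GCCX in \<open>auto simp: nth_flip_wire\<close>)
  moreover have "qgate_ket O' g = (\<lambda>w. qreturn (flip_wire k (w ! i \<and> w ! j) w))"
    using GCCX by auto
  ultimately show ?thesis by simp
next
  case (GQuery js os)
  let ?p = "\<lambda>w. flip_wires (zip os (O' (map ((!) w) js))) w"
  \<comment> \<open>A query gate never writes to the wires it reads, so a second application sees
    the same query and cancels the first.\<close>
  have "map ((!) (?p w)) js = map ((!) w) js" for w
    using assms GQuery by (intro map_cong nth_flip_wires refl) (auto dest: set_zip_leftD)
  then have "qunitary (bits_of_length l) (\<lambda>w. qreturn (?p w))"
    by (intro qunitary_involution) (simp_all only: length_flip_wires flip_wires_flip_wires)
  moreover have "qgate_ket O' g = (\<lambda>w. qreturn (?p w))"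
    using GQuery by auto
  ultimately show ?thesis by simp
qed

lemma qunitary_gates:
  assumes "\<forall>g\<in>set gs. distinct (qgate_wires g) \<and> set (qgate_wires g) \<subseteq> {..<l}"
  shows "qunitary (bits_of_length l) (qgates_ket O' gs)"
  using assms
proof (induction gs)
  case Nil
  have "qgates_ket O' [] = qreturn" by auto
  then show ?case by (simp add: qunitary_return)
next
  case (Cons g gs)
  have "qgates_ket O' (g # gs) = (\<lambda>w. qbind (qgate_ket O' g w) (qgates_ket O' gs))"
    by auto
  moreover have "qunitary (bits_of_length l) (qgate_ket O' g)"
    using Cons.prems by (intro qunitary_gate) auto
  ultimately show ?case
    using Cons by (simp add: qunitary_bind)
qed

lemma qunitary_circuit:
  "qcirc_wf C \<Longrightarrow> qunitary (bits_of_length (qc_wires C)) (qgates_ket O' (qc_gates C))"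
  by (rule qunitary_gates) (auto simp: qcirc_wf_def)

lemma qnorm2_bind_return_inj:
  assumes "qfin \<psi>" "inj_on f (qsupp \<psi>)"
  shows "qnorm2 (qbind \<psi> (\<lambda>a. qreturn (f a))) = qnorm2 \<psi>"
  by (rule qnorm2_bind) (use assms in \<open>auto dest: inj_onD\<close>)

section \<open>Honest key generation and signing under a fixed oracle\<close>

locale oss_run =
  fixes S :: oss and \<eta> :: nat and O' :: bfun
  assumes gen_wf: "qcirc_wf (oss_gen S \<eta>)"
    and sign_wf: "qcirc_wf (oss_sign S \<eta> m)"
    and gen_wires: "oss_vk_len S \<eta> + oss_sk_len S \<eta> \<le> qc_wires (oss_gen S \<eta>)"
    and sign_wires: "max (oss_sk_len S \<eta>) (oss_sig_len S \<eta>) \<le> qc_wires (oss_sign S \<eta> m)"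
begin

abbreviation sign_labels :: "bool \<Rightarrow> bool list set" where
  "sign_labels m \<equiv> bits_of_length (qc_wires (oss_sign S \<eta> m))"

lemma sign_unitary: "qunitary (sign_labels m) (oss_sign_ket S \<eta> O' m)"
  unfolding oss_sign_ket_def by (rule qunitary_circuit[OF sign_wf])

lemma sign_init_label: "length sk = oss_sk_len S \<eta> \<Longrightarrow> oss_sign_init S \<eta> m sk \<in> sign_labels m"
  using sign_wires[of m] by (simp add: oss_sign_init_def)

lemma sign_init_inj:
  "length sk = oss_sk_len S \<eta> \<Longrightarrow> length sk' = oss_sk_len S \<eta> \<Longrightarrow>
    oss_sign_init S \<eta> m sk = oss_sign_init S \<eta> m sk' \<longleftrightarrow> sk = sk'"
  by (simp add: oss_sign_init_def)

lemma gen_ket: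
  shows gen_fin: "qfin (oss_gen_ket S \<eta> O')"
    and gen_norm: "qnorm2 (oss_gen_ket S \<eta> O') = 1"
    and gen_supp: "(vk, sk, g) \<in> qsupp (oss_gen_ket S \<eta> O') \<Longrightarrow>
      length vk = oss_vk_len S \<eta> \<and> length sk = oss_sk_len S \<eta>"
proof -
  let ?N = "qc_wires (oss_gen S \<eta>)"
  let ?\<psi> = "qcirc_ket O' (oss_gen S \<eta>) []"
  let ?f = "\<lambda>w :: bool list. (take (oss_vk_len S \<eta>) w, take (oss_sk_len S \<eta>) (drop (oss_vk_len S \<eta>) w),
              drop (oss_vk_len S \<eta> + oss_sk_len S \<eta>) w)"
  have ket: "oss_gen_ket S \<eta> O' = qbind ?\<psi> (\<lambda>w. qreturn (?f w))"
    by (simp add: oss_gen_ket_def)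
  note U0 = qunitary_circuit[OF gen_wf, of O']
  note U = qunitaryD(2,3)[OF U0, of "replicate ?N False"] qunitaryD(4)[OF U0]
  have fin: "qfin ?\<psi>" and supp: "qsupp ?\<psi> \<subseteq> bits_of_length ?N"
    using U by (simp_all add: qcirc_ket_def)
  have "of_real (qnorm2 ?\<psi>) = (1 :: complex)"
    using U(3)[of "replicate ?N False" "replicate ?N False"] by (simp add: qcirc_ket_def qinner_self)
  then have norm: "qnorm2 ?\<psi> = 1" by simp
  have "inj ?f"
  proof (rule injI)
    have split: "w = take (oss_vk_len S \<eta>) w @ take (oss_sk_len S \<eta>) (drop (oss_vk_len S \<eta>) w)
        @ drop (oss_vk_len S \<eta> + oss_sk_len S \<eta>) w" for w :: "bool list"
      by (metis append_take_drop_id drop_drop add.commute)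
    fix w w' :: "bool list" assume "?f w = ?f w'"
    then show "w = w'"
      using split[of w] split[of w'] by simp
  qed
  then show "qnorm2 (oss_gen_ket S \<eta> O') = 1"
    unfolding ket using norm fin by (subst qnorm2_bind_return_inj) (auto intro: inj_on_subset)
  show "qfin (oss_gen_ket S \<eta> O')"
    unfolding ket by (intro qfin_bind fin) simp
  show "length vk = oss_vk_len S \<eta> \<and> length sk = oss_sk_len S \<eta>"
    if s: "(vk, sk, g) \<in> qsupp (oss_gen_ket S \<eta> O')"
  proof -
    obtain w where "w \<in> qsupp ?\<psi>" "(vk, sk, g) = ?f w"
      using subsetD[OF qsupp_bind s[unfolded ket]] by auto
    moreover from this(1) have "length w = ?N" using supp by auto
    ultimately show ?thesis using gen_wires by simp
  qed
qed

definition signed_ket :: "bool \<Rightarrow> (bool list \<times> bool list \<times> bool list) ket" where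
  "signed_ket m = do {
     (vk, sk, g) \<leftarrow> oss_gen_ket S \<eta> O';
     w \<leftarrow> oss_sign_ket S \<eta> O' m (oss_sign_init S \<eta> m sk);
     qreturn (vk, g, w)
   }"

lemma sign_ket_init:
  assumes "(vk, sk, g) \<in> qsupp (oss_gen_ket S \<eta> O')"
  shows "qfin (oss_sign_ket S \<eta> O' m (oss_sign_init S \<eta> m sk))"
    and "qsupp (oss_sign_ket S \<eta> O' m (oss_sign_init S \<eta> m sk)) \<subseteq> sign_labels m"
  using qunitaryD(2,3)[OF sign_unitary sign_init_label] gen_supp[OF assms] by auto

text \<open>The signing key leaves no label behind. Two keys under the same \<open>vk\<close> and
  \<open>g\<close> are told apart only by the unitarity of signing and the injectivity of the
  initial string.\<close>

lemma signed_ket: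
  shows signed_fin: "qfin (signed_ket m)" and signed_norm: "qnorm2 (signed_ket m) = 1"
    and signed_supp: "(vk, g, w) \<in> qsupp (signed_ket m) \<Longrightarrow>
      length vk = oss_vk_len S \<eta> \<and> w \<in> sign_labels m"
proof -
  let ?V = "\<lambda>(vk, sk, g). qbind (oss_sign_ket S \<eta> O' m (oss_sign_init S \<eta> m sk))
    (\<lambda>w. qreturn (vk, g, w))"
  have ket: "signed_ket m = qbind (oss_gen_ket S \<eta> O') ?V"
    by (simp add: signed_ket_def)
  have fin: "qfin (?V a)" if "a \<in> qsupp (oss_gen_ket S \<eta> O')" for a
    using that by (cases a) (auto intro!: qfin_bind dest: sign_ket_init)
  have "qinner (?V a) (?V b) = (if a = b then 1 else 0)"
    if a: "a \<in> qsupp (oss_gen_ket S \<eta> O')" and b: "b \<in> qsupp (oss_gen_ket S \<eta> O')" for a b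
  proof -
    obtain vk sk g vk' sk' g' where ab: "a = (vk, sk, g)" "b = (vk', sk', g')"
      by (cases a; cases b)
    let ?s = "\<lambda>sk. oss_sign_ket S \<eta> O' m (oss_sign_init S \<eta> m sk)"
    have "qinner (?V a) (?V b) = (if vk = vk' \<and> g = g' then 1 else 0) * qinner (?s sk) (?s sk')"
      unfolding ab prod.case
      by (rule qinner_bind) (use a b in \<open>auto simp: ab dest: sign_ket_init\<close>)
    also have "\<dots> = (if a = b then 1 else 0)"
      using a b gen_supp[of vk sk g] gen_supp[of vk' sk' g'] unfolding ab
      by (subst qunitaryD(4)[OF sign_unitary[of m] sign_init_label sign_init_label])
        (auto simp: sign_init_inj)
    finally show ?thesis .
  qed
  then show "qnorm2 (signed_ket m) = 1"
    unfolding ket using gen_norm by (subst qnorm2_bind) (use gen_fin fin in auto)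
  show "qfin (signed_ket m)"
    unfolding ket by (intro qfin_bind gen_fin fin)
  show "length vk = oss_vk_len S \<eta> \<and> w \<in> sign_labels m" if "(vk, g, w) \<in> qsupp (signed_ket m)"
  proof -
    from that obtain sk where s: "(vk, sk, g) \<in> qsupp (oss_gen_ket S \<eta> O')"
      and w: "w \<in> qsupp (oss_sign_ket S \<eta> O' m (oss_sign_init S \<eta> m sk))"
      using qsupp_bind[of "oss_gen_ket S \<eta> O'" ?V] qsupp_bind unfolding ket by fastforce
    then show ?thesis
      using gen_supp[OF s] sign_ket_init(2)[OF s, of m] by auto
  qed
qed

definition accepted :: "bool \<Rightarrow> (bool list \<times> bool list \<times> bool list) set" where
  "accepted m = {(vk, g, w). oss_accepts S \<eta> O' vk m (take (oss_sig_len S \<eta>) w)}"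

end

lemma pmf_bind_return_True: "pmf (bind_pmf p (\<lambda>x. return_pmf (P x))) True = measure_pmf.prob p {x. P x}"
  by (simp add: map_pmf_def[symmetric] pmf_map vimage_def)

text \<open>Turns the correctness experiment into an average, over the setup coins, of the weight of
  the accepted labels, which is the quantity that appears later for each fixed oracle.\<close>

lemma oss_honest_eq:
  assumes "oss_run S \<eta>"
  shows "pmf (oss_honest S \<eta> m) True = measure_pmf.expectation (uniform_bits (oss_coins S \<eta>))
    (\<lambda>R1. qprob (oss_run.signed_ket S \<eta> (oss_oracle S \<eta> R1) m)
       (oss_run.accepted S \<eta> (oss_oracle S \<eta> R1) m))"
proof -
  have "pmf (bind_pmf (measure_ket (oss_run.signed_ket S \<eta> O' m))
      (\<lambda>(vk, g, w). return_pmf (oss_accepts S \<eta> O' vk m (take (oss_sig_len S \<eta>) w)))) True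
    = qprob (oss_run.signed_ket S \<eta> O' m) (oss_run.accepted S \<eta> O' m)" for O'
  proof -
    interpret oss_run S \<eta> O' by (rule assms)
    show ?thesis
      by (simp add: case_prod_unfold pmf_bind_return_True prob_measure_ket signed_fin signed_norm
          accepted_def)
  qed
  then show ?thesis
    unfolding oss_honest_def Let_def pmf_bind oss_run.signed_ket_def[OF assms] by simp
qed

section \<open>Fourier transforms of binary cosets\<close>

lemma bit_vec_add_self [simp]: "v + v = 0\<^sub>v (dim_vec v)" for v :: bitvec
  by (rule eq_vecI) simp_all

lemma bit_vec_add_add [simp]:
  fixes u v :: bitvec
  assumes "u \<in> carrier_vec n" "v \<in> carrier_vec n"
  shows "u + v + v = u"
  using assms by (intro eq_vecI) (auto simp: add.assoc)

lemma finite_carrier_vec [simp]: "finite (carrier_vec n :: bitvec set)"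
  and card_carrier_vec: "card (carrier_vec n :: bitvec set) = 2 ^ n"
proof -
  have bij: "bij_betw list_of_vec (carrier_vec n :: bitvec set) {xs. set xs \<subseteq> UNIV \<and> length xs = n}"
  proof (rule bij_betwI[of _ _ _ vec_of_list])
    show "list_of_vec \<in> carrier_vec n \<rightarrow> {xs. set xs \<subseteq> UNIV \<and> length xs = n}"
      by (rule funcsetI, simp)
    show "vec_of_list \<in> {xs. set xs \<subseteq> UNIV \<and> length xs = n} \<rightarrow> carrier_vec n"
      by (rule funcsetI, rule carrier_vecI, simp)
  qed (simp_all only: vec_list list_vec)
  have univ: "(UNIV :: bit set) = {0, 1}"
    by (metis (full_types) UNIV_eq_I bit.exhaust insert_iff)
  have fin: "finite (UNIV :: bit set)" and card: "card (UNIV :: bit set) = 2"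
    by (simp_all add: univ)
  show "finite (carrier_vec n :: bitvec set)"
    using bij_betw_finite[OF bij] finite_lists_length_eq[OF fin] by simp
  show "card (carrier_vec n :: bitvec set) = 2 ^ n"
    using bij_betw_same_card[OF bij] card_lists_length_eq[OF fin] card by simp
qed

definition bit_sign :: "bit \<Rightarrow> complex" where
  "bit_sign x = (if x = 1 then - 1 else 1)"

lemma bit_sign_simps [simp]: "bit_sign 0 = 1" "bit_sign 1 = - 1" "cnj (bit_sign x) = bit_sign x"
  by (simp_all add: bit_sign_def)

lemma bit_sign_add: "bit_sign (x + y) = bit_sign x * bit_sign y"
  by (cases x; cases y) (simp_all add: bit_sign_def)

lemma bit_sign_mult_self [simp]: "bit_sign x * bit_sign x = 1"
  by (simp add: bit_sign_def)

text \<open>The sum equals its own negative. The character sums below vanish this way, with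
  \<open>t\<close> the translation by a vector on which the character takes the value -1.\<close>

lemma sum_involution_eq_0:
  fixes f :: "'a \<Rightarrow> complex"
  assumes "\<And>x. x \<in> X \<Longrightarrow> t x \<in> X" "\<And>x. x \<in> X \<Longrightarrow> t (t x) = x"
    and "\<And>x. x \<in> X \<Longrightarrow> f (t x) = - f x"
  shows "sum f X = 0"
proof -
  have "sum f X = (\<Sum>x\<in>X. f (t x))"
    by (rule sum.reindex_bij_witness[of _ t t]) (use assms in auto)
  also have "\<dots> = - sum f X"
    using assms(3) by (simp add: sum_negf)
  finally have "sum f X + sum f X = 0"
    by (metis add.left_inverse)
  then show ?thesis
    by (metis mult_2 mult_eq_0_iff zero_neq_numeral)
qed

lemma hadamard_vec_eq:
  "u \<in> carrier_vec n \<Longrightarrow> v \<in> carrier_vec n \<Longrightarrow>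
    hadamard_vec u v = bit_sign (u \<bullet> v) / sqrt (2 ^ n)"
  by (auto simp: hadamard_vec_def bit_sign_def)

lemma qsupp_hadamard_vec: "u \<in> carrier_vec n \<Longrightarrow> qsupp (hadamard_vec u) = carrier_vec n"
  by (auto simp: qsupp_def hadamard_vec_def)

lemma qadjoint_hadamard_vec: "qadjoint hadamard_vec = hadamard_vec"
proof (intro ext)
  fix u v :: bitvec
  have "v \<in> carrier_vec (dim_vec u) \<longleftrightarrow> u \<in> carrier_vec (dim_vec v)"
    by auto
  moreover have "u \<bullet> v = v \<bullet> u" if "v \<in> carrier_vec (dim_vec u)"
    using that by (intro comm_scalar_prod[of _ "dim_vec u"]) auto
  ultimately show "qadjoint hadamard_vec u v = hadamard_vec u v"
    by (auto simp: qadjoint_def hadamard_vec_def)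
qed

lemma qunitary_hadamard_vec: "qunitary (carrier_vec n) hadamard_vec"
proof -
  have "qinner (hadamard_vec a) (hadamard_vec b) = (if a = b then 1 else 0)"
    if a: "a \<in> carrier_vec n" and b: "b \<in> carrier_vec n" for a b
  proof -
    let ?c = "complex_of_real (1 / 2 ^ n)"
    have "complex_of_real (sqrt (2 ^ n)) * complex_of_real (sqrt (2 ^ n)) = 2 ^ n"
      by (simp flip: of_real_mult)
    then have "qinner (hadamard_vec a) (hadamard_vec b)
        = (\<Sum>v\<in>carrier_vec n. bit_sign (a \<bullet> v) * bit_sign (b \<bullet> v) * ?c)"
      unfolding qinner_def qsupp_hadamard_vec[OF a]
      using a b by (intro sum.cong refl) (simp add: hadamard_vec_eq)
    also have "\<dots> = (if a = b then 1 else 0)"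
    proof (cases "a = b")
      case True
      then show ?thesis by (simp add: card_carrier_vec)
    next
      case False
      then obtain i where i: "i < n" "a $ i \<noteq> b $ i"
        using a b by (metis carrier_vecD eq_vecI)
      \<comment> \<open>At a coordinate where \<open>a\<close> and \<open>b\<close> differ, exactly
        one of the two signs flips under this translation.\<close>
      let ?e = "unit_vec n i :: bitvec"
      have "bit_sign (a $ i) * bit_sign (b $ i) = - 1"
        using i(2) by (cases "a $ i"; cases "b $ i") auto
      then have "(\<Sum>v\<in>carrier_vec n. bit_sign (a \<bullet> v) * bit_sign (b \<bullet> v) * ?c) = 0"
        using a b i(1)
        by (intro sum_involution_eq_0[of _ "\<lambda>v. v + ?e"])
          (auto simp: scalar_prod_add_distrib[of _ n] bit_sign_add algebra_simps)
      then show ?thesis using False by simp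
    qed
    finally show ?thesis .
  qed
  then show ?thesis
    by (simp add: qunitary_def qadjoint_hadamard_vec qsupp_hadamard_vec)
qed

lemma hadamard_vec_hadamard_vec:
  assumes "u \<in> carrier_vec n"
  shows "qbind (hadamard_vec u) hadamard_vec = qreturn u"
  using qunitary_bind_adjoint[OF qunitary_hadamard_vec assms] by (simp add: qadjoint_hadamard_vec)

lemma qunitary_phase:
  assumes "finite A" "\<And>a. a \<in> A \<Longrightarrow> z a * cnj (z a) = 1"
  shows "qunitary A (\<lambda>a. qphase (z a) a)"
proof -
  have "qadjoint (\<lambda>a. qphase (z a) a) b = qphase (cnj (z b)) b" for b
    by (auto simp: qadjoint_def qphase_def fun_eq_iff)
  then show ?thesis
    using assms by (auto simp: qunitary_def qinner_phase mult.commute dest: subsetD[OF qsupp_phase])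
qed

locale bit_coset =
  fixes A :: "bit mat" and b :: bitvec and n l :: nat
  assumes A: "A \<in> carrier_mat n l" and b: "b \<in> carrier_vec n" and n_pos: "0 < n"
begin

definition coset :: "bitvec set" where
  "coset = (\<lambda>x. A *\<^sub>v x + b) ` carrier_vec l"

definition coset_bit :: "bool \<Rightarrow> bitvec set" where
  "coset_bit c = {u \<in> coset. u $ 0 = of_bool c}"

definition dual :: "bitvec \<Rightarrow> bool" where
  "dual v \<longleftrightarrow> transpose_mat A *\<^sub>v v = 0\<^sub>v l"

abbreviation e0 :: bitvec where "e0 \<equiv> unit_vec n 0"

lemma coset_carrier: "u \<in> coset \<Longrightarrow> u \<in> carrier_vec n"
  using A b by (auto simp: coset_def)

lemma coset_bit_carrier: "u \<in> coset_bit c \<Longrightarrow> u \<in> carrier_vec n"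
  using coset_carrier by (auto simp: coset_bit_def)

lemma finite_coset [simp]: "finite coset" "finite (coset_bit c)"
  by (simp_all add: coset_def coset_bit_def)

lemma coset_add:
  assumes "u \<in> coset" "z \<in> carrier_vec l"
  shows "u + A *\<^sub>v z \<in> coset"
proof -
  from assms obtain x where x: "x \<in> carrier_vec l" "u = A *\<^sub>v x + b"
    by (auto simp: coset_def)
  have c: "A *\<^sub>v x \<in> carrier_vec n" "A *\<^sub>v z \<in> carrier_vec n"
    using A x(1) assms(2) by auto
  have "u + A *\<^sub>v z = A *\<^sub>v x + (b + A *\<^sub>v z)"
    unfolding x(2) using b c by (intro assoc_add_vec)
  also have "b + A *\<^sub>v z = A *\<^sub>v z + b"
    using b c by (intro comm_add_vec)
  also have "A *\<^sub>v x + (A *\<^sub>v z + b) = A *\<^sub>v x + A *\<^sub>v z + b"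
    using b c by (intro assoc_add_vec[symmetric])
  also have "A *\<^sub>v x + A *\<^sub>v z = A *\<^sub>v (x + z)"
    using mult_add_distrib_mat_vec[OF A x(1) assms(2)] by simp
  finally show ?thesis
    using x(1) assms(2) by (auto simp: coset_def)
qed

text \<open>Off the dual some column of \<open>A\<close> has product 1 with \<open>v\<close>, and
  translating the coset by this column flips every sign.\<close>

lemma sum_coset_eq_0:
  assumes v: "v \<in> carrier_vec n" and nd: "\<not> dual v"
  shows "(\<Sum>u\<in>coset. bit_sign (u \<bullet> v)) = 0"
proof -
  have Av: "transpose_mat A *\<^sub>v v \<in> carrier_vec l"
    using A v by simp
  then obtain i where i: "i < l" "(transpose_mat A *\<^sub>v v) $ i \<noteq> 0"
    using nd unfolding dual_def by (metis carrier_vecD eq_vecI index_zero_vec)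
  let ?z = "unit_vec l i :: bitvec"
  have Az: "A *\<^sub>v ?z \<in> carrier_vec n" using A by simp
  have "(A *\<^sub>v ?z) \<bullet> v = v \<bullet> (A *\<^sub>v ?z)"
    using Az v by (rule comm_scalar_prod)
  also have "\<dots> = (transpose_mat A *\<^sub>v v) \<bullet> ?z"
    using transpose_vec_mult_scalar[OF A _ v, of ?z] by simp
  also have "\<dots> = 1" using i by (simp del: index_mult_mat_vec)
  finally have one: "(A *\<^sub>v ?z) \<bullet> v = 1" .
  show ?thesis
  proof (rule sum_involution_eq_0[of _ "\<lambda>u. u + A *\<^sub>v ?z"])
    fix u assume u: "u \<in> coset"
    show "u + A *\<^sub>v ?z \<in> coset" using coset_add[OF u] by simp
    show "u + A *\<^sub>v ?z + A *\<^sub>v ?z = u"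
      using coset_carrier[OF u] Az by (rule bit_vec_add_add)
    show "bit_sign ((u + A *\<^sub>v ?z) \<bullet> v) = - bit_sign (u \<bullet> v)"
      using add_scalar_prod_distrib[OF coset_carrier[OF u] Az v] one by (simp add: bit_sign_add)
  qed
qed

definition fourier :: "bool \<Rightarrow> bitvec \<Rightarrow> complex" where
  "fourier c v = (\<Sum>u\<in>coset_bit c. bit_sign (u \<bullet> v))"

text \<open>The indicator of a half is \<open>(1 + (-1)^(c + u $ 0)) / 2\<close>, and multiplying a
  character by \<open>(-1)^(u $ 0)\<close> moves its frequency from \<open>v\<close> to
  \<open>v + e0\<close>. So a half is governed by two sums over the full coset.\<close>

lemma fourier_eq:
  assumes v: "v \<in> carrier_vec n"
  shows "fourier c v = ((\<Sum>u\<in>coset. bit_sign (u \<bullet> v))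
    + bit_sign (of_bool c) * (\<Sum>u\<in>coset. bit_sign (u \<bullet> (v + e0)))) / 2"
proof -
  have e: "bit_sign (u \<bullet> (v + e0)) = bit_sign (u \<bullet> v) * bit_sign (u $ 0)" if "u \<in> coset" for u
    by (simp only: scalar_prod_add_distrib[OF coset_carrier[OF that] v unit_vec_carrier]
        scalar_prod_right_unit[OF n_pos] bit_sign_add)
  have "fourier c v = (\<Sum>u\<in>coset. if u $ 0 = of_bool c then bit_sign (u \<bullet> v) else 0)"
    unfolding fourier_def coset_bit_def by (simp add: sum.inter_filter)
  also have "\<dots> = (\<Sum>u\<in>coset. (bit_sign (u \<bullet> v) + bit_sign (of_bool c) * bit_sign (u \<bullet> (v + e0))) / 2)"
  proof (intro sum.cong refl)
    fix u assume "u \<in> coset"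
    have "bit_sign (of_bool c) * bit_sign (u $ 0) = (if u $ 0 = of_bool c then 1 else - 1)"
      by (cases c; cases "u $ 0") auto
    then show "(if u $ 0 = of_bool c then bit_sign (u \<bullet> v) else 0)
        = (bit_sign (u \<bullet> v) + bit_sign (of_bool c) * bit_sign (u \<bullet> (v + e0))) / 2"
      unfolding e[OF \<open>u \<in> coset\<close>] by (simp add: mult.left_commute split: if_splits)
  qed
  also have "\<dots> = ((\<Sum>u\<in>coset. bit_sign (u \<bullet> v))
    + bit_sign (of_bool c) * (\<Sum>u\<in>coset. bit_sign (u \<bullet> (v + e0)))) / 2"
    by (simp only: sum.distrib sum_distrib_left sum_divide_distrib[symmetric])
  finally show ?thesis .
qed

text \<open>The transpose maps \<open>e0\<close> to the first row of \<open>A\<close>. This is where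
  a nonzero first row enters the Fourier analysis.\<close>

lemma not_dual_both:
  assumes v: "v \<in> carrier_vec n" and row: "row A 0 \<noteq> 0\<^sub>v l"
  shows "\<not> (dual v \<and> dual (v + e0))"
proof
  assume "dual v \<and> dual (v + e0)"
  moreover have "transpose_mat A *\<^sub>v (v + e0) = transpose_mat A *\<^sub>v v + transpose_mat A *\<^sub>v e0"
    using A v by (intro mult_add_distrib_mat_vec) auto
  moreover have "transpose_mat A *\<^sub>v e0 \<in> carrier_vec l"
    using A by simp
  ultimately have "transpose_mat A *\<^sub>v e0 = 0\<^sub>v l"
    unfolding dual_def by (metis left_zero_vec)
  moreover have "transpose_mat A *\<^sub>v e0 = row A 0"
    using A n_pos by (intro eq_vecI) (auto simp: row_def col_def)
  ultimately show False using row by simp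
qed

text \<open>The bit enters \<open>fourier_eq\<close> only as the sign of the sum at
  \<open>v + e0\<close>, which vanishes because \<open>v + e0\<close> is off the dual.\<close>

lemma fourier_dual:
  assumes v: "v \<in> carrier_vec n" and row: "row A 0 \<noteq> 0\<^sub>v l" and d: "dual v"
  shows "fourier c v = fourier c' v"
proof -
  have "\<not> dual (v + e0)" using not_dual_both[OF v row] d by simp
  then show ?thesis
    using sum_coset_eq_0[of "v + e0"] v by (simp add: fourier_eq[OF v])
qed

text \<open>Now the sum at \<open>v\<close> vanishes, and the remaining term carries the bit as a
  global sign.\<close>

lemma fourier_not_dual:
  assumes v: "v \<in> carrier_vec n" and nd: "\<not> dual v"
  shows "fourier c v = bit_sign (of_bool c) * fourier False v"
  using sum_coset_eq_0[OF v nd] by (simp add: fourier_eq[OF v])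

lemma fourier_eq_0:
  assumes v: "v \<in> carrier_vec n" and "\<not> dual v" "\<not> dual (v + e0)"
  shows "fourier c v = 0"
  using sum_coset_eq_0[OF v assms(2)] sum_coset_eq_0[of "v + e0"] assms(3) v
  by (simp add: fourier_eq[OF v])

lemma phase_fourier:
  assumes v: "v \<in> carrier_vec n" and row: "row A 0 \<noteq> 0\<^sub>v l"
  shows "(if dual v then 1 else - 1) * fourier (\<not> c) v = fourier c v"
proof (cases "dual v")
  case True
  then show ?thesis using fourier_dual[OF v row] by simp
next
  case False
  then show ?thesis
    using fourier_not_dual[OF v False, of c] fourier_not_dual[OF v False, of "\<not> c"]
    by (cases c) auto
qed

lemma sum_hadamard_vec:
  assumes v: "v \<in> carrier_vec n"
  shows "(\<Sum>u\<in>coset_bit c. hadamard_vec u v) = fourier c v / sqrt (2 ^ n)"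
  unfolding fourier_def sum_divide_distrib
  using v by (intro sum.cong refl hadamard_vec_eq) (auto dest: coset_bit_carrier)

text \<open>The two halves of the coset have the same Fourier transform up to the sign that is \<open>1\<close> on the
  dual and \<open>-1\<close> off it, so this phase exchanges them.\<close>

lemma correction_sum:
  assumes row: "row A 0 \<noteq> 0\<^sub>v l"
    and z: "\<And>v. v \<in> carrier_vec n \<Longrightarrow> z v = (if dual v then 1 else - 1)"
  shows "(\<Sum>u\<in>coset_bit (\<not> c). qbind (hadamard_vec u) (\<lambda>v. qbind (qphase (z v) v) hadamard_vec) w)
    = of_bool (w \<in> coset_bit c)"
proof -
  have bind: "qbind (hadamard_vec u) V w = (\<Sum>v\<in>carrier_vec n. hadamard_vec u v * V v w)"
    if "u \<in> coset_bit c'" for u c' V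
    by (simp add: qbind_supp qsupp_hadamard_vec[OF coset_bit_carrier[OF that]])
  have "(\<Sum>u\<in>coset_bit (\<not> c). qbind (hadamard_vec u) (\<lambda>v. qbind (qphase (z v) v) hadamard_vec) w)
    = (\<Sum>u\<in>coset_bit (\<not> c). \<Sum>v\<in>carrier_vec n. hadamard_vec u v * (z v * hadamard_vec v w))"
    by (intro sum.cong refl) (simp add: bind qphase_bind)
  also have "\<dots> = (\<Sum>v\<in>carrier_vec n. (z v * (\<Sum>u\<in>coset_bit (\<not> c). hadamard_vec u v)) * hadamard_vec v w)"
    by (subst sum.swap) (simp add: sum_distrib_left sum_distrib_right mult_ac)
  also have "\<dots> = (\<Sum>v\<in>carrier_vec n. (\<Sum>u\<in>coset_bit c. hadamard_vec u v) * hadamard_vec v w)"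
  proof (intro sum.cong refl arg_cong2[where f = "(*)"])
    fix v :: bitvec assume v: "v \<in> carrier_vec n"
    show "z v * (\<Sum>u\<in>coset_bit (\<not> c). hadamard_vec u v) = (\<Sum>u\<in>coset_bit c. hadamard_vec u v)"
      using phase_fourier[OF v row, of c, symmetric] by (simp add: sum_hadamard_vec[OF v] z[OF v])
  qed
  also have "\<dots> = (\<Sum>u\<in>coset_bit c. qbind (hadamard_vec u) hadamard_vec w)"
    by (simp add: bind sum_distrib_right) (rule sum.swap)
  also have "\<dots> = (\<Sum>u\<in>coset_bit c. if w = u then 1 else 0)"
    by (intro sum.cong refl)
      (simp add: hadamard_vec_hadamard_vec[OF coset_bit_carrier], simp add: qreturn_def)
  also have "\<dots> = of_bool (w \<in> coset_bit c)"
    by simp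
  finally show ?thesis .
qed

end

section \<open>Matrices with a zero row\<close>

text \<open>The rank is the size of a maximal independent subset of the set of columns. A repeated
  column shrinks this set, so full column rank will force distinct columns.\<close>

lemma rank_le_card_cols:
  fixes A :: "'a :: field mat"
  assumes A: "A \<in> carrier_mat k l"
  shows "vec_space.rank k A \<le> card (set (cols A))"
proof -
  interpret vec_space "TYPE('a)" k .
  obtain S where S: "maximal S (\<lambda>T. T \<subseteq> set (cols A) \<and> lin_indpt T)"
    using maximal_exists[of "(\<lambda>T. T \<subseteq> set (cols A) \<and> lin_indpt T)" "card (set (cols A))" "{}"]
    by (meson List.finite_set card_mono empty_iff empty_subsetI finite_lin_indpt2 rev_finite_subset)
  then show ?thesis
    using rank_card_indpt[OF A S] by (simp add: card_mono maximal_def)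
qed

lemma mult_mat_unit_vec:
  fixes A :: "'a :: comm_ring_1 mat"
  assumes "A \<in> carrier_mat k l" "i < l"
  shows "A *\<^sub>v unit_vec l i = col A i"
  using assms by (intro eq_vecI) (auto simp: col_def row_def)

text \<open>A trivial kernel is easier to follow through a replacement of rows than the rank is; the
  counting of matrices and the injectivity on cosets both go through the kernel.\<close>

lemma full_column_rank_iff:
  fixes A :: "'a :: field mat"
  assumes A: "A \<in> carrier_mat k l"
  shows "vec_space.rank k A = l \<longleftrightarrow> (\<forall>x\<in>carrier_vec l. A *\<^sub>v x = 0\<^sub>v k \<longrightarrow> x = 0\<^sub>v l)"
proof -
  interpret vec_space "TYPE('a)" k .
  show ?thesis
  proof (intro iffI ballI impI)
    fix x assume r: "rank A = l" and x: "x \<in> carrier_vec l" "A *\<^sub>v x = 0\<^sub>v k"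
    have "card (set (cols A)) = length (cols A)"
      using rank_le_card_cols[OF A] r A card_length[of "cols A"] by simp
    then have "distinct (cols A)" by (rule card_distinct)
    then show "x = 0\<^sub>v l"
      using full_rank_lin_indpt[OF A r] lin_depI[OF A x(1) _ x(2)] by blast
  next
    assume ker: "\<forall>x\<in>carrier_vec l. A *\<^sub>v x = 0\<^sub>v k \<longrightarrow> x = 0\<^sub>v l"
    have dist: "distinct (cols A)"
    proof (rule ccontr)
      assume "\<not> distinct (cols A)"
      then obtain i j where ij: "i < l" "j < l" "i \<noteq> j" "col A i = col A j"
        using A by (auto simp: distinct_conv_nth)
      \<comment> \<open>Equal columns would put this nonzero vector into the kernel.\<close>
      let ?x = "unit_vec l i - unit_vec l j :: 'a vec"
      have "A *\<^sub>v ?x = A *\<^sub>v unit_vec l i - A *\<^sub>v unit_vec l j"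
        using A by (intro mult_minus_distrib_mat_vec) auto
      also have "\<dots> = 0\<^sub>v k"
        using A ij by (simp add: mult_mat_unit_vec[OF A])
      finally have "?x = 0\<^sub>v l" using ker by simp
      then have "?x $ i = 0" using ij by simp
      then show False using ij by simp
    qed
    have "lin_indpt (set (cols A))"
      using ker lin_depE[OF A _ dist] by metis
    then show "rank A = l"
      by (rule lin_indpt_full_rank[OF A dist])
  qed
qed

lemma finite_carrier_mat: "finite (carrier_mat k l :: bit mat set)"
proof (rule finite_subset)
  show "(carrier_mat k l :: bit mat set)
      \<subseteq> mat_of_rows l ` {xs. set xs \<subseteq> carrier_vec l \<and> length xs = k}"
  proof
    fix A :: "bit mat" assume A: "A \<in> carrier_mat k l"
    then have "A = mat_of_rows l (rows A)" "set (rows A) \<subseteq> carrier_vec l" "length (rows A) = k"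
      using rows_carrier[of A] by auto
    then show "A \<in> mat_of_rows l ` {xs. set xs \<subseteq> carrier_vec l \<and> length xs = k}"
      by blast
  qed
  show "finite (mat_of_rows l ` {xs. set xs \<subseteq> (carrier_vec l :: bitvec set) \<and> length xs = k})"
    by (intro finite_imageI finite_lists_length_eq finite_carrier_vec)
qed

lemma finite_full_rank_mats [simp]: "finite (full_rank_mats k l)"
  by (rule finite_subset[OF _ finite_carrier_mat]) (auto simp: full_rank_mats_def)

text \<open>Replacing a zero first row by any of the \<open>2\<^sup>l\<close> vectors keeps the kernel trivial.\<close>

lemma card_zero_row_le:
  assumes l: "l \<le> k" and k: "0 < k"
  shows "card {A \<in> full_rank_mats k l. row A 0 = 0\<^sub>v l} * 2 ^ l \<le> card (full_rank_mats k l)"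
proof -
  let ?Z = "{A \<in> full_rank_mats k l. row A 0 = 0\<^sub>v l}"
  define g :: "bit mat \<times> bitvec \<Rightarrow> bit mat" where
    "g = (\<lambda>(A, v). mat k l (\<lambda>(i, j). if i = 0 then v $ j else A $$ (i, j)))"
  have row0: "A $$ (0, j) = 0" if "A \<in> ?Z" "j < l" for A j
  proof -
    have "A \<in> carrier_mat k l" "row A 0 $ j = 0"
      using that by (auto simp: full_rank_mats_def)
    then show ?thesis using k that(2) by simp
  qed
  \<comment> \<open>The image shows \<open>v\<close> as its first row and the remaining rows of
    \<open>A\<close>; the first row of \<open>A\<close> is known to be zero.\<close>
  have "inj_on g (?Z \<times> carrier_vec l)"
  proof (rule inj_onI)
    fix p p' assume p: "p \<in> ?Z \<times> carrier_vec l" "p' \<in> ?Z \<times> carrier_vec l" "g p = g p'"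
    obtain A v A' v' where pv: "p = (A, v)" "p' = (A', v')" by (cases p; cases p')
    have Z: "A \<in> ?Z" "A' \<in> ?Z" and v: "v \<in> carrier_vec l" "v' \<in> carrier_vec l"
      and eq: "g (A, v) = g (A', v')"
      using p unfolding pv by blast+
    have e: "g (A, v) $$ (i, j) = g (A', v') $$ (i, j)" for i j using eq by simp
    have "v $ j = v' $ j" if "j < l" for j
      using e[of 0 j] k that by (simp add: g_def)
    then have "v = v'"
      using v by (intro eq_vecI) auto
    moreover have "A = A'"
    proof (rule eq_matI)
      have c: "A \<in> carrier_mat k l" "A' \<in> carrier_mat k l"
        using Z by (auto simp: full_rank_mats_def)
      then show "dim_row A = dim_row A'" "dim_col A = dim_col A'" by auto
      fix i j assume ij: "i < dim_row A'" "j < dim_col A'"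
      show "A $$ (i, j) = A' $$ (i, j)"
        using e[of i j] row0[OF Z(1), of j] row0[OF Z(2), of j] c ij
        by (cases "i = 0") (auto simp: g_def)
    qed
    ultimately show "p = p'" by (simp add: pv)
  qed
  moreover have "g ` (?Z \<times> carrier_vec l) \<subseteq> full_rank_mats k l"
  proof clarsimp
    fix A :: "bit mat" and v :: bitvec
    assume A: "A \<in> full_rank_mats k l" "row A 0 = 0\<^sub>v l" and v: "v \<in> carrier_vec l"
    let ?B = "g (A, v)"
    have cA: "A \<in> carrier_mat k l" and cB: "?B \<in> carrier_mat k l"
      using A by (auto simp: full_rank_mats_def g_def)
    have "x = 0\<^sub>v l" if x: "x \<in> carrier_vec l" and Bx: "?B *\<^sub>v x = 0\<^sub>v k" for x
    proof -
      \<comment> \<open>Row 0 of \<open>A\<close> is zero and its other rows are those of the new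
        matrix, so the kernel of the new matrix lies in that of \<open>A\<close>.\<close>
      have "A *\<^sub>v x = 0\<^sub>v k"
      proof (rule eq_vecI)
        fix i assume "i < dim_vec (0\<^sub>v k :: bitvec)"
        then have i: "i < k" by simp
        show "(A *\<^sub>v x) $ i = 0\<^sub>v k $ i"
        proof (cases "i = 0")
          case True
          then show ?thesis using A(2) i cA x by simp
        next
          case False
          have "row ?B i = row A i"
            using False i cA by (intro eq_vecI) (auto simp: g_def)
          moreover have "(?B *\<^sub>v x) $ i = 0" using Bx i by simp
          ultimately show ?thesis using i cA cB by simp
        qed
      qed (use cA in simp)
      then show ?thesis
        using A(1) full_column_rank_iff[OF cA] l x by (auto simp: full_rank_mats_def)
    qed
    then show "?B \<in> full_rank_mats k l"
      using cB full_column_rank_iff[OF cB] l by (auto simp: full_rank_mats_def)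
  qed
  ultimately have "card (?Z \<times> (carrier_vec l :: bitvec set)) \<le> card (full_rank_mats k l)"
    by (intro card_inj_on_le[of g]) auto
  then show ?thesis
    by (simp add: card_cartesian_product card_carrier_vec)
qed

text \<open>A condition on one coordinate of a product has the density it has on that coordinate. It
  is used twice: for the function \<open>y \<mapsto> A_y\<close> inside one coin value, and for the
  random function that assigns coins to verification keys.\<close>

lemma card_PiE_at_le:
  assumes "finite I" "i \<in> I" "card {c \<in> C. P c} * M \<le> card C"
  shows "card {f \<in> I \<rightarrow>\<^sub>E C. P (f i)} * M \<le> card (I \<rightarrow>\<^sub>E C)"
proof -
  have "{f \<in> I \<rightarrow>\<^sub>E C. P (f i)} = PiE I (\<lambda>j. if j = i then {c \<in> C. P c} else C)"
    (is "?L = PiE I ?B")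
  proof (intro equalityI subsetI)
    fix f assume "f \<in> ?L"
    then have f: "f \<in> I \<rightarrow>\<^sub>E C" and P: "P (f i)" by simp_all
    show "f \<in> PiE I ?B"
    proof (rule PiE_I)
      show "f j \<in> ?B j" if "j \<in> I" for j using PiE_mem[OF f that] P by (cases "j = i") auto
      show "f j = undefined" if "j \<notin> I" for j using PiE_arb[OF f that] .
    qed
  next
    fix f assume f: "f \<in> PiE I ?B"
    have "f j \<in> C" if "j \<in> I" for j
      using PiE_mem[OF f that] by (cases "j = i") auto
    moreover have "P (f i)" using PiE_mem[OF f assms(2)] by simp
    ultimately show "f \<in> ?L" using PiE_arb[OF f] by auto
  qed
  then have "card {f \<in> I \<rightarrow>\<^sub>E C. P (f i)} = (\<Prod>j\<in>I. card (if j = i then {c \<in> C. P c} else C))"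
    by (simp only: card_PiE[OF assms(1)])
  also have "\<dots> = card {c \<in> C. P c} * (\<Prod>j\<in>I - {i}. card C)"
    using assms(1,2) by (subst prod.remove[of _ i]) (auto intro!: prod.cong)
  also have "\<dots> * M \<le> card C * (\<Prod>j\<in>I - {i}. card C)"
    using mult_right_mono[OF assms(3), of "\<Prod>j\<in>I - {i}. card C"] by (simp add: mult_ac)
  also have "\<dots> = card (I \<rightarrow>\<^sub>E C)"
    unfolding card_PiE[OF assms(1)] by (rule prod.remove[OF assms(1,2), symmetric])
  finally show ?thesis by simp
qed

definition zero_row :: "nat \<Rightarrow> obar_coins \<Rightarrow> bitvec \<Rightarrow> bool" where
  "zero_row \<eta> \<omega> y \<longleftrightarrow> row (fst (snd \<omega>) y) 0 = 0\<^sub>v (par_n \<eta> - par_r \<eta>)"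

lemma finite_obar_coin_space [simp]: "finite (obar_coin_space \<eta>)"
  unfolding obar_coin_space_def
  by (intro finite_cartesian_product finite_PiE finite_permutations finite_full_rank_mats
      finite_carrier_vec)

text \<open>24 is \<open>3 * 16 / 2\<close>: the dimension of the cosets is three halves of
  \<open>par_s\<close>.\<close>

lemma par_n_bounds:
  assumes "0 < \<eta>"
  shows "par_n \<eta> - par_r \<eta> = 24 * \<eta>" "par_r \<eta> \<le> par_n \<eta>" "0 < par_n \<eta>"
  using assms by (auto simp: par_n_def par_s_def)

lemma card_coins_zero_row_le:
  assumes "0 < \<eta>" "y \<in> carrier_vec (par_r \<eta>)"
  shows "card {\<omega> \<in> obar_coin_space \<eta>. zero_row \<eta> \<omega> y} * 2 ^ (24 * \<eta>) \<le> card (obar_coin_space \<eta>)"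
proof -
  let ?\<Pi> = "{\<pi>. \<pi> permutes (carrier_vec (par_n \<eta>) :: bitvec set)}"
  let ?M = "full_rank_mats (par_k \<eta>) (par_n \<eta> - par_r \<eta>)"
  let ?As = "(carrier_vec (par_r \<eta>) :: bitvec set) \<rightarrow>\<^sub>E ?M"
  let ?bs = "(carrier_vec (par_r \<eta>) :: bitvec set) \<rightarrow>\<^sub>E (carrier_vec (par_k \<eta>) :: bitvec set)"
  let ?P = "\<lambda>A :: bit mat. row A 0 = 0\<^sub>v (par_n \<eta> - par_r \<eta>)"
  have "card {A \<in> ?M. ?P A} * 2 ^ (24 * \<eta>) \<le> card ?M"
    using card_zero_row_le[of "par_n \<eta> - par_r \<eta>" "par_k \<eta>"] par_n_bounds[OF assms(1)]
    by (simp add: par_k_def)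
  then have le: "card {A \<in> ?As. ?P (A y)} * 2 ^ (24 * \<eta>) \<le> card ?As"
    using assms(2) by (intro card_PiE_at_le) auto
  have "{\<omega> \<in> obar_coin_space \<eta>. zero_row \<eta> \<omega> y} = ?\<Pi> \<times> {A \<in> ?As. ?P (A y)} \<times> ?bs"
    by (auto simp: obar_coin_space_def zero_row_def)
  then have "card {\<omega> \<in> obar_coin_space \<eta>. zero_row \<eta> \<omega> y} * 2 ^ (24 * \<eta>)
      = card ?\<Pi> * (card {A \<in> ?As. ?P (A y)} * 2 ^ (24 * \<eta>)) * card ?bs"
    by (simp add: card_cartesian_product mult_ac)
  also have "\<dots> \<le> card ?\<Pi> * card ?As * card ?bs"
    using le by (intro mult_le_mono order.refl)
  also have "\<dots> = card (obar_coin_space \<eta>)"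
    by (simp add: obar_coin_space_def card_cartesian_product)
  finally show ?thesis .
qed

lemma prob_ideal_zero_row_le:
  assumes "0 < \<eta>" "y \<in> carrier_vec (par_r \<eta>)" "length vk = l" "obar_coin_space \<eta> \<noteq> {}"
  shows "measure_pmf.prob (pmf_of_set (bits_of_length l \<rightarrow>\<^sub>E obar_coin_space \<eta>))
    {f. zero_row \<eta> (f vk) y} \<le> 1 / 2 ^ (24 * \<eta>)"
proof -
  let ?F = "bits_of_length l \<rightarrow>\<^sub>E obar_coin_space \<eta>"
  have fin: "finite ?F" by (intro finite_PiE) auto
  have ne: "?F \<noteq> {}" using assms(4) by (simp add: PiE_eq_empty_iff)
  have "card {f \<in> ?F. zero_row \<eta> (f vk) y} * 2 ^ (24 * \<eta>) \<le> card ?F"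
    using assms by (intro card_PiE_at_le card_coins_zero_row_le) auto
  then have "real (card {f \<in> ?F. zero_row \<eta> (f vk) y}) * 2 ^ (24 * \<eta>) \<le> real (card ?F)"
    by (simp only: of_nat_mult of_nat_power of_nat_numeral flip: of_nat_le_iff[where 'a = real])
  moreover have "?F \<inter> {f. zero_row \<eta> (f vk) y} = {f \<in> ?F. zero_row \<eta> (f vk) y}"
    by auto
  moreover have "card ?F > 0" using fin ne by (simp add: card_gt_0_iff)
  ultimately show ?thesis
    unfolding measure_pmf_of_set[OF ne fin] by (subst divide_le_eq) (simp_all add: le_divide_eq)
qed

section \<open>Negligible functions and the distinguisher\<close>

lemma negl_mono:
  assumes "negl g" "\<forall>\<^sub>F \<eta> in sequentially. \<bar>f \<eta>\<bar> \<le> \<bar>g \<eta>\<bar>"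
  shows "negl f"
proof -
  have "f \<in> O(g)" using assms(2) by (intro bigoI[of _ 1]) simp
  then show ?thesis
    using assms(1) unfolding negl_def by (meson landau_o.big_small_trans)
qed

lemma negl_add: "negl f \<Longrightarrow> negl g \<Longrightarrow> negl (\<lambda>\<eta>. f \<eta> + g \<eta>)"
  unfolding negl_def by (auto intro: sum_in_smallo)

lemma negl_cmult: "negl f \<Longrightarrow> negl (\<lambda>\<eta>. c * f \<eta>)"
  unfolding negl_def by (cases "c = 0") auto

text \<open>\<open>negl\<close> ranges over all exponents, so the decay of \<open>f\<close> at
  exponent \<open>2 * c\<close> gives that of its root at \<open>c\<close>; the constant
  \<open>e\<close> is matched by its square.\<close>

lemma negl_sqrt:
  assumes "negl f"
  shows "negl (\<lambda>\<eta>. sqrt \<bar>f \<eta>\<bar>)"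
  unfolding negl_def
proof (intro allI impI landau_o.smallI)
  fix c e :: real assume c: "0 < c" and e: "0 < e"
  have "f \<in> o(\<lambda>\<eta>. inverse (real \<eta> powr (2 * c)))"
    using assms c by (auto simp: negl_def)
  from landau_o.smallD[OF this, of "e\<^sup>2"] e
  have "\<forall>\<^sub>F \<eta> in sequentially. \<bar>f \<eta>\<bar> \<le> e\<^sup>2 * inverse (real \<eta> powr (2 * c))"
    by simp
  then show "\<forall>\<^sub>F \<eta> in sequentially. norm (sqrt \<bar>f \<eta>\<bar>) \<le> e * norm (inverse (real \<eta> powr c))"
  proof eventually_elim
    case (elim \<eta>)
    have "real \<eta> powr (2 * c) = (real \<eta> powr c)\<^sup>2"
      by (simp add: power2_eq_square flip: powr_add)
    then have "sqrt \<bar>f \<eta>\<bar> \<le> sqrt ((e * inverse (real \<eta> powr c))\<^sup>2)"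
      using elim by (intro real_sqrt_le_mono) (simp add: power_mult_distrib power_inverse)
    then show ?case using e by simp
  qed
qed

lemma negl_inverse_power2: "negl (\<lambda>\<eta>. 1 / 2 ^ \<eta>)"
  unfolding negl_def
proof (intro allI impI)
  fix c :: real
  show "(\<lambda>\<eta>. 1 / 2 ^ \<eta>) \<in> o(\<lambda>\<eta>. inverse (real \<eta> powr c))"
    by real_asymp
qed

text \<open>This form has a separate factor and exponent, which makes closure under sums and
  products immediate.\<close>

lemma poly_bounded_iff: "poly_bounded f \<longleftrightarrow> (\<exists>a k. \<forall>\<eta>. f \<eta> \<le> a * (\<eta> + 1) ^ k)"
proof
  assume "poly_bounded f"
  then obtain c where c: "\<And>\<eta>. f \<eta> \<le> \<eta> ^ c + c" by (auto simp: poly_bounded_def)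
  have "\<eta> ^ c + c \<le> (1 + c) * (\<eta> + 1) ^ c" for \<eta>
  proof -
    have "c * 1 \<le> c * (\<eta> + 1) ^ c" by (intro mult_le_mono2) simp
    moreover have "\<eta> ^ c \<le> (\<eta> + 1) ^ c" by (intro power_mono) simp_all
    ultimately show ?thesis unfolding add_mult_distrib by linarith
  qed
  then show "\<exists>a k. \<forall>\<eta>. f \<eta> \<le> a * (\<eta> + 1) ^ k"
    using c le_trans by blast
next
  assume "\<exists>a k. \<forall>\<eta>. f \<eta> \<le> a * (\<eta> + 1) ^ k"
  then obtain a k where f: "\<And>\<eta>. f \<eta> \<le> a * (\<eta> + 1) ^ k" by blast
  \<comment> \<open>Beyond \<open>M\<close> the factor \<open>a\<close> is at most \<eta> and
    \<open>\<eta> + 1\<close> at most the square of \<eta>, which costs the exponent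
    \<open>1 + 2 * k\<close>; below \<open>M\<close> the last summand of \<open>e\<close> already
    covers \<open>f\<close>.\<close>
  define M where "M = max a 2"
  define e where "e = 1 + 2 * k + a * (M + 1) ^ k"
  have "f \<eta> \<le> \<eta> ^ e + e" for \<eta>
  proof (cases "\<eta> < M")
    case True
    have "f \<eta> \<le> a * (M + 1) ^ k"
      using True by (intro order.trans[OF f] mult_le_mono2 power_mono) auto
    then show ?thesis by (simp add: e_def)
  next
    case False
    then have \<eta>: "a \<le> \<eta>" "2 \<le> \<eta>" by (auto simp: M_def)
    have "\<eta> + 1 \<le> \<eta> * \<eta>"
      using \<eta>(2) mult_le_mono1[OF \<eta>(2), of \<eta>] by linarith
    then have "(\<eta> + 1) ^ k \<le> (\<eta> * \<eta>) ^ k" by (rule power_mono) simp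
    then have "a * (\<eta> + 1) ^ k \<le> \<eta> * (\<eta> * \<eta>) ^ k"
      using \<eta>(1) by (intro mult_le_mono)
    also have "\<dots> = \<eta> ^ (1 + 2 * k)"
      by (simp add: power_mult power2_eq_square)
    also have "\<dots> \<le> \<eta> ^ e"
      using \<eta>(2) by (intro power_increasing) (auto simp: e_def)
    finally show ?thesis using f[of \<eta>] by linarith
  qed
  then show "poly_bounded f" by (auto simp: poly_bounded_def)
qed

lemma poly_bounded_mono: "poly_bounded g \<Longrightarrow> (\<And>\<eta>. f \<eta> \<le> g \<eta>) \<Longrightarrow> poly_bounded f"
  unfolding poly_bounded_def by (meson le_trans)

lemma poly_bounded_add:
  assumes "poly_bounded f" "poly_bounded g"
  shows "poly_bounded (\<lambda>\<eta>. f \<eta> + g \<eta>)"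
proof -
  obtain a k b l where f: "\<And>\<eta>. f \<eta> \<le> a * (\<eta> + 1) ^ k" and g: "\<And>\<eta>. g \<eta> \<le> b * (\<eta> + 1) ^ l"
    using assms by (auto simp: poly_bounded_iff)
  have "f \<eta> + g \<eta> \<le> (a + b) * (\<eta> + 1) ^ (k + l)" for \<eta>
  proof -
    have "a * (\<eta> + 1) ^ k \<le> a * (\<eta> + 1) ^ (k + l)" "b * (\<eta> + 1) ^ l \<le> b * (\<eta> + 1) ^ (k + l)"
      by (intro mult_le_mono2 power_increasing; simp)+
    then show ?thesis using f[of \<eta>] g[of \<eta>] unfolding add_mult_distrib by linarith
  qed
  then show ?thesis unfolding poly_bounded_iff by blast
qed

lemma poly_bounded_mult:
  assumes "poly_bounded f" "poly_bounded g"
  shows "poly_bounded (\<lambda>\<eta>. f \<eta> * g \<eta>)"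
proof -
  obtain a k b l where f: "\<And>\<eta>. f \<eta> \<le> a * (\<eta> + 1) ^ k" and g: "\<And>\<eta>. g \<eta> \<le> b * (\<eta> + 1) ^ l"
    using assms by (auto simp: poly_bounded_iff)
  have "f \<eta> * g \<eta> \<le> (a * b) * (\<eta> + 1) ^ (k + l)" for \<eta>
    using mult_le_mono[OF f[of \<eta>] g[of \<eta>]] by (simp add: power_add mult_ac)
  then show ?thesis unfolding poly_bounded_iff by blast
qed

lemma poly_bounded_const: "poly_bounded (\<lambda>_. c)"
  unfolding poly_bounded_def by (intro exI[of _ c]) simp

lemma poly_bounded_par_n: "poly_bounded par_n"
proof -
  have "par_n \<eta> \<le> 40 * (\<eta> + 1) ^ 2" for \<eta>
  proof -
    have "par_n \<eta> \<le> 16 * \<eta> * \<eta> + 24 * \<eta>"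
      by (simp add: par_n_def par_r_def par_s_def)
    also have "\<dots> \<le> 40 * (\<eta> + 1) ^ 2"
      by (simp add: power2_eq_square)
    finally show ?thesis .
  qed
  then show ?thesis unfolding poly_bounded_iff by blast
qed

section \<open>Classical gates and a circuit that tests a block of answer bits for zero\<close>

primrec classical_gate :: "qgate \<Rightarrow> bool" where
  "classical_gate (GX i) = True"
| "classical_gate (GH i) = False"
| "classical_gate (GT i) = False"
| "classical_gate (GCX i j) = True"
| "classical_gate (GCCX i j k) = True"
| "classical_gate (GQuery is os) = True"

text \<open>The values at \<open>GH\<close> and \<open>GT\<close> are fillers: agreement with
  \<open>qgate_ket\<close> is claimed only under \<open>classical_gate\<close>.\<close>

primrec gate_map :: "bfun \<Rightarrow> qgate \<Rightarrow> bool list \<Rightarrow> bool list" where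
  "gate_map O' (GX i) w = flip_wire i True w"
| "gate_map O' (GH i) w = w"
| "gate_map O' (GT i) w = w"
| "gate_map O' (GCX i j) w = flip_wire j (w ! i) w"
| "gate_map O' (GCCX i j k) w = flip_wire k (w ! i \<and> w ! j) w"
| "gate_map O' (GQuery is os) w = flip_wires (zip os (O' (map ((!) w) is))) w"

lemma qgates_ket_classical:
  "list_all classical_gate gs \<Longrightarrow> qgates_ket O' gs w = qreturn (fold (gate_map O') gs w)"
proof (induction gs arbitrary: w)
  case (Cons g gs)
  then have "qgate_ket O' g w = qreturn (gate_map O' g w)" by (cases g) auto
  then show ?case using Cons by simp
qed simp

lemma nth_flip_wire_same: "i < length w \<Longrightarrow> flip_wire i v w ! i = (w ! i \<noteq> v)"
  by (simp add: flip_wire_def)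

lemma nth_flip_wires_distinct:
  assumes "distinct (map fst zs)" "j < length w"
  shows "flip_wires zs w ! j = (w ! j \<noteq> ((j, True) \<in> set zs))"
  using assms
proof (induction zs arbitrary: w)
  case (Cons z zs)
  obtain i v where z: "z = (i, v)" by (cases z)
  have "(i, b) \<notin> set zs" for b using Cons.prems z by force
  moreover have "flip_wire i v w ! j = (w ! j \<noteq> (j = i \<and> v))"
    using Cons.prems(2) by (cases "j = i") (auto simp: nth_flip_wire_same nth_flip_wire)
  ultimately show ?case
    using Cons z by auto
qed simp

lemma fold_GX: "fold (gate_map O') (map GX js) w = flip_wires (map (\<lambda>i. (i, True)) js) w"
  by (induction js arbitrary: w) auto

lemma nth_fold_GX:
  assumes "distinct js" "j < length w"
  shows "fold (gate_map O') (map GX js) w ! j = (w ! j \<noteq> (j \<in> set js))"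
  unfolding fold_GX using assms by (subst nth_flip_wires_distinct) (auto simp: comp_def)

lemma length_gate_map [simp]: "length (gate_map O' g w) = length w"
  by (cases g) auto

lemma length_fold_gate_map [simp]: "length (fold (gate_map O') gs w) = length w"
  by (induction gs arbitrary: w) auto

text \<open>A chain of Toffoli gates writes into ancilla \<open>B + i\<close> the conjunction of the first \<open>i\<close> wires
  starting at \<open>A\<close>.\<close>

lemma nth_fold_GCCX_chain:
  assumes "A + l \<le> B" "B + l < length w" "w ! B" "\<And>k. B < k \<Longrightarrow> k \<le> B + l \<Longrightarrow> \<not> w ! k"
    and "j \<le> l" "k < length w"
  shows "fold (gate_map O') (map (\<lambda>i. GCCX (B + i) (A + i) (B + i + 1)) [0..<j]) w ! k
    = (if B \<le> k \<and> k \<le> B + j then \<forall>i<k - B. w ! (A + i) else w ! k)"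
  using assms(5,6)
proof (induction j arbitrary: k)
  case 0
  then show ?case using assms(3) by auto
next
  case (Suc j)
  let ?u = "fold (gate_map O') (map (\<lambda>i. GCCX (B + i) (A + i) (B + i + 1)) [0..<j]) w"
  have u: "?u ! k = (if B \<le> k \<and> k \<le> B + j then \<forall>i<k - B. w ! (A + i) else w ! k)"
    if "k < length w" for k
    using Suc that by simp
  have step: "fold (gate_map O') (map (\<lambda>i. GCCX (B + i) (A + i) (B + i + 1)) [0..<Suc j]) w
      = flip_wire (B + j + 1) (?u ! (B + j) \<and> ?u ! (A + j)) ?u"
    by simp
  have uB: "?u ! (B + j) = (\<forall>i<j. w ! (A + i))"
    using Suc.prems assms(2) by (subst u) auto
  have uA: "?u ! (A + j) = w ! (A + j)"
    using Suc.prems assms(1,2) by (subst u) auto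
  show ?case
  proof (cases "k = B + j + 1")
    case True
    then have "\<not> ?u ! k" using Suc.prems assms(2,4) by (subst u) auto
    then show ?thesis
      unfolding step uA uB using True Suc.prems by (auto simp: nth_flip_wire_same less_Suc_eq)
  next
    case False
    then have "B \<le> k \<and> k \<le> B + Suc j \<longleftrightarrow> B \<le> k \<and> k \<le> B + j" by auto
    then show ?thesis
      unfolding step using False u[of k] Suc.prems by (simp add: nth_flip_wire)
  qed
qed

text \<open>The output is wire 0, followed by the query \<open>Q\<close>, the \<open>m\<close> answer bits and the ancillas of the
  chain; the answer bits \<open>p, \<dots>, p + l - 1\<close> are tested for being zero.\<close>

definition zero_test :: "bool list \<Rightarrow> nat \<Rightarrow> nat \<Rightarrow> nat \<Rightarrow> qcirc" where
  "zero_test Q m p l = (let q = length Q; A = q + 1 + p; B = q + m + 1 in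
    \<lparr>qc_wires = q + m + l + 2,
     qc_gates = map GX (map Suc (filter ((!) Q) [0..<q]))
       @ [GQuery [1..<q + 1] [q + 1..<q + m + 1]]
       @ map GX (B # [A..<A + l])
       @ map (\<lambda>i. GCCX (B + i) (A + i) (B + i + 1)) [0..<l]
       @ [GCX (B + l) 0]\<rparr>)"

lemma zero_test_wf: "p + l \<le> m \<Longrightarrow> qcirc_wf (zero_test Q m p l)"
  by (auto simp: zero_test_def qcirc_wf_def Let_def)

lemma zero_test_size:
  "qc_wires (zero_test Q m p l) + length (qc_gates (zero_test Q m p l))
    \<le> 2 * length Q + m + 3 * l + 5"
proof -
  have "length (filter ((!) Q) [0..<length Q]) \<le> length Q"
    by (metis diff_zero length_filter_le length_upt)
  then show ?thesis by (simp add: zero_test_def Let_def)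
qed

text \<open>All gates are classical, so the run is deterministic and can be followed wire by wire.
  The states \<open>w1\<close> to \<open>w5\<close> are those after writing the query, asking it,
  negating the tested bits and setting the seed of the chain, running the chain, and copying its
  last ancilla to the output. The negation turns "all zero" into a conjunction.\<close>

lemma zero_test_run:
  assumes "p + l \<le> m" "length (O' Q) = m"
  shows "\<exists>w. qcirc_run O' (zero_test Q m p l) = return_pmf w
    \<and> (take 1 w = [True] \<longleftrightarrow> (\<forall>i<l. \<not> O' Q ! (p + i)))"
proof -
  define q A B where "q = length Q" and "A = q + 1 + p" and "B = q + m + 1"
  define N where "N = q + m + l + 2"
  define w0 where "w0 = replicate N False"
  define w1 where "w1 = fold (gate_map O') (map GX (map Suc (filter ((!) Q) [0..<q]))) w0"
  define w2 where "w2 = gate_map O' (GQuery [1..<q + 1] [q + 1..<q + m + 1]) w1"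
  define w3 where "w3 = fold (gate_map O') (map GX (B # [A..<A + l])) w2"
  define w4 where "w4 = fold (gate_map O') (map (\<lambda>i. GCCX (B + i) (A + i) (B + i + 1)) [0..<l]) w3"
  define w5 where "w5 = gate_map O' (GCX (B + l) 0) w4"
  have len: "length w0 = N" "length w1 = N" "length w2 = N" "length w3 = N" "length w4 = N"
    by (simp_all add: w0_def w1_def w2_def w3_def w4_def)
  have w1: "w1 ! k = (\<exists>i<q. k = Suc i \<and> Q ! i)" if "k < N" for k
    unfolding w1_def using that len
    by (subst nth_fold_GX) (auto simp: w0_def distinct_map)
  have "map ((!) w1) [1..<q + 1] = Q"
    by (rule nth_equalityI) (auto simp: q_def[symmetric] w1 N_def simp del: upt_Suc)
  then have w2_eq: "w2 = flip_wires (zip [q + 1..<q + m + 1] (O' Q)) w1"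
    by (simp add: w2_def del: upt_Suc)
  have fst: "map fst (zip [q + 1..<q + m + 1] (O' Q)) = [q + 1..<q + m + 1]"
    using assms(2) by (simp del: upt_Suc)
  have mem: "(k, True) \<in> set (zip [q + 1..<q + m + 1] (O' Q)) \<longleftrightarrow> (\<exists>j<m. k = q + 1 + j \<and> O' Q ! j)" for k
  proof -
    have "(k, True) \<in> set (zip [q + 1..<q + m + 1] (O' Q))
        \<longleftrightarrow> (\<exists>j<m. [q + 1..<q + m + 1] ! j = k \<and> O' Q ! j)"
      using assms(2) by (auto simp: set_zip simp del: upt_Suc)
    also have "\<dots> \<longleftrightarrow> (\<exists>j<m. k = q + 1 + j \<and> O' Q ! j)"
      by (intro ex_cong1) (auto simp del: upt_Suc)
    finally show ?thesis .
  qed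
  have w2: "w2 ! k = (w1 ! k \<noteq> (\<exists>j<m. k = q + 1 + j \<and> O' Q ! j))" if "k < N" for k
    unfolding w2_eq using that len
    by (subst nth_flip_wires_distinct) (simp_all only: fst mem distinct_upt)
  have w3: "w3 ! k = (w2 ! k \<noteq> (k = B \<or> A \<le> k \<and> k < A + l))" if "k < N" for k
    unfolding w3_def using that len assms(1)
    by (subst nth_fold_GX) (auto simp: A_def B_def)
  have w3A: "w3 ! (A + i) = (\<not> O' Q ! (p + i))" if "i < l" for i
    using that assms(1) by (auto simp: w3 w2 w1 A_def N_def B_def)
  have w3B: "w3 ! B" "\<And>k. B < k \<Longrightarrow> k \<le> B + l \<Longrightarrow> \<not> w3 ! k" "\<not> w3 ! 0"
    using assms(1) by (auto simp: w3 w2 w1 A_def N_def B_def)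
  have w4: "w4 ! k = (if B \<le> k \<and> k \<le> B + l then \<forall>i<k - B. w3 ! (A + i) else w3 ! k)"
    if "k < N" for k
    unfolding w4_def by (rule nth_fold_GCCX_chain)
      (use that len w3B assms(1) in \<open>auto simp: A_def B_def N_def\<close>)
  have "w5 ! 0 = (\<forall>i<l. \<not> O' Q ! (p + i))"
  proof -
    have "w4 ! (B + l) = (\<forall>i<l. w3 ! (A + i))" "w4 ! 0 = w3 ! 0"
      by (subst w4; simp add: B_def N_def)+
    then show ?thesis
      using w3A w3B(3) len(5) by (simp add: w5_def nth_flip_wire_same N_def)
  qed
  moreover have "length w5 = N" using len by (simp add: w5_def)
  moreover have "qcirc_ket O' (zero_test Q m p l) [] = qreturn w5"
  proof -
    have "qc_gates (zero_test Q m p l) = map GX (map Suc (filter ((!) Q) [0..<q]))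
       @ [GQuery [1..<q + 1] [q + 1..<q + m + 1]]
       @ map GX (B # [A..<A + l])
       @ map (\<lambda>i. GCCX (B + i) (A + i) (B + i + 1)) [0..<l]
       @ [GCX (B + l) 0]" (is "_ = ?gs")
      by (simp add: zero_test_def Let_def q_def A_def B_def)
    moreover have "list_all classical_gate ?gs"
      by (auto simp: list_all_iff)
    moreover have "fold (gate_map O') ?gs w0 = w5"
    proof -
      have single: "fold (gate_map O') [g] w = gate_map O' g w" for g w by simp
      show ?thesis
        by (simp only: fold_append comp_def single w1_def[symmetric] w2_def[symmetric]
            w3_def[symmetric] w4_def[symmetric] w5_def[symmetric])
    qed
    moreover have "qc_wires (zero_test Q m p l) = N"
      by (simp add: zero_test_def Let_def q_def N_def)
    ultimately show ?thesis
      by (simp only: qcirc_ket_def qgates_ket_classical append_Nil list.size(3) diff_zero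
          w0_def[symmetric])
  qed
  ultimately show ?thesis
    by (intro exI[of _ w5]) (cases w5, auto simp: qcirc_run_def N_def)
qed

lemma vec_of_bits_of_vec [simp]: "vec_of_bits (bits_of_vec v) = v"
proof -
  have "(of_bool (x = 1) :: bit) = x" for x by (cases x) auto
  then have "map of_bool (bits_of_vec v) = list_of_vec v"
    by (simp add: bits_of_vec_def comp_def)
  then show ?thesis by (simp add: vec_of_bits_def vec_list)
qed

lemma length_bits_of_vec [simp]: "length (bits_of_vec v) = dim_vec v"
  by (simp add: bits_of_vec_def)

lemma nth_bits_of_vec: "i < dim_vec v \<Longrightarrow> bits_of_vec v ! i = (v $ i = 1)"
  by (simp add: bits_of_vec_def list_of_vec_index)

lemma fit_eq: "length xs = l \<Longrightarrow> fit l xs = xs"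
  by (simp add: fit_def)

text \<open>A query asks for values of the permutation, the matrix and the shift at once. Only the
  matrix is of interest, so the slot of the permutation is filled with zeros.\<close>

definition zero_row_query :: "nat \<Rightarrow> bool list \<Rightarrow> bitvec \<Rightarrow> bool list" where
  "zero_row_query \<eta> vk y = vk @ bits_of_vec (0\<^sub>v (par_n \<eta>)) @ bits_of_vec y"

text \<open>The answer starts with the \<open>n\<close> bits of the permuted zero vector, followed
  by the rows of the matrix; hence the tested window begins at \<open>n\<close> and has the length
  \<open>k\<close> of one row.\<close>

lemma coin_oracle_zero_row_query:
  assumes \<eta>: "0 < \<eta>" and f: "f vk \<in> obar_coin_space \<eta>" and vk: "length vk = l"
    and y: "y \<in> carrier_vec (par_r \<eta>)"
  defines "n \<equiv> par_n \<eta>" and "k \<equiv> par_n \<eta> - par_r \<eta>"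
  defines "a \<equiv> coin_oracle l \<eta> f (zero_row_query \<eta> vk y)"
  shows "length a = n + (n * k + n)"
    and "(\<forall>i<k. \<not> a ! (n + i)) \<longleftrightarrow> zero_row \<eta> (f vk) y"
proof -
  obtain \<pi> A b where \<omega>: "f vk = (\<pi>, A, b)" by (cases "f vk")
  have \<pi>: "\<pi> permutes carrier_vec n" and A: "A y \<in> carrier_mat n k" and b: "b y \<in> carrier_vec n"
    using f y by (auto simp: \<omega> obar_coin_space_def full_rank_mats_def par_k_def n_def k_def
        dest: PiE_mem)
  have "\<pi> (0\<^sub>v n) \<in> carrier_vec n"
    using permutes_in_image[OF \<pi>] by simp
  then have d\<pi>: "dim_vec (\<pi> (0\<^sub>v n)) = n" by simp
  have q: "fit (l + par_n \<eta> + par_r \<eta>) (zero_row_query \<eta> vk y) = zero_row_query \<eta> vk y"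
    using vk y by (intro fit_eq) (simp add: zero_row_query_def)
  have a: "a = bits_of_vec (\<pi> (0\<^sub>v n)) @ concat (map bits_of_vec (rows (A y))) @ bits_of_vec (b y)"
    unfolding a_def coin_oracle_def q using vk \<omega> y
    by (simp add: zero_row_query_def n_def Let_def)
  have rows: "\<forall>r\<in>set (rows (A y)). dim_vec r = k" "length (rows (A y)) = n"
    using A rows_carrier[of "A y"] by auto
  have "length (concat (map bits_of_vec rs)) = length rs * k" if "\<forall>r\<in>set rs. dim_vec r = k" for rs
    using that by (induction rs) auto
  then show "length a = n + (n * k + n)"
    using rows d\<pi> b by (simp add: a)
  have n0: "0 < n" using par_n_bounds[OF \<eta>] by (simp add: n_def)
  then obtain rs where rs: "rows (A y) = row (A y) 0 # rs"
    using A by (cases "rows (A y)") (auto simp: rows_def map_eq_Cons_conv upt_eq_Cons_conv)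
  have row: "dim_vec (row (A y) 0) = k" using A by simp
  have "a ! (n + i) = (row (A y) 0 $ i = 1)" if "i < k" for i
    using that row d\<pi> unfolding a rs by (simp add: nth_append nth_bits_of_vec)
  moreover have "row (A y) 0 = 0\<^sub>v k \<longleftrightarrow> (\<forall>i<k. row (A y) 0 $ i = 0)"
    using row by (auto intro!: eq_vecI)
  ultimately show "(\<forall>i<k. \<not> a ! (n + i)) \<longleftrightarrow> zero_row \<eta> (f vk) y"
    by (auto simp: zero_row_def \<omega> k_def)
qed

text \<open>The indistinguishability is used against the worst choice of \<open>vk\<close> and \<open>y\<close>, which a
  non-uniform distinguisher can have hard-wired.\<close>

lemma prf_zero_row_negl:
  assumes F: "pseudorandom_function l F" and l: "poly_bounded l"
  obtains \<epsilon> where "negl \<epsilon>"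
    and "\<And>\<eta> vk y. 0 < \<eta> \<Longrightarrow> length vk = l \<eta> \<Longrightarrow> y \<in> carrier_vec (par_r \<eta>) \<Longrightarrow>
      measure_pmf.prob (uniform_bits (prf_key_len F \<eta>)) {\<kappa>. zero_row \<eta> (prf_eval F \<eta> \<kappa> vk) y} \<le> \<epsilon> \<eta>"
proof -
  define p where "p \<eta> = (\<lambda>(vk, y). measure_pmf.prob (uniform_bits (prf_key_len F \<eta>))
    {\<kappa>. zero_row \<eta> (prf_eval F \<eta> \<kappa> vk) y})" for \<eta>
  define Q where "Q \<eta> = (bits_of_length (l \<eta>) \<times> carrier_vec (par_r \<eta>) :: (bool list \<times> bitvec) set)" for \<eta>
  have "\<exists>x\<in>Q \<eta>. \<forall>x'\<in>Q \<eta>. p \<eta> x' \<le> p \<eta> x" for \<eta>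
  proof -
    have "(replicate (l \<eta>) False, 0\<^sub>v (par_r \<eta>)) \<in> Q \<eta>" by (simp add: Q_def)
    then have "p \<eta> ` Q \<eta> \<noteq> {}" "finite (p \<eta> ` Q \<eta>)" by (blast, simp add: Q_def)
    from Max_in[OF this(2,1)] Max_ge[OF this(2)] show ?thesis by fastforce
  qed
  then obtain x where x: "\<And>\<eta>. x \<eta> \<in> Q \<eta>" "\<And>\<eta> x'. x' \<in> Q \<eta> \<Longrightarrow> p \<eta> x' \<le> p \<eta> (x \<eta>)"
    by metis
  define vk y where "vk \<eta> = fst (x \<eta>)" and "y \<eta> = snd (x \<eta>)" for \<eta>
  have vk: "length (vk \<eta>) = l \<eta>" and y: "y \<eta> \<in> carrier_vec (par_r \<eta>)" for \<eta>
    using x(1)[of \<eta>] by (auto simp: Q_def vk_def y_def)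
  define \<D> where "\<D> \<eta> = zero_test (zero_row_query \<eta> (vk \<eta>) (y \<eta>))
    (par_n \<eta> + (par_n \<eta> * (par_n \<eta> - par_r \<eta>) + par_n \<eta>)) (par_n \<eta>) (par_n \<eta> - par_r \<eta>)" for \<eta>
  have "qpt \<D>"
    unfolding qpt_def
  proof (intro conjI allI)
    show "qcirc_wf (\<D> \<eta>)" for \<eta>
      unfolding \<D>_def by (rule zero_test_wf) simp
    have "poly_bounded (\<lambda>\<eta>. 2 * l \<eta> + (par_n \<eta> * par_n \<eta> + 9 * par_n \<eta> + 5))"
      by (intro poly_bounded_add poly_bounded_mult l poly_bounded_const poly_bounded_par_n)
    then show "poly_bounded (\<lambda>\<eta>. qc_wires (\<D> \<eta>) + length (qc_gates (\<D> \<eta>)))"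
    proof (rule poly_bounded_mono)
      fix \<eta>
      have r: "par_r \<eta> \<le> par_n \<eta>" by (simp add: par_n_def)
      have "par_n \<eta> * (par_n \<eta> - par_r \<eta>) \<le> par_n \<eta> * par_n \<eta>" by simp
      moreover have "length (zero_row_query \<eta> (vk \<eta>) (y \<eta>)) = l \<eta> + par_n \<eta> + par_r \<eta>"
        using vk y by (simp add: zero_row_query_def)
      ultimately show "qc_wires (\<D> \<eta>) + length (qc_gates (\<D> \<eta>))
          \<le> 2 * l \<eta> + (par_n \<eta> * par_n \<eta> + 9 * par_n \<eta> + 5)"
        unfolding \<D>_def using r by (intro order.trans[OF zero_test_size]) linarith
    qed
  qed
  then have neg: "negl (\<lambda>\<eta>. \<bar>pmf (prf_real l F \<D> \<eta>) True - pmf (prf_ideal l \<D> \<eta>) True\<bar>)"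
    using F by (auto simp: pseudorandom_function_def)
  have coins: "prf_eval F \<eta> \<kappa> v \<in> obar_coin_space \<eta>"
    if "length \<kappa> = prf_key_len F \<eta>" "length v = l \<eta>" for \<eta> \<kappa> v
    using F that by (auto simp: pseudorandom_function_def)
  \<comment> \<open>The output bit is determined by the oracle, so both experiments return exactly
    the event of a zero row, without sampling error.\<close>
  have run: "bind_pmf (qcirc_run (coin_oracle (l \<eta>) \<eta> f) (\<D> \<eta>)) (\<lambda>w. return_pmf (take 1 w = [True]))
      = return_pmf (zero_row \<eta> (f (vk \<eta>)) (y \<eta>))"
    if \<eta>: "0 < \<eta>" and f: "f (vk \<eta>) \<in> obar_coin_space \<eta>" for \<eta> f
  proof -
    note co = coin_oracle_zero_row_query[where f = f and vk = "vk \<eta>", OF \<eta> f vk y]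
    have le: "par_n \<eta> + (par_n \<eta> - par_r \<eta>)
        \<le> par_n \<eta> + (par_n \<eta> * (par_n \<eta> - par_r \<eta>) + par_n \<eta>)"
      by (simp add: trans_le_add2)
    obtain w where w: "qcirc_run (coin_oracle (l \<eta>) \<eta> f) (\<D> \<eta>) = return_pmf w"
      "take 1 w = [True] \<longleftrightarrow> zero_row \<eta> (f (vk \<eta>)) (y \<eta>)"
      using zero_test_run[where p = "par_n \<eta>" and l = "par_n \<eta> - par_r \<eta>"
          and O' = "coin_oracle (l \<eta>) \<eta> f", OF le co(1)]
      unfolding co(2) \<D>_def by auto
    then show ?thesis by (simp add: bind_return_pmf)
  qed
  have fin: "finite (bits_of_length k)" "bits_of_length k \<noteq> {}" for k
    using Ex_list_of_length[of k] by auto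
  have real: "pmf (prf_real l F \<D> \<eta>) True = p \<eta> (x \<eta>)" if \<eta>: "0 < \<eta>" for \<eta>
  proof -
    have "prf_real l F \<D> \<eta> = bind_pmf (uniform_bits (prf_key_len F \<eta>))
        (\<lambda>\<kappa>. return_pmf (zero_row \<eta> (prf_eval F \<eta> \<kappa> (vk \<eta>)) (y \<eta>)))"
      unfolding prf_real_def using coins vk fin
      by (intro bind_pmf_cong refl run[OF \<eta>]) (auto simp: uniform_bits_def)
    then show ?thesis
      by (simp add: pmf_bind_return_True p_def vk_def y_def case_prod_unfold)
  qed
  have ideal: "pmf (prf_ideal l \<D> \<eta>) True \<le> 1 / 2 ^ (24 * \<eta>)" if \<eta>: "0 < \<eta>" for \<eta>
  proof -
    have ne: "obar_coin_space \<eta> \<noteq> {}"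
      using coins[of "replicate (prf_key_len F \<eta>) False" \<eta> "vk \<eta>"] vk by auto
    have "finite (bits_of_length (l \<eta>) \<rightarrow>\<^sub>E obar_coin_space \<eta>)"
      "(bits_of_length (l \<eta>) \<rightarrow>\<^sub>E obar_coin_space \<eta>) \<noteq> {}"
      using ne by (auto simp: PiE_eq_empty_iff intro!: finite_PiE)
    then have "prf_ideal l \<D> \<eta> = bind_pmf (pmf_of_set (bits_of_length (l \<eta>) \<rightarrow>\<^sub>E obar_coin_space \<eta>))
        (\<lambda>f. return_pmf (zero_row \<eta> (f (vk \<eta>)) (y \<eta>)))"
      unfolding prf_ideal_def using vk
      by (intro bind_pmf_cong refl run[OF \<eta>]) (auto dest: PiE_mem)
    then show ?thesis
      using prob_ideal_zero_row_le[OF \<eta> y vk ne] by (simp add: pmf_bind_return_True)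
  qed
  show thesis
  proof (rule that)
    \<comment> \<open>Distinguishing advantage plus the ideal probability, where
      \<open>1 / 2 ^ (24 * \<eta>)\<close> is relaxed to \<open>1 / 2 ^ \<eta>\<close>.\<close>
    let ?\<epsilon> = "\<lambda>\<eta>. \<bar>pmf (prf_real l F \<D> \<eta>) True - pmf (prf_ideal l \<D> \<eta>) True\<bar> + 1 / 2 ^ \<eta>"
    show "negl ?\<epsilon>" by (rule negl_add[OF neg negl_inverse_power2])
    show "measure_pmf.prob (uniform_bits (prf_key_len F \<eta>)) {\<kappa>. zero_row \<eta> (prf_eval F \<eta> \<kappa> v) z} \<le> ?\<epsilon> \<eta>"
      if \<eta>: "0 < \<eta>" and v: "length v = l \<eta>" and z: "z \<in> carrier_vec (par_r \<eta>)" for \<eta> v z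
    proof -
      have "p \<eta> (v, z) \<le> p \<eta> (x \<eta>)" using v z by (intro x(2)) (simp add: Q_def)
      moreover have "(1 :: real) / 2 ^ (24 * \<eta>) \<le> 1 / 2 ^ \<eta>"
        by (intro divide_left_mono power_increasing) auto
      ultimately show ?thesis
        using real[OF \<eta>] ideal[OF \<eta>] by (simp add: p_def)
    qed
  qed
qed

section \<open>Measuring a qubit isometry\<close>

text \<open>With \<open>x b = V b a\<close> this is the diagonal entry at \<open>a\<close> of the
  state after \<open>V\<close>, that is, the probability of outcome \<open>a\<close>.\<close>

definition qubit_form :: "complex mat \<Rightarrow> (bool \<Rightarrow> complex) \<Rightarrow> complex" where
  "qubit_form \<rho> x =
     (\<Sum>b\<in>UNIV. \<Sum>b'\<in>UNIV. x b * \<rho> $$ (of_bool b, of_bool b') * cnj (x b'))"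

lemma qubit_form_nonneg:
  assumes "density_qubit \<rho>"
  shows "0 \<le> Re (qubit_form \<rho> x)" "Im (qubit_form \<rho> x) = 0"
proof -
  \<comment> \<open>In \<open>(\<rho> *\<^sub>v v) \<bullet>c v\<close> the conjugate falls on the
    row index, in \<open>qubit_form\<close> on the column index; conjugating \<open>x\<close>
    reconciles them.\<close>
  define v where "v = vec 2 (\<lambda>i. cnj (x (i = 1)))"
  have \<rho>: "\<rho> \<in> carrier_mat 2 2" using assms by (simp add: density_qubit_def)
  have v: "v \<in> carrier_vec 2" by (simp add: v_def)
  have "0 \<le> (\<rho> *\<^sub>v v) \<bullet>c v"
    using assms v by (simp add: density_qubit_def)
  moreover have "(\<rho> *\<^sub>v v) \<bullet>c v = qubit_form \<rho> x"
  proof -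
    have "{0..<2} = {0, 1 :: nat}" by auto
    moreover have "dim_row \<rho> = 2" "dim_col \<rho> = 2" "dim_vec v = 2" using \<rho> v by auto
    ultimately have "(\<rho> *\<^sub>v v) \<bullet>c v = (\<rho> $$ (0, 0) * v $ 0 + \<rho> $$ (0, 1) * v $ 1) * cnj (v $ 0)
        + (\<rho> $$ (1, 0) * v $ 0 + \<rho> $$ (1, 1) * v $ 1) * cnj (v $ 1)"
      by (simp add: scalar_prod_def)
    also have "\<dots> = qubit_form \<rho> x"
      by (simp add: v_def qubit_form_def UNIV_bool algebra_simps)
    finally show ?thesis .
  qed
  ultimately show "0 \<le> Re (qubit_form \<rho> x)" "Im (qubit_form \<rho> x) = 0"
    by (simp_all add: less_eq_complex_def)
qed

text \<open>Evaluating the positive form at \<open>(1, 1)\<close>, \<open>(1, -1)\<close>,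
  \<open>(1, \<i>)\<close> and \<open>(1, -\<i>)\<close> bounds the real and imaginary parts of the
  off-diagonal entries by half the trace.\<close>

lemma cmod_density_le_1:
  assumes "density_qubit \<rho>"
  shows "cmod (\<rho> $$ (of_bool b, of_bool b')) \<le> 1"
proof -
  note form = qubit_form_nonneg[OF assms]
  have tr: "Re (\<rho> $$ (0, 0)) + Re (\<rho> $$ (1, 1)) = 1"
    using assms by (simp add: density_qubit_def complex_eq_iff)
  have d: "0 \<le> Re (\<rho> $$ (0, 0))" "Im (\<rho> $$ (0, 0)) = 0"
    using form[of "\<lambda>b. of_bool (\<not> b)"] by (simp_all add: qubit_form_def UNIV_bool)
  have d': "0 \<le> Re (\<rho> $$ (1, 1))" "Im (\<rho> $$ (1, 1)) = 0"
    using form[of "\<lambda>b. of_bool b"] by (simp_all add: qubit_form_def UNIV_bool)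
  note f1 = form[of "\<lambda>b. 1"] and f2 = form[of "\<lambda>b. if b then - 1 else 1"]
    and f3 = form[of "\<lambda>b. if b then \<i> else 1"] and f4 = form[of "\<lambda>b. if b then - \<i> else 1"]
  have "\<bar>Re (\<rho> $$ (0, 1))\<bar> + \<bar>Im (\<rho> $$ (0, 1))\<bar> \<le> 1" "\<bar>Re (\<rho> $$ (1, 0))\<bar> + \<bar>Im (\<rho> $$ (1, 0))\<bar> \<le> 1"
    using f1 f2 f3 f4 d d' tr by (simp_all add: qubit_form_def UNIV_bool)
  then have "cmod (\<rho> $$ (0, 1)) \<le> 1" "cmod (\<rho> $$ (1, 0)) \<le> 1"
    using cmod_le[of "\<rho> $$ (0, 1)"] cmod_le[of "\<rho> $$ (1, 0)"] by linarith+
  moreover have "cmod (\<rho> $$ (0, 0)) \<le> 1" "cmod (\<rho> $$ (1, 1)) \<le> 1"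
    using cmod_le[of "\<rho> $$ (0, 0)"] cmod_le[of "\<rho> $$ (1, 1)"] d d' tr by linarith+
  ultimately show ?thesis by (cases b; cases b') simp_all
qed

locale qubit_isometry =
  fixes V :: "bool \<Rightarrow> 'a ket"
  assumes fin: "qfin (V b)"
    and orth: "qinner (V b) (V b') = (if b = b' then 1 else 0)"
begin

lemma norm: "qnorm2 (V b) = 1"
  using orth[of b b] by (simp add: qinner_self)

text \<open>\<open>embed_pmf\<close> is informative only for nonnegative weights of total 1.
  Positivity of \<rho> gives the first; orthonormality of the \<open>V b\<close> reduces the total
  to the trace of \<rho>.\<close>

lemma
  assumes \<rho>: "density_qubit \<rho>"
  shows pmf_measure_qubit: "pmf (measure_qubit \<rho> V) a = Re (qubit_form \<rho> (\<lambda>b. V b a))"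
    and prob_measure_qubit: "measure_pmf.prob (measure_qubit \<rho> V) A
      = (\<Sum>a\<in>(\<Union>b. qsupp (V b)) \<inter> A. Re (qubit_form \<rho> (\<lambda>b. V b a)))"
proof -
  let ?X = "\<Union>b. qsupp (V b)"
  let ?f = "\<lambda>a. Re (qubit_form \<rho> (\<lambda>b. V b a))"
  have X: "finite ?X" using fin by simp
  have f0: "?f a = 0" if "a \<notin> ?X" for a
    using that by (simp add: qubit_form_def qsupp_def)
  have inner: "(\<Sum>a\<in>?X. V b a * cnj (V b' a)) = (if b = b' then 1 else 0)" for b b'
    using orth[of b b'] X by (subst (asm) qinner_superset[OF X]) auto
  have "(\<Sum>a\<in>?X. qubit_form \<rho> (\<lambda>b. V b a))
      = (\<Sum>b\<in>UNIV. \<Sum>b'\<in>UNIV. \<rho> $$ (of_bool b, of_bool b') * (\<Sum>a\<in>?X. V b a * cnj (V b' a)))"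
    unfolding qubit_form_def
    by (subst sum.swap, intro sum.cong refl, subst sum.swap)
      (simp add: sum_distrib_left mult_ac)
  also have "\<dots> = \<rho> $$ (0, 0) + \<rho> $$ (1, 1)"
    unfolding inner by (simp add: UNIV_bool)
  finally have "(\<Sum>a\<in>?X. qubit_form \<rho> (\<lambda>b. V b a)) = 1"
    using \<rho> by (simp add: density_qubit_def)
  then have total: "(\<Sum>a\<in>?X. ?f a) = 1"
    by (metis Re_sum one_complex.sel(1))
  have nn: "0 \<le> ?f a" for a by (rule qubit_form_nonneg[OF \<rho>])
  have "(\<integral>\<^sup>+ a. ennreal (?f a) \<partial>count_space UNIV) = (\<Sum>a\<in>?X. ennreal (?f a))"
    using X f0 by (intro nn_integral_count_space'[of ?X]) auto
  also have "\<dots> = 1"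
    using total nn by (subst sum_ennreal) auto
  finally have pmf: "pmf (measure_qubit \<rho> V) a = ?f a" for a
    unfolding measure_qubit_def qubit_form_def[symmetric]
    by (intro pmf_embed_pmf nn)
  then show "pmf (measure_qubit \<rho> V) a = ?f a" .
  have "measure_pmf.prob (measure_qubit \<rho> V) A = measure_pmf.prob (measure_qubit \<rho> V) (?X \<inter> A)"
    by (intro measure_prob_cong_0) (use pmf f0 in auto)
  also have "\<dots> = (\<Sum>a\<in>?X \<inter> A. ?f a)"
    using X by (simp add: measure_measure_pmf_finite pmf)
  finally show "measure_pmf.prob (measure_qubit \<rho> V) A = (\<Sum>a\<in>?X \<inter> A. ?f a)" .
qed

end

lemma mult_le_weighted:
  fixes x y t :: real
  assumes "0 < t"
  shows "x * y \<le> (t * x\<^sup>2 + y\<^sup>2 / t) / 2"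
proof -
  have "0 \<le> (t * x - y)\<^sup>2 / t" using assms by simp
  also have "(t * x - y)\<^sup>2 / t = t * x\<^sup>2 + y\<^sup>2 / t - 2 * (x * y)"
    using assms by (simp add: power2_eq_square field_simps)
  finally show ?thesis by simp
qed

lemma sum_cmod_power2_le_qnorm2:
  assumes "qfin \<psi>" "finite Y"
  shows "(\<Sum>a\<in>Y. (cmod (\<psi> a))\<^sup>2) \<le> qnorm2 \<psi>"
proof -
  have "(\<Sum>a\<in>Y. (cmod (\<psi> a))\<^sup>2) \<le> (\<Sum>a\<in>Y \<union> qsupp \<psi>. (cmod (\<psi> a))\<^sup>2)"
    using assms by (intro sum_mono2) auto
  also have "\<dots> = qnorm2 \<psi>"
    using assms by (intro qprob_superset[symmetric]) auto
  finally show ?thesis .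
qed

lemma sum_cmod_mult_le:
  assumes \<psi>: "qfin \<psi>" "qnorm2 \<psi> \<le> 1" and \<phi>: "qfin \<phi>" "qnorm2 \<phi> \<le> d" and t: "0 < t" and Y: "finite Y"
  shows "(\<Sum>a\<in>Y. cmod (\<psi> a) * cmod (\<phi> a)) \<le> (t + d / t) / 2"
proof -
  have "(\<Sum>a\<in>Y. cmod (\<psi> a) * cmod (\<phi> a))
      \<le> (\<Sum>a\<in>Y. (t * (cmod (\<psi> a))\<^sup>2 + (cmod (\<phi> a))\<^sup>2 / t) / 2)"
    by (intro sum_mono mult_le_weighted t)
  also have "\<dots> = (t * (\<Sum>a\<in>Y. (cmod (\<psi> a))\<^sup>2) + (\<Sum>a\<in>Y. (cmod (\<phi> a))\<^sup>2) / t) / 2"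
    by (simp add: sum.distrib sum_distrib_left sum_divide_distrib add_divide_distrib)
  also have "\<dots> \<le> (t * 1 + d / t) / 2"
    using sum_cmod_power2_le_qnorm2[OF \<psi>(1) Y] sum_cmod_power2_le_qnorm2[OF \<phi>(1) Y] \<psi>(2) \<phi>(2) t
    by (intro divide_right_mono add_mono mult_left_mono) auto
  finally show ?thesis by simp
qed

text \<open>For each pair of bits, \<open>V b a * cnj (V b' a) - T b a * cnj (T b' a)\<close> splits
  into two products with one factor a difference, and each product is estimated with weight
  \<open>t\<close>. The four entries of \<rho> have modulus at most 1, whence the factor 4.\<close>

lemma measure_qubit_perturbation:
  fixes V T :: "bool \<Rightarrow> 'a ket"
  assumes \<rho>: "density_qubit \<rho>" and Y: "finite Y" and t: "0 < t"
    and V: "\<And>b. qfin (V b)" "\<And>b. qnorm2 (V b) \<le> 1"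
    and T: "\<And>b. qfin (T b)" "\<And>b. qnorm2 (T b) \<le> 1"
    and d: "\<And>b. qnorm2 (\<lambda>a. V b a - T b a) \<le> d"
  shows "\<bar>(\<Sum>a\<in>Y. Re (qubit_form \<rho> (\<lambda>b. V b a))) - (\<Sum>a\<in>Y. Re (qubit_form \<rho> (\<lambda>b. T b a)))\<bar>
    \<le> 4 * (t + d / t)"
proof -
  let ?\<Delta> = "\<lambda>b a. V b a - T b a"
  let ?r = "\<lambda>b b'. \<rho> $$ (of_bool b, of_bool b')"
  have \<Delta>: "qfin (?\<Delta> b)" for b
    using V(1)[of b] T(1)[of b] by (intro finite_subset[OF qsupp_diff]) simp
  have entry: "cmod (\<Sum>a\<in>Y. ?r b b' * (V b a * cnj (V b' a) - T b a * cnj (T b' a))) \<le> t + d / t"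
    for b b'
  proof -
    have "cmod (\<Sum>a\<in>Y. ?r b b' * (V b a * cnj (V b' a) - T b a * cnj (T b' a)))
        = cmod (?r b b') * cmod (\<Sum>a\<in>Y. V b a * cnj (V b' a) - T b a * cnj (T b' a))"
      by (simp add: sum_distrib_left[symmetric] norm_mult)
    also have "\<dots> \<le> 1 * cmod (\<Sum>a\<in>Y. V b a * cnj (V b' a) - T b a * cnj (T b' a))"
      by (intro mult_right_mono cmod_density_le_1[OF \<rho>]) simp
    also have "\<dots> \<le> (\<Sum>a\<in>Y. cmod (V b a) * cmod (?\<Delta> b' a) + cmod (T b' a) * cmod (?\<Delta> b a))"
    proof (simp only: mult_1, rule order.trans[OF norm_sum], rule sum_mono)
      fix a
      have "V b a * cnj (V b' a) - T b a * cnj (T b' a)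
          = V b a * cnj (?\<Delta> b' a) + cnj (T b' a) * ?\<Delta> b a"
        by (simp add: algebra_simps)
      then show "cmod (V b a * cnj (V b' a) - T b a * cnj (T b' a))
          \<le> cmod (V b a) * cmod (?\<Delta> b' a) + cmod (T b' a) * cmod (?\<Delta> b a)"
        using norm_triangle_ineq[of "V b a * cnj (?\<Delta> b' a)" "cnj (T b' a) * ?\<Delta> b a"]
        by (simp add: norm_mult del: complex_cnj_diff)
    qed
    also have "\<dots> \<le> (t + d / t) / 2 + (t + d / t) / 2"
      unfolding sum.distrib
      by (intro add_mono sum_cmod_mult_le V T \<Delta> d t Y)
    finally show ?thesis by simp
  qed
  have "(\<Sum>a\<in>Y. Re (qubit_form \<rho> (\<lambda>b. V b a))) - (\<Sum>a\<in>Y. Re (qubit_form \<rho> (\<lambda>b. T b a)))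
      = Re (\<Sum>a\<in>Y. qubit_form \<rho> (\<lambda>b. V b a) - qubit_form \<rho> (\<lambda>b. T b a))"
    by (simp add: sum_subtractf)
  also have "(\<Sum>a\<in>Y. qubit_form \<rho> (\<lambda>b. V b a) - qubit_form \<rho> (\<lambda>b. T b a))
      = (\<Sum>b\<in>UNIV. \<Sum>b'\<in>UNIV. \<Sum>a\<in>Y. ?r b b' * (V b a * cnj (V b' a) - T b a * cnj (T b' a)))"
  proof -
    have "qubit_form \<rho> (\<lambda>b. V b a) - qubit_form \<rho> (\<lambda>b. T b a)
        = (\<Sum>b\<in>UNIV. \<Sum>b'\<in>UNIV. ?r b b' * (V b a * cnj (V b' a) - T b a * cnj (T b' a)))" for a
      unfolding qubit_form_def sum_subtractf[symmetric]
      by (intro sum.cong refl) (simp add: algebra_simps)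
    then show ?thesis
      by (simp only:) (subst sum.swap, intro sum.cong refl, rule sum.swap)
  qed
  finally have "\<bar>(\<Sum>a\<in>Y. Re (qubit_form \<rho> (\<lambda>b. V b a))) - (\<Sum>a\<in>Y. Re (qubit_form \<rho> (\<lambda>b. T b a)))\<bar>
      \<le> cmod (\<Sum>b\<in>UNIV. \<Sum>b'\<in>UNIV. \<Sum>a\<in>Y. ?r b b' * (V b a * cnj (V b' a) - T b a * cnj (T b' a)))"
    by (simp only: abs_Re_le_cmod)
  also have "\<dots> \<le> (\<Sum>b::bool\<in>UNIV. \<Sum>b'::bool\<in>UNIV. t + d / t)"
    by (intro sum_norm_le entry)
  also have "\<dots> = 4 * (t + d / t)"
    by (simp add: UNIV_bool)
  finally show ?thesis .
qed

section \<open>Total variation distance\<close>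

lemma tv_dist_nonneg: "0 \<le> tv_dist p q"
proof -
  have "\<bar>measure_pmf.prob p A - measure_pmf.prob q A\<bar> \<le> 1" for A
    using measure_pmf.prob_le_1[of p A] measure_pmf.prob_le_1[of q A]
      measure_nonneg[of p A] measure_nonneg[of q A] by linarith
  then have "bdd_above (range (\<lambda>A. \<bar>measure_pmf.prob p A - measure_pmf.prob q A\<bar>))"
    by (intro bdd_aboveI[of _ 1]) auto
  from cSUP_upper[OF _ this, of "{}"] show ?thesis
    by (simp add: tv_dist_def)
qed

text \<open>Lower bounds suffice: all mass of the first distribution lies on the two bits, so if
  neither bit loses more than \<epsilon>, no event loses more than \<open>2 * \<epsilon>\<close>.
  Passing to the complement bounds the gain.\<close>

lemma tv_dist_Some_le:
  fixes p :: "bool pmf"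
  assumes "\<And>\<beta>. pmf p \<beta> - \<epsilon> \<le> pmf q (Some \<beta>)" "0 \<le> \<epsilon>"
  shows "tv_dist (map_pmf Some p) q \<le> 2 * \<epsilon>"
proof -
  have P: "measure_pmf.prob (map_pmf Some p) A = (\<Sum>\<beta>\<in>{\<beta>. Some \<beta> \<in> A}. pmf p \<beta>)" for A
    unfolding measure_map_pmf vimage_def by (rule measure_measure_pmf_finite) simp
  have Q: "(\<Sum>\<beta>\<in>{\<beta>. Some \<beta> \<in> A}. pmf q (Some \<beta>)) \<le> measure_pmf.prob q A" for A
  proof -
    have "(\<Sum>\<beta>\<in>{\<beta>. Some \<beta> \<in> A}. pmf q (Some \<beta>)) = measure_pmf.prob q (Some ` {\<beta>. Some \<beta> \<in> A})"
      by (subst measure_measure_pmf_finite) (simp_all add: sum.reindex)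
    also have "\<dots> \<le> measure_pmf.prob q A"
      by (intro measure_pmf.finite_measure_mono) auto
    finally show ?thesis .
  qed
  have le: "measure_pmf.prob (map_pmf Some p) A - measure_pmf.prob q A \<le> 2 * \<epsilon>" for A
  proof -
    have "(\<Sum>\<beta>\<in>{\<beta>. Some \<beta> \<in> A}. pmf p \<beta>) - (\<Sum>\<beta>\<in>{\<beta>. Some \<beta> \<in> A}. pmf q (Some \<beta>))
        \<le> (\<Sum>\<beta>\<in>{\<beta>. Some \<beta> \<in> A}. \<epsilon>)"
      unfolding sum_subtractf[symmetric] using assms(1) by (intro sum_mono) (simp add: algebra_simps)
    also have "\<dots> \<le> (\<Sum>\<beta>::bool\<in>UNIV. \<epsilon>)"
      using assms(2) by (intro sum_mono2) auto
    finally show ?thesis using P[of A] Q[of A] by (simp add: UNIV_bool)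
  qed
  have "\<bar>measure_pmf.prob (map_pmf Some p) A - measure_pmf.prob q A\<bar> \<le> 2 * \<epsilon>" for A
    using le[of A] le[of "- A"] measure_pmf.prob_compl[of A "map_pmf Some p"]
      measure_pmf.prob_compl[of A q] by (simp add: Compl_eq_Diff_UNIV)
  then show ?thesis
    unfolding tv_dist_def by (intro cSUP_least) auto
qed

section \<open>The coset states\<close>

lemma qrestrict_bind:
  assumes "qfin \<psi>"
    and "\<And>a. a \<in> qsupp \<psi> \<Longrightarrow> a \<in> A \<Longrightarrow> qsupp (V a) \<subseteq> B"
    and "\<And>a. a \<in> qsupp \<psi> \<Longrightarrow> a \<notin> A \<Longrightarrow> qsupp (V a) \<inter> B = {}"
  shows "qrestrict B (qbind \<psi> V) = qbind (qrestrict A \<psi>) V"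
proof (rule ext)
  fix b
  have "qbind (qrestrict A \<psi>) V b = (\<Sum>a\<in>qsupp \<psi>. (if a \<in> A then \<psi> a else 0) * V a b)"
    by (subst qbind_superset[OF assms(1)]) (auto simp: qrestrict_def qsupp_def)
  also have "\<dots> = (\<Sum>a\<in>qsupp \<psi>. if b \<in> B then \<psi> a * V a b else 0)"
    using assms(2,3) by (intro sum.cong refl) (auto simp: qsupp_def)
  also have "\<dots> = qrestrict B (qbind \<psi> V) b"
    by (simp add: qrestrict_def qbind_supp)
  finally show "qrestrict B (qbind \<psi> V) b = qbind (qrestrict A \<psi>) V b" ..
qed

text \<open>An isometry that maps labels in \<open>A\<close> into \<open>B\<close> and the others
  outside \<open>B\<close> cannot shift weight across. This carries a probability through later
  steps that leave the tested register alone.\<close>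

lemma qprob_bind_preserved:
  assumes "qfin \<psi>" "\<And>a. a \<in> qsupp \<psi> \<Longrightarrow> qfin (V a)"
    and "\<And>a b. a \<in> qsupp \<psi> \<Longrightarrow> b \<in> qsupp \<psi> \<Longrightarrow> qinner (V a) (V b) = (if a = b then 1 else 0)"
    and "\<And>a. a \<in> qsupp \<psi> \<Longrightarrow> a \<in> A \<Longrightarrow> qsupp (V a) \<subseteq> B"
    and "\<And>a. a \<in> qsupp \<psi> \<Longrightarrow> a \<notin> A \<Longrightarrow> qsupp (V a) \<inter> B = {}"
  shows "qprob (qbind \<psi> V) B = qprob \<psi> A"
proof -
  have "qprob (qbind \<psi> V) B = qnorm2 (qrestrict B (qbind \<psi> V))"
    by (simp only: qnorm2_restrict)
  also have "\<dots> = qnorm2 (qbind (qrestrict A \<psi>) V)"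
  proof -
    have "qrestrict B (qbind \<psi> V) = qbind (qrestrict A \<psi>) V"
      by (rule qrestrict_bind) (use assms in auto)
    then show ?thesis by (simp only:)
  qed
  also have "\<dots> = qprob \<psi> A"
    using assms(1-3) by (subst qnorm2_bind) auto
  finally show ?thesis .
qed

definition correct_ket :: "bool \<Rightarrow> (bitvec \<Rightarrow> complex) \<Rightarrow> bitvec \<Rightarrow> bitvec ket" where
  "correct_ket c z u = (if (u $ 0 = 1) = c then qreturn u
     else do { v \<leftarrow> hadamard_vec u; v \<leftarrow> qphase (z v) v; hadamard_vec v })"

lemma qunitary_hadamard_phase:
  assumes "\<And>v. v \<in> carrier_vec n \<Longrightarrow> z v * cnj (z v) = 1"
  shows "qunitary (carrier_vec n)
    (\<lambda>u. qbind (hadamard_vec u) (\<lambda>v. qbind (qphase (z v) v) hadamard_vec))"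
  by (intro qunitary_bind qunitary_hadamard_vec qunitary_phase finite_carrier_vec assms)

text \<open>Each branch is unitary, but the images of the two branches may overlap: with the ideal
  phase and a nonzero first row both halves of the coset end in the same half. Therefore only inputs
  with equal first bit are compared, and the kept record of that bit separates the others.\<close>

lemma correct_ket:
  assumes z: "\<And>v. v \<in> carrier_vec n \<Longrightarrow> z v * cnj (z v) = 1" and u: "u \<in> carrier_vec n"
  shows "qfin (correct_ket c z u)" "qsupp (correct_ket c z u) \<subseteq> carrier_vec n"
    and "u' \<in> carrier_vec n \<Longrightarrow> (u $ 0 = 1) = (u' $ 0 = 1) \<Longrightarrow>
      qinner (correct_ket c z u) (correct_ket c z u') = (if u = u' then 1 else 0)"
  using qunitaryD(2-4)[OF qunitary_hadamard_phase[of n z, OF z]] u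
  by (auto simp: correct_ket_def)

lemma qsupp_uniform_ket: "qsupp (uniform_ket l) = carrier_vec l"
  by (auto simp: qsupp_def uniform_ket_def)

lemma qnorm2_uniform_ket: "qnorm2 (uniform_ket l) = 1"
  by (simp add: qprob_def qsupp_uniform_ket) (simp add: uniform_ket_def card_carrier_vec norm_divide
    power_divide flip: of_real_power)

text \<open>The value of \<open>u $ 0 = 1\<close> stays in the label as the record of the
  measurement. The phase is left open because the actual and the idealised commitment both have this
  form.\<close>

definition obar_observed_ket :: "nat \<Rightarrow> obar_coins \<Rightarrow> bool \<Rightarrow> (bitvec \<Rightarrow> bitvec \<Rightarrow> complex) \<Rightarrow>
    (bitvec \<times> bitvec \<times> bitvec \<times> bool) ket" where
  "obar_observed_ket \<eta> \<omega> c z = do {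
    (y, u, x) \<leftarrow> obar_gen_ket \<eta> (obar_P (obar_setup \<eta> \<omega>)) (obar_Pinv (obar_setup \<eta> \<omega>));
    u' \<leftarrow> correct_ket c (z y) u;
    qreturn (y, u', x, u $ 0 = 1)
  }"

text \<open>The phase that is applied when the signature of 0 is valid.\<close>

definition obar_dual_sign :: "nat \<Rightarrow> obar_coins \<Rightarrow> bitvec \<Rightarrow> bitvec \<Rightarrow> complex" where
  "obar_dual_sign \<eta> \<omega> y v = (if obar_D (obar_setup \<eta> \<omega>) y v then 1 else - 1)"

section \<open>Key generation of the coset scheme for fixed coins\<close>

locale obar_run =
  fixes \<eta> :: nat and \<pi> :: "bitvec \<Rightarrow> bitvec" and A :: "bitvec \<Rightarrow> bit mat" and b :: "bitvec \<Rightarrow> bitvec"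
  assumes coins: "(\<pi>, A, b) \<in> obar_coin_space \<eta>" and \<eta>_pos: "0 < \<eta>"
begin

abbreviation n where "n \<equiv> par_n \<eta>"
abbreviation r where "r \<equiv> par_r \<eta>"
abbreviation l where "l \<equiv> n - r"
abbreviation \<omega> where "\<omega> \<equiv> (\<pi>, A, b)"
abbreviation ob where "ob \<equiv> obar_setup \<eta> (\<pi>, A, b)"

lemma n_eq: "n = r + l" and n_pos: "0 < n"
  using par_n_bounds[OF \<eta>_pos] by auto

lemma \<pi>_permutes: "\<pi> permutes carrier_vec n"
  and A_full: "y \<in> carrier_vec r \<Longrightarrow> A y \<in> full_rank_mats n l"
  and b_carrier: "y \<in> carrier_vec r \<Longrightarrow> b y \<in> carrier_vec n"
  using coins by (auto simp: obar_coin_space_def par_k_def dest: PiE_mem)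

lemma A_carrier: "y \<in> carrier_vec r \<Longrightarrow> A y \<in> carrier_mat n l"
  using A_full by (auto simp: full_rank_mats_def)

lemma bit_coset: "y \<in> carrier_vec r \<Longrightarrow> bit_coset (A y) (b y) n l"
  using A_carrier b_carrier n_pos by unfold_locales

abbreviation S where "S y \<equiv> coset_S \<eta> \<omega> y"
abbreviation S_bit where "S_bit y c \<equiv> coset_S_bit \<eta> \<omega> y c"

lemma S_eq: "S y = bit_coset.coset (A y) (b y) l" if "y \<in> carrier_vec r"
  using bit_coset.coset_def[OF bit_coset[OF that]] by (simp add: coset_S_def)

lemma S_bit_eq: "S_bit y c = bit_coset.coset_bit (A y) (b y) l c" if "y \<in> carrier_vec r"
  using bit_coset.coset_bit_def[OF bit_coset[OF that]] by (simp add: coset_S_bit_def S_eq[OF that])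

lemma D_eq: "obar_D ob y v = bit_coset.dual (A y) l v" if "y \<in> carrier_vec r"
  using bit_coset.dual_def[OF bit_coset[OF that]] by (simp add: obar_setup_def)

lemma zero_row_eq: "zero_row \<eta> \<omega> y \<longleftrightarrow> row (A y) 0 = 0\<^sub>v l"
  by (simp add: zero_row_def)

lemma S_carrier: "y \<in> carrier_vec r \<Longrightarrow> u \<in> S y \<Longrightarrow> u \<in> carrier_vec n"
  using bit_coset.coset_carrier[OF bit_coset] by (simp add: S_eq)

lemma A_inj:
  assumes y: "y \<in> carrier_vec r" and z: "z \<in> carrier_vec l" "z' \<in> carrier_vec l"
    and eq: "A y *\<^sub>v z + b y = A y *\<^sub>v z' + b y"
  shows "z = z'"
proof -
  note cA = A_carrier[OF y]
  have c: "A y *\<^sub>v z \<in> carrier_vec n" "A y *\<^sub>v z' \<in> carrier_vec n"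
    using cA z by auto
  have "A y *\<^sub>v z = A y *\<^sub>v z + b y + b y"
    using c(1) b_carrier[OF y] by simp
  also have "\<dots> = A y *\<^sub>v z'"
    unfolding eq using c(2) b_carrier[OF y] by simp
  finally have "A y *\<^sub>v (z - z') = 0\<^sub>v n"
    using mult_minus_distrib_mat_vec[OF cA z] c by simp
  moreover have "vec_space.rank n (A y) = l"
    using A_full[OF y] by (simp add: full_rank_mats_def)
  ultimately have "z - z' = 0\<^sub>v l"
    using full_column_rank_iff[OF cA] z by simp
  have "z $ i = z' $ i" if "i < l" for i
  proof -
    have "z $ i - z' $ i = (z - z') $ i"
      by (rule index_minus_vec(1)[symmetric]) (use that z in simp)
    also have "\<dots> = 0" unfolding \<open>z - z' = 0\<^sub>v l\<close> using that by simp
    finally show ?thesis by (simp only: right_minus_eq)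
  qed
  then show ?thesis using carrier_vecD[OF z(1)] carrier_vecD[OF z(2)] by (intro eq_vecI) simp_all
qed

definition first_part :: "bitvec \<Rightarrow> bitvec" where "first_part x = vec_first (\<pi> x) r"
definition last_part :: "bitvec \<Rightarrow> bitvec" where "last_part x = vec_last (\<pi> x) l"
definition image_vec :: "bitvec \<Rightarrow> bitvec" where
  "image_vec x = A (first_part x) *\<^sub>v last_part x + b (first_part x)"

lemma parts:
  assumes "x \<in> carrier_vec n"
  shows "first_part x \<in> carrier_vec r" "last_part x \<in> carrier_vec l"
    and "first_part x @\<^sub>v last_part x = \<pi> x"
proof -
  have "\<pi> x \<in> carrier_vec (r + l)"
    using permutes_in_image[OF \<pi>_permutes] assms n_eq by simp
  then show "first_part x @\<^sub>v last_part x = \<pi> x"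
    unfolding first_part_def last_part_def by (rule vec_first_last_append)
qed (simp_all add: first_part_def last_part_def)

lemma P_eq: "obar_P ob x = (first_part x, image_vec x)"
  by (simp add: obar_setup_def first_part_def last_part_def image_vec_def Let_def)

lemma Pinv_P:
  assumes x: "x \<in> carrier_vec n"
  shows "obar_Pinv ob (first_part x) (image_vec x) = Some x"
proof -
  have Z: "{z \<in> carrier_vec l. image_vec x = A (first_part x) *\<^sub>v z + b (first_part x)} = {last_part x}"
  proof (intro equalityI subsetI)
    fix z assume z: "z \<in> {z \<in> carrier_vec l. image_vec x = A (first_part x) *\<^sub>v z + b (first_part x)}"
    have "z = last_part x"
      by (rule A_inj[OF parts(1)[OF x] _ parts(2)[OF x]]) (use z in \<open>simp_all add: image_vec_def\<close>)
    then show "z \<in> {last_part x}" by simp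
  qed (use parts(2)[OF x] in \<open>simp add: image_vec_def\<close>)
  have "inv_into UNIV \<pi> (\<pi> x) = x"
    using permutes_inverses(2)[OF \<pi>_permutes] by simp
  then show ?thesis
    unfolding obar_setup_def prod.case obar.simps Let_def Z using parts(3)[OF x] by simp
qed

abbreviation gen_ket where "gen_ket \<equiv> obar_gen_ket \<eta> (obar_P ob) (obar_Pinv ob)"
abbreviation gen_label where "gen_label x \<equiv> (first_part x, image_vec x, 0\<^sub>v n :: bitvec)"

text \<open>The inverse recovers \<open>x\<close>, and \<open>x + x = 0\<close> modulo 2, so the
  input register ends in the zero vector and no longer distinguishes the branches.\<close>

lemma gen_ket_eq: "gen_ket = qbind (uniform_ket n) (\<lambda>x. qreturn (gen_label x))"
  unfolding obar_gen_ket_def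
proof (rule qbind_cong)
  fix x assume "x \<in> qsupp (uniform_ket n)"
  then have x: "x \<in> carrier_vec n" by (simp add: qsupp_uniform_ket)
  then show "(let (y, u) = obar_P ob x in
      qreturn (y, u, x + (case obar_Pinv ob y u of None \<Rightarrow> 0\<^sub>v n | Some x' \<Rightarrow> x')))
    = qreturn (gen_label x)"
    by (simp add: P_eq Pinv_P[OF x])
qed

lemma gen_label_inj: "inj_on gen_label (carrier_vec n)"
proof (rule inj_onI)
  fix x x' assume x: "x \<in> carrier_vec n" "x' \<in> carrier_vec n" and eq: "gen_label x = gen_label x'"
  have "last_part x = last_part x'"
  proof (rule A_inj[OF parts(1,2)[OF x(1)] parts(2)[OF x(2)]])
    have "first_part x = first_part x'" "image_vec x = image_vec x'" using eq by auto
    then show "A (first_part x) *\<^sub>v last_part x + b (first_part x)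
        = A (first_part x) *\<^sub>v last_part x' + b (first_part x)"
      by (simp add: image_vec_def)
  qed
  then have "\<pi> x = \<pi> x'"
    using eq parts(3)[OF x(1)] parts(3)[OF x(2)] by simp
  then show "x = x'"
    using permutes_inj[OF \<pi>_permutes] by (auto dest: injD)
qed

text \<open>Since \<pi> is a permutation, \<open>\<pi> x\<close> ranges over all concatenations of
  \<open>y\<close> and \<open>z\<close>. Together with \<open>gen_label_inj\<close> this makes the
  state flat over all pairs of a \<open>y\<close> and a point of its coset.\<close>

lemma gen_label_image:
  "gen_label ` carrier_vec n = {(y, u, x :: bitvec). y \<in> carrier_vec r \<and> u \<in> S y \<and> x = 0\<^sub>v n}"
proof (intro equalityI subsetI)
  fix p assume "p \<in> gen_label ` carrier_vec n"
  then show "p \<in> {(y, u, x). y \<in> carrier_vec r \<and> u \<in> S y \<and> x = 0\<^sub>v n}"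
    using parts by (auto simp: coset_S_def image_vec_def)
next
  fix p :: "bitvec \<times> bitvec \<times> bitvec"
  assume "p \<in> {(y, u, x). y \<in> carrier_vec r \<and> u \<in> S y \<and> x = 0\<^sub>v n}"
  then obtain y z where p: "y \<in> carrier_vec r" "z \<in> carrier_vec l" "p = (y, A y *\<^sub>v z + b y, 0\<^sub>v n)"
    by (auto simp: coset_S_def)
  define x where "x = inv_into UNIV \<pi> (y @\<^sub>v z)"
  have \<pi>x: "\<pi> x = y @\<^sub>v z"
    using permutes_inverses(1)[OF \<pi>_permutes] by (simp add: x_def)
  have "y @\<^sub>v z \<in> carrier_vec n"
    using p(1,2) n_eq by (metis append_carrier_vec)
  then have x: "x \<in> carrier_vec n"
    using permutes_in_image[OF \<pi>_permutes, of x] \<pi>x by simp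
  have "first_part x @\<^sub>v last_part x = y @\<^sub>v z"
    using parts(3)[OF x] \<pi>x by simp
  then have "first_part x = y" "last_part x = z"
    using append_vec_eq[of "first_part x" r y] parts[OF x] p(1) by auto
  then have "p = gen_label x" by (simp add: p(3) image_vec_def)
  then show "p \<in> gen_label ` carrier_vec n" using x by blast
qed

lemma gen_ket_amplitude:
  "gen_ket (y, u, x) = (if y \<in> carrier_vec r \<and> u \<in> S y \<and> x = 0\<^sub>v n then 1 / sqrt (2 ^ n) else 0)"
proof -
  have "gen_ket (y, u, x) = (\<Sum>p\<in>gen_label ` carrier_vec n.
      complex_of_real (1 / sqrt (2 ^ n)) * (if (y, u, x) = p then 1 else 0))"
    unfolding gen_ket_eq sum.reindex[OF gen_label_inj] qbind_supp qsupp_uniform_ket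
    by (intro sum.cong refl) (simp only: comp_def, simp add: uniform_ket_def qreturn_def)
  also have "\<dots> = (if (y, u, x) \<in> gen_label ` carrier_vec n then 1 / sqrt (2 ^ n) else 0)"
    by (subst sum_distrib_left[symmetric], subst sum.delta') auto
  finally show ?thesis unfolding gen_label_image by simp
qed

lemma gen_fin: "qfin gen_ket"
  unfolding gen_ket_eq by (intro qfin_bind) (simp_all add: qsupp_uniform_ket)

lemma gen_supp: "(y, u, x) \<in> qsupp gen_ket \<longleftrightarrow> y \<in> carrier_vec r \<and> u \<in> S y \<and> x = 0\<^sub>v n"
  by (simp add: qsupp_def gen_ket_amplitude)

lemma gen_norm: "qnorm2 gen_ket = 1"
  unfolding gen_ket_eq
  by (subst qnorm2_bind_return_inj) (simp_all add: qsupp_uniform_ket gen_label_inj qnorm2_uniform_ket)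

lemma card_S: "card (S y) = 2 ^ l" if y: "y \<in> carrier_vec r"
proof -
  have "inj_on (\<lambda>z. A y *\<^sub>v z + b y) (carrier_vec l)"
    using A_inj[OF y] by (auto intro: inj_onI)
  then show ?thesis
    by (simp add: coset_S_def card_image card_carrier_vec)
qed

text \<open>Every coset has \<open>2 ^ l\<close> points of weight \<open>1 / 2 ^ n\<close> each and
  \<open>n = r + l\<close>, so the measured \<open>y\<close> is uniform and an error over
  \<open>y\<close> becomes a plain average.\<close>

lemma gen_prob: "qprob gen_ket {(y, u, x). y \<in> Y} = (\<Sum>y\<in>carrier_vec r. of_bool (y \<in> Y) / 2 ^ r)"
proof -
  let ?X = "SIGMA y : carrier_vec r \<inter> Y. S y \<times> {0\<^sub>v n :: bitvec}"
  have fin: "finite (S y)" for y by (simp add: coset_S_def)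
  have "qprob gen_ket {(y, u, x). y \<in> Y} = (\<Sum>p\<in>?X. (cmod (gen_ket p))\<^sup>2)"
    using fin by (intro qprob_superset) (auto simp: gen_supp)
  also have "\<dots> = (\<Sum>p\<in>?X. 1 / 2 ^ n)"
    by (intro sum.cong refl)
      (auto simp: gen_ket_amplitude norm_divide power_divide simp flip: of_real_power)
  also have "\<dots> = (\<Sum>y\<in>carrier_vec r \<inter> Y. real (card (S y)) / 2 ^ n)"
  proof -
    have "card ?X = (\<Sum>y\<in>carrier_vec r \<inter> Y. card (S y))"
      using fin by (subst card_SigmaI) (auto simp: card_cartesian_product)
    then show ?thesis by (simp add: sum_divide_distrib)
  qed
  also have "\<dots> = (\<Sum>y\<in>carrier_vec r \<inter> Y. 1 / 2 ^ r)"
  proof (intro sum.cong refl)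
    fix y assume "y \<in> carrier_vec r \<inter> Y"
    then have "real (card (S y)) = 2 ^ l" by (simp add: card_S)
    moreover have "(2 :: real) ^ n = 2 ^ r * 2 ^ l"
      using n_eq by (metis power_add)
    ultimately show "real (card (S y)) / 2 ^ n = 1 / 2 ^ r" by simp
  qed
  also have "\<dots> = (\<Sum>y\<in>carrier_vec r. of_bool (y \<in> Y) / 2 ^ r)"
    unfolding sum.inter_restrict[OF finite_carrier_vec] by (intro sum.cong refl) simp
  finally show ?thesis .
qed

abbreviation observed_ket where "observed_ket \<equiv> obar_observed_ket \<eta> \<omega>"
abbreviation dual_sign where "dual_sign \<equiv> obar_dual_sign \<eta> \<omega>"

lemmas observed_ket_def = obar_observed_ket_def[of \<eta> "(\<pi>, A, b)"]
lemmas dual_sign_def = obar_dual_sign_def[of \<eta> "(\<pi>, A, b)"]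

context
  fixes z :: "bitvec \<Rightarrow> bitvec \<Rightarrow> complex"
  assumes z: "z y v * cnj (z y v) = 1"
begin

lemma observed_step:
  assumes "(y, u, x) \<in> qsupp gen_ket"
  shows "qfin (correct_ket c (z y) u)" "qsupp (correct_ket c (z y) u) \<subseteq> carrier_vec n"
  using correct_ket(1,2)[of n "z y" u c] z assms S_carrier by (auto simp: gen_supp)

lemma observed_step_inner:
  fixes c :: bool
  assumes a: "a \<in> qsupp gen_ket" and a': "a' \<in> qsupp gen_ket"
  defines "V \<equiv> \<lambda>(y, u, x). qbind (correct_ket c (z y) u) (\<lambda>u'. qreturn (y, u', x, u $ 0 = 1))"
  shows "qinner (V a) (V a') = (if a = a' then 1 else 0)"
proof -
  obtain y u x y' u' x' where aa: "a = (y, u, x)" "a' = (y', u', x')" by (cases a; cases a')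
  note s = observed_step[OF a[unfolded aa]] observed_step[OF a'[unfolded aa]]
  have "qinner (V a) (V a') = (if y = y' \<and> x = x' \<and> (u $ 0 = 1) = (u' $ 0 = 1) then 1 else 0)
      * qinner (correct_ket c (z y) u) (correct_ket c (z y') u')"
    unfolding V_def aa prod.case by (rule qinner_bind) (use s in auto)
  also have "\<dots> = (if a = a' then 1 else 0)"
  proof (cases "y = y' \<and> x = x' \<and> (u $ 0 = 1) = (u' $ 0 = 1)")
    case True
    moreover have "u \<in> carrier_vec n" "u' \<in> carrier_vec n"
      using a a' S_carrier by (auto simp: aa gen_supp)
    ultimately have "qinner (correct_ket c (z y) u) (correct_ket c (z y') u') = (if u = u' then 1 else 0)"
      using correct_ket(3)[of n "z y" u u' c] z by simp
    then show ?thesis using True by (simp add: aa)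
  qed (auto simp: aa)
  finally show ?thesis .
qed

lemma observed_fin: "qfin (observed_ket c z)"
  unfolding observed_ket_def using observed_step
  by (intro qfin_bind gen_fin) (auto intro!: qfin_bind)

lemma observed_supp:
  assumes "(y, u', x, b') \<in> qsupp (observed_ket c z)"
  shows "y \<in> carrier_vec r" "u' \<in> carrier_vec n"
proof -
  obtain u where a: "(y, u, x) \<in> qsupp gen_ket" and u': "u' \<in> qsupp (correct_ket c (z y) u)"
    using subsetD[OF qsupp_bind assms[unfolded observed_ket_def]]
    by (auto dest!: subsetD[OF qsupp_bind])
  show "y \<in> carrier_vec r" using a by (simp add: gen_supp)
  show "u' \<in> carrier_vec n" using observed_step(2)[OF a] u' by auto
qed

lemma observed_norm: "qnorm2 (observed_ket c z) = 1"
  unfolding observed_ket_def using gen_fin observed_step observed_step_inner gen_norm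
  by (subst qnorm2_bind) (auto intro!: qfin_bind)

lemma observed_prob:
  "qprob (observed_ket c z) {(y, u, x, b'). y \<in> Y} = (\<Sum>y\<in>carrier_vec r. of_bool (y \<in> Y) / 2 ^ r)"
proof -
  have "qprob (observed_ket c z) {(y, u, x, b'). y \<in> Y} = qprob gen_ket {(y, u, x). y \<in> Y}"
    unfolding observed_ket_def
    using gen_fin observed_step observed_step_inner
    by (intro qprob_bind_preserved) (auto intro!: qfin_bind dest!: subsetD[OF qsupp_bind])
  then show ?thesis by (simp add: gen_prob)
qed

lemma observed_bind:
  "qbind (observed_ket c z) K = do {
     (y, u, x) \<leftarrow> gen_ket;
     u' \<leftarrow> correct_ket c (z y) u;
     K (y, u', x, u $ 0 = 1)
   }"
proof -
  have "qbind (observed_ket c z) K = qbind gen_ket (\<lambda>a. qbind (case a of (y, u, x) \<Rightarrow>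
      qbind (correct_ket c (z y) u) (\<lambda>u'. qreturn (y, u', x, u $ 0 = 1))) K)"
    unfolding observed_ket_def using observed_step
    by (intro qbind_assoc gen_fin) (auto intro!: qfin_bind)
  also have "\<dots> = qbind gen_ket (\<lambda>(y, u, x). qbind (correct_ket c (z y) u) (\<lambda>u'. K (y, u', x, u $ 0 = 1)))"
  proof (rule qbind_cong)
    fix a assume "a \<in> qsupp gen_ket"
    then show "qbind (case a of (y, u, x) \<Rightarrow>
        qbind (correct_ket c (z y) u) (\<lambda>u'. qreturn (y, u', x, u $ 0 = 1))) K
      = (case a of (y, u, x) \<Rightarrow> qbind (correct_ket c (z y) u) (\<lambda>u'. K (y, u', x, u $ 0 = 1)))"
      using observed_step by (cases a) (auto simp: qbind_assoc)
  qed
  finally show ?thesis .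
qed

end

lemma dual_sign_norm: "dual_sign y v * cnj (dual_sign y v) = 1"
  by (simp add: dual_sign_def)

text \<open>Sum over the inputs \<open>u\<close> whose recorded bit is \<open>b'\<close>: for
  \<open>b' = c\<close> nothing is applied, otherwise \<open>correction_sum\<close> turns one half
  into the other. The right-hand side is the same for both values of \<open>b'\<close>, so the
  record carries no trace of the committed bit; otherwise it would destroy the coherence of the
  qubit.\<close>

lemma observed_amplitude:
  assumes nz: "\<not> zero_row \<eta> \<omega> y"
  shows "observed_ket c dual_sign (y, w, x, b')
    = (if y \<in> carrier_vec r \<and> x = 0\<^sub>v n then 1 / sqrt (2 ^ n) else 0) * of_bool (w \<in> S_bit y c)"
proof (cases "y \<in> carrier_vec r \<and> x = 0\<^sub>v n")
  case False
  have "(y, w, x, b') \<notin> qsupp (observed_ket c dual_sign)"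
  proof
    assume "(y, w, x, b') \<in> qsupp (observed_ket c dual_sign)"
    then obtain u where "(y, u, x) \<in> qsupp gen_ket"
      unfolding observed_ket_def
      by (auto dest!: subsetD[OF qsupp_bind])
    then show False using False by (simp add: gen_supp)
  qed
  then show ?thesis using False by (auto simp: not_in_qsupp)
next
  case True
  then have y: "y \<in> carrier_vec r" and x: "x = 0\<^sub>v n" by auto
  interpret C: bit_coset "A y" "b y" n l by (rule bit_coset[OF y])
  let ?\<kappa> = "1 / complex_of_real (sqrt (2 ^ n))"
  let ?V = "\<lambda>(y, u, x). qbind (correct_ket c (dual_sign y) u) (\<lambda>u'. qreturn (y, u', x, u $ 0 = 1))"
  have amp: "?V a (y, w, x, b') = (if fst a = y \<and> snd (snd a) = x \<and> (fst (snd a) $ 0 = 1) = b'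
      then correct_ket c (dual_sign y) (fst (snd a)) w else 0)" if a: "a \<in> qsupp gen_ket" for a
  proof -
    obtain y' u x' where aa: "a = (y', u, x')" by (cases a)
    let ?\<phi> = "correct_ket c (dual_sign y') u"
    have fin: "qfin ?\<phi>"
      using observed_step(1)[of dual_sign, OF dual_sign_norm] a unfolding aa by blast
    have "?V a (y, w, x, b') = (\<Sum>u'\<in>insert w (qsupp ?\<phi>).
        ?\<phi> u' * qreturn (y', u', x', u $ 0 = 1) (y, w, x, b'))"
      unfolding aa prod.case by (rule qbind_superset) (use fin in auto)
    also have "\<dots> = (\<Sum>u'\<in>insert w (qsupp ?\<phi>).
        if u' = w then ?\<phi> u' * of_bool (y' = y \<and> x' = x \<and> (u $ 0 = 1) = b') else 0)"
      by (intro sum.cong refl) (auto simp: qreturn_def)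
    also have "\<dots> = ?\<phi> w * of_bool (y' = y \<and> x' = x \<and> (u $ 0 = 1) = b')"
      using fin by (subst sum.delta) auto
    finally show ?thesis by (auto simp: aa)
  qed
  have "observed_ket c dual_sign (y, w, x, b')
      = (\<Sum>a\<in>qsupp gen_ket. gen_ket a * (if fst a = y \<and> snd (snd a) = x \<and> (fst (snd a) $ 0 = 1) = b'
        then correct_ket c (dual_sign y) (fst (snd a)) w else 0))"
    unfolding observed_ket_def qbind_supp[of gen_ket] using amp by (intro sum.cong refl) simp
  \<comment> \<open>Fixing \<open>y\<close>, \<open>x\<close> and the recorded bit leaves exactly
    one half of the coset as inputs, all with the same amplitude.\<close>
  also have "\<dots> = (\<Sum>a\<in>(\<lambda>u. (y, u, x)) ` C.coset_bit b'. ?\<kappa> * correct_ket c (dual_sign y) (fst (snd a)) w)"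
  proof (rule sum.mono_neutral_cong_right[OF gen_fin])
    show "(\<lambda>u. (y, u, x)) ` C.coset_bit b' \<subseteq> qsupp gen_ket"
      using y x S_eq[OF y] by (auto simp: gen_supp C.coset_bit_def)
  next
    show "\<forall>a\<in>qsupp gen_ket - (\<lambda>u. (y, u, x)) ` C.coset_bit b'. gen_ket a *
        (if fst a = y \<and> snd (snd a) = x \<and> (fst (snd a) $ 0 = 1) = b'
         then correct_ket c (dual_sign y) (fst (snd a)) w else 0) = 0"
    proof
      fix a assume a: "a \<in> qsupp gen_ket - (\<lambda>u. (y, u, x)) ` C.coset_bit b'"
      obtain y' u x' where aa: "a = (y', u, x')" by (cases a)
      have "\<not> (y' = y \<and> x' = x \<and> (u $ 0 = 1) = b')"
      proof
        assume e: "y' = y \<and> x' = x \<and> (u $ 0 = 1) = b'"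
        then have "u \<in> C.coset_bit b'"
          using a S_eq[OF y] by (cases "u $ 0") (auto simp: aa gen_supp C.coset_bit_def)
        then show False using a e by (auto simp: aa)
      qed
      then show "gen_ket a * (if fst a = y \<and> snd (snd a) = x \<and> (fst (snd a) $ 0 = 1) = b'
         then correct_ket c (dual_sign y) (fst (snd a)) w else 0) = 0"
        by (auto simp: aa)
    qed
  next
    fix a assume "a \<in> (\<lambda>u. (y, u, x)) ` C.coset_bit b'"
    then obtain u where u: "a = (y, u, x)" "u \<in> C.coset_bit b'" by auto
    then have "(u $ 0 = 1) = b'" "u \<in> S y"
      using S_eq[OF y] by (auto simp: C.coset_bit_def)
    then show "gen_ket a * (if fst a = y \<and> snd (snd a) = x \<and> (fst (snd a) $ 0 = 1) = b'
         then correct_ket c (dual_sign y) (fst (snd a)) w else 0)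
      = ?\<kappa> * correct_ket c (dual_sign y) (fst (snd a)) w"
      using y x by (simp add: u gen_ket_amplitude)
  qed
  also have "\<dots> = ?\<kappa> * (\<Sum>u\<in>C.coset_bit b'. correct_ket c (dual_sign y) u w)"
    by (subst sum.reindex) (auto simp: inj_on_def sum_distrib_left)
  also have "(\<Sum>u\<in>C.coset_bit b'. correct_ket c (dual_sign y) u w) = of_bool (w \<in> C.coset_bit c)"
  proof (cases "b' = c")
    case True
    have "(\<Sum>u\<in>C.coset_bit b'. correct_ket c (dual_sign y) u w)
        = (\<Sum>u\<in>C.coset_bit b'. if w = u then 1 else 0)"
      using True by (intro sum.cong refl) (auto simp: correct_ket_def qreturn_def C.coset_bit_def)
    then show ?thesis using True by simp
  next
    case False
    then have b': "b' = (\<not> c)" by auto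
    have "(\<Sum>u\<in>C.coset_bit b'. correct_ket c (dual_sign y) u w)
        = (\<Sum>u\<in>C.coset_bit (\<not> c). qbind (hadamard_vec u)
            (\<lambda>v. qbind (qphase (dual_sign y v) v) hadamard_vec) w)"
      unfolding b' by (intro sum.cong refl) (auto simp: correct_ket_def C.coset_bit_def)
    also have "\<dots> = of_bool (w \<in> C.coset_bit c)"
      using nz zero_row_eq by (intro C.correction_sum) (auto simp: dual_sign_def D_eq[OF y])
    finally show ?thesis .
  qed
  finally show ?thesis
    using True by (simp add: S_bit_eq[OF y])
qed

end

text \<open>If every choice survives in an injective label, branches cannot interfere: amplitudes
  multiply, and probabilities average over the first stage.\<close>

lemma
  assumes "qfin \<psi>" and "\<And>a. a \<in> qsupp \<psi> \<Longrightarrow> qfin (V a)" and f: "inj f"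
  shows bind_label_amplitude:
      "qbind \<psi> (\<lambda>a. qbind (V a) (\<lambda>q. qreturn (f (a, q)))) (f (a, q)) = \<psi> a * V a q"
    and bind_label_amplitude_0:
      "p \<notin> range f \<Longrightarrow> qbind \<psi> (\<lambda>a. qbind (V a) (\<lambda>q. qreturn (f (a, q)))) p = 0"
    and qprob_bind_label:
      "qprob (qbind \<psi> (\<lambda>a. qbind (V a) (\<lambda>q. qreturn (f (a, q))))) E
        = (\<Sum>a\<in>qsupp \<psi>. (cmod (\<psi> a))\<^sup>2 * qprob (V a) {q. f (a, q) \<in> E})"
proof -
  let ?\<Psi> = "qbind \<psi> (\<lambda>a. qbind (V a) (\<lambda>q. qreturn (f (a, q))))"
  have inner: "qbind (V a') (\<lambda>q. qreturn (f (a', q))) (f (a, q)) = (if a' = a then V a q else 0)"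
    if a': "a' \<in> qsupp \<psi>" for a' a q
  proof -
    have "qbind (V a') (\<lambda>q. qreturn (f (a', q))) (f (a, q))
        = (\<Sum>q'\<in>insert q (qsupp (V a')). V a' q' * qreturn (f (a', q')) (f (a, q)))"
      using assms(2)[OF a'] by (intro qbind_superset) auto
    also have "\<dots> = (\<Sum>q'\<in>insert q (qsupp (V a')). if q' = q then V a' q' * of_bool (a' = a) else 0)"
      using f by (intro sum.cong refl) (auto simp: qreturn_def inj_eq)
    also have "\<dots> = (if a' = a then V a q else 0)"
      using assms(2)[OF a'] by (subst sum.delta) auto
    finally show ?thesis .
  qed
  have amp: "?\<Psi> (f (a, q)) = \<psi> a * V a q" for a q
  proof -
    have "?\<Psi> (f (a, q)) = (\<Sum>a'\<in>insert a (qsupp \<psi>). if a' = a then \<psi> a' * V a q else 0)"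
      unfolding qbind_supp[of \<psi>] using assms(1)
      by (intro sum.mono_neutral_cong_left) (auto simp: inner not_in_qsupp)
    also have "\<dots> = \<psi> a * V a q"
      using assms(1) by (subst sum.delta) auto
    finally show ?thesis .
  qed
  then show "?\<Psi> (f (a, q)) = \<psi> a * V a q" .
  have supp: "qsupp ?\<Psi> \<subseteq> f ` (SIGMA a : qsupp \<psi>. qsupp (V a))"
  proof
    fix p assume "p \<in> qsupp ?\<Psi>"
    from subsetD[OF qsupp_bind this] obtain a where a: "a \<in> qsupp \<psi>"
      "p \<in> qsupp (qbind (V a) (\<lambda>q. qreturn (f (a, q))))" by auto
    from subsetD[OF qsupp_bind a(2)] show "p \<in> f ` (SIGMA a : qsupp \<psi>. qsupp (V a))"
      using a(1) by auto
  qed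
  show "?\<Psi> p = 0" if "p \<notin> range f"
    using supp that by (auto simp: qsupp_def)
  have fin: "finite (SIGMA a : qsupp \<psi>. qsupp (V a) \<inter> {q. f (a, q) \<in> E})"
    using assms(1,2) by (intro finite_SigmaI) auto
  have "qprob ?\<Psi> E = (\<Sum>p\<in>f ` (SIGMA a : qsupp \<psi>. qsupp (V a) \<inter> {q. f (a, q) \<in> E}). (cmod (?\<Psi> p))\<^sup>2)"
    using supp fin by (intro qprob_superset) auto
  also have "\<dots> = (\<Sum>(a, q)\<in>(SIGMA a : qsupp \<psi>. qsupp (V a) \<inter> {q. f (a, q) \<in> E}).
      (cmod (\<psi> a * V a q))\<^sup>2)"
    using f by (subst sum.reindex) (auto simp: amp intro: inj_on_subset intro!: sum.cong)
  also have "\<dots> = (\<Sum>a\<in>qsupp \<psi>. \<Sum>q\<in>qsupp (V a) \<inter> {q. f (a, q) \<in> E}. (cmod (\<psi> a * V a q))\<^sup>2)"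
    using assms(1,2) by (subst sum.Sigma) auto
  also have "\<dots> = (\<Sum>a\<in>qsupp \<psi>. (cmod (\<psi> a))\<^sup>2 * qprob (V a) {q. f (a, q) \<in> E})"
    by (simp add: qprob_def norm_mult power_mult_distrib sum_distrib_left)
  finally show "qprob ?\<Psi> E
      = (\<Sum>a\<in>qsupp \<psi>. (cmod (\<psi> a))\<^sup>2 * qprob (V a) {q. f (a, q) \<in> E})" .
qed

section \<open>Undoing the signature of 0 and signing 1\<close>

context oss_run
begin

lemma signed_bind:
  "qbind (signed_ket m) K = qbind (oss_gen_ket S \<eta> O') (\<lambda>(vk, sk, g).
     qbind (oss_sign_ket S \<eta> O' m (oss_sign_init S \<eta> m sk)) (\<lambda>w. K (vk, g, w)))"
proof -
  have "qbind (signed_ket m) K = qbind (oss_gen_ket S \<eta> O') (\<lambda>a. qbind (case a of (vk, sk, g) \<Rightarrow>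
     qbind (oss_sign_ket S \<eta> O' m (oss_sign_init S \<eta> m sk)) (\<lambda>w. qreturn (vk, g, w))) K)"
    unfolding signed_ket_def using sign_ket_init
    by (intro qbind_assoc gen_fin) (auto intro!: qfin_bind)
  also have "\<dots> = qbind (oss_gen_ket S \<eta> O') (\<lambda>(vk, sk, g).
     qbind (oss_sign_ket S \<eta> O' m (oss_sign_init S \<eta> m sk)) (\<lambda>w. K (vk, g, w)))"
  proof (rule qbind_cong)
    fix a assume "a \<in> qsupp (oss_gen_ket S \<eta> O')"
    then show "qbind (case a of (vk, sk, g) \<Rightarrow>
       qbind (oss_sign_ket S \<eta> O' m (oss_sign_init S \<eta> m sk)) (\<lambda>w. qreturn (vk, g, w))) K
     = (case a of (vk, sk, g) \<Rightarrow>
       qbind (oss_sign_ket S \<eta> O' m (oss_sign_init S \<eta> m sk)) (\<lambda>w. K (vk, g, w)))"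
      using sign_ket_init(1) by (cases a) (auto simp: qbind_assoc)
  qed
  finally show ?thesis .
qed

definition unsign_ket :: "bool list \<Rightarrow> bool list ket" where
  "unsign_ket w = qadjoint (oss_sign_ket S \<eta> O' False) w"

definition sign1_ket :: "bool list \<Rightarrow> bool list ket" where
  "sign1_ket w = oss_sign_ket S \<eta> O' True (oss_sign_init S \<eta> True (take (oss_sk_len S \<eta>) w))"

definition resign_ket :: "bool list \<Rightarrow> (bool list \<times> bool list) ket" where
  "resign_ket w0 = do {
     w \<leftarrow> unsign_ket w0;
     w1 \<leftarrow> sign1_ket w;
     qreturn (drop (oss_sk_len S \<eta>) w, w1)
   }"

lemma unsign_unitary: "qunitary (sign_labels False) unsign_ket"
  unfolding unsign_ket_def[abs_def] by (rule qunitary_adjoint[OF sign_unitary])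

lemma take_sk_length: "w \<in> sign_labels False \<Longrightarrow> length (take (oss_sk_len S \<eta>) w) = oss_sk_len S \<eta>"
  using sign_wires[of False] by simp

lemma sign1_ket:
  assumes "w \<in> sign_labels False"
  shows "qfin (sign1_ket w)" "qsupp (sign1_ket w) \<subseteq> sign_labels True"
  unfolding sign1_ket_def
  using qunitaryD(2,3)[OF sign_unitary sign_init_label[OF take_sk_length[OF assms]]] by auto

lemma sign1_ket_inner:
  assumes "w \<in> sign_labels False" "w' \<in> sign_labels False"
  shows "qinner (sign1_ket w) (sign1_ket w')
    = (if take (oss_sk_len S \<eta>) w = take (oss_sk_len S \<eta>) w' then 1 else 0)"
  unfolding sign1_ket_def
  by (subst qunitaryD(4)[OF sign_unitary sign_init_label sign_init_label])
    (use assms take_sk_length in \<open>simp_all add: sign_init_inj del: length_take\<close>)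

lemma resign_fin: "w0 \<in> sign_labels False \<Longrightarrow> qfin (resign_ket w0)"
  unfolding resign_ket_def using qunitaryD(2,3)[OF unsign_unitary] sign1_ket
  by (intro qfin_bind) auto

text \<open>Signing 1 reads only the key wires of the unsigned string, and the other wires are kept
  as a label. Together they determine the string, so the composition stays isometric although its
  first output is overwritten.\<close>

lemma resign_inner:
  assumes w: "w0 \<in> sign_labels False" "w0' \<in> sign_labels False"
  shows "qinner (resign_ket w0) (resign_ket w0') = (if w0 = w0' then 1 else 0)"
proof -
  let ?V = "\<lambda>w. qbind (sign1_ket w) (\<lambda>w1. qreturn (drop (oss_sk_len S \<eta>) w, w1))"
  have V: "qinner (?V w) (?V w') = (if w = w' then 1 else 0)"
    if "w \<in> sign_labels False" "w' \<in> sign_labels False" for w w'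
  proof -
    have "qinner (?V w) (?V w') = (if drop (oss_sk_len S \<eta>) w = drop (oss_sk_len S \<eta>) w' then 1 else 0)
        * qinner (sign1_ket w) (sign1_ket w')"
      by (rule qinner_bind) (use that sign1_ket in auto)
    also have "\<dots> = (if w = w' then 1 else 0)"
      unfolding sign1_ket_inner[OF that]
      by (auto, metis append_take_drop_id)
    finally show ?thesis .
  qed
  note U = qunitaryD(2,3)[OF unsign_unitary]
  have "qinner (resign_ket w0) (resign_ket w0') = 1 * qinner (unsign_ket w0) (unsign_ket w0')"
    unfolding resign_ket_def
  proof (rule qinner_bind)
    show "qinner (?V a) (?V b) = (if a = b then 1 else 0)"
      if "a \<in> qsupp (unsign_ket w0)" "b \<in> qsupp (unsign_ket w0')" for a b
      using that U(1)[OF w(1)] U(1)[OF w(2)] by (intro V) auto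
    show "qfin (?V a)" if "a \<in> qsupp (unsign_ket w0)" for a
      using that U(1)[OF w(1)] sign1_ket(1)[of a] by (intro qfin_bind) auto
    show "qfin (?V a)" if "a \<in> qsupp (unsign_ket w0')" for a
      using that U(1)[OF w(2)] sign1_ket(1)[of a] by (intro qfin_bind) auto
  qed (use U w in auto)
  then show ?thesis
    using qunitaryD(4)[OF unsign_unitary w] by simp
qed

lemma resign_bind:
  assumes w: "w0 \<in> sign_labels False"
  shows "qbind (resign_ket w0) K = do {
     w \<leftarrow> unsign_ket w0;
     w1 \<leftarrow> sign1_ket w;
     K (drop (oss_sk_len S \<eta>) w, w1)
   }"
proof -
  note U = qunitaryD(2,3)[OF unsign_unitary w]
  have s: "qfin (sign1_ket w)" if "w \<in> qsupp (unsign_ket w0)" for w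
    using that U(1) sign1_ket(1)[of w] by auto
  have "qbind (resign_ket w0) K = qbind (unsign_ket w0) (\<lambda>w.
      qbind (qbind (sign1_ket w) (\<lambda>w1. qreturn (drop (oss_sk_len S \<eta>) w, w1))) K)"
    unfolding resign_ket_def using U s by (intro qbind_assoc) (auto intro!: qfin_bind)
  also have "\<dots> = qbind (unsign_ket w0) (\<lambda>w. qbind (sign1_ket w) (\<lambda>w1. K (drop (oss_sk_len S \<eta>) w, w1)))"
    using s by (intro qbind_cong) (simp add: qbind_assoc)
  finally show ?thesis .
qed

definition unsigned_rest :: "bool list" where
  "unsigned_rest = replicate (qc_wires (oss_sign S \<eta> False) - oss_sk_len S \<eta>) False"

text \<open>Unsigning returns the initial string exactly, which is the key followed by zero
  ancillas. The continuation \<open>K\<close> must not depend on \<open>w0\<close>; this is why the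
  phase may not look at the signature.\<close>

lemma sign_resign:
  assumes sk: "length sk = oss_sk_len S \<eta>"
  shows "qbind (oss_sign_ket S \<eta> O' False (oss_sign_init S \<eta> False sk)) (\<lambda>w0. qbind (resign_ket w0) K)
    = qbind (oss_sign_ket S \<eta> O' True (oss_sign_init S \<eta> True sk)) (\<lambda>w1. K (unsigned_rest, w1))"
proof -
  let ?w = "oss_sign_init S \<eta> False sk"
  let ?\<psi> = "oss_sign_ket S \<eta> O' False ?w"
  let ?C = "\<lambda>w. qbind (sign1_ket w) (\<lambda>w1. K (drop (oss_sk_len S \<eta>) w, w1))"
  note w = sign_init_label[OF sk, of False]
  note U = qunitaryD(2,3)[OF sign_unitary w]
  have "qbind ?\<psi> (\<lambda>w0. qbind (resign_ket w0) K) = qbind ?\<psi> (\<lambda>w0. qbind (unsign_ket w0) ?C)"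
    using U by (intro qbind_cong resign_bind) auto
  also have "\<dots> = qbind (qbind ?\<psi> unsign_ket) ?C"
    using U qunitaryD(3)[OF unsign_unitary] by (intro qbind_assoc[symmetric]) auto
  also have "qbind ?\<psi> unsign_ket = qreturn ?w"
    using qunitary_bind_adjoint[OF sign_unitary w] by (simp add: unsign_ket_def[abs_def])
  also have "qbind (qreturn ?w) ?C = ?C ?w" by simp
  also have "\<dots> = qbind (oss_sign_ket S \<eta> O' True (oss_sign_init S \<eta> True sk)) (\<lambda>w1. K (unsigned_rest, w1))"
    using sk by (simp add: sign1_ket_def oss_sign_init_def unsigned_rest_def)
  finally show ?thesis .
qed

end

section \<open>The commitment\<close>

text \<open>All keys are fixed here: \<omega> stands for the pseudorandom function under one key,
  and its values are only assumed to lie in the coin space. The randomness of the keys enters when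
  the bounds are averaged.\<close>

locale pfc_run = oss_run +
  fixes \<omega> :: "bool list \<Rightarrow> obar_coins"
  assumes coins: "length vk = oss_vk_len S \<eta> \<Longrightarrow> \<omega> vk \<in> obar_coin_space \<eta>"
    and \<eta>_pos: "0 < \<eta>"
begin

definition ck :: commitment_key where
  "ck = \<lparr> ck_O = O',
     ck_P = (\<lambda>vk x. obar_P (obar_setup \<eta> (\<omega> vk)) x),
     ck_Pinv = (\<lambda>vk y u. obar_Pinv (obar_setup \<eta> (\<omega> vk)) y u),
     ck_D = (\<lambda>vk \<sigma> y u. if oss_accepts S \<eta> O' vk False \<sigma>
       then Some (\<not> obar_D (obar_setup \<eta> (\<omega> vk)) y u) else None) \<rparr>"

lemma ck_O: "ck_O ck = O'"
  by (simp add: ck_def)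

abbreviation n where "n \<equiv> par_n \<eta>"
abbreviation r where "r \<equiv> par_r \<eta>"
abbreviation sig_len where "sig_len \<equiv> oss_sig_len S \<eta>"
abbreviation vk_len where "vk_len \<equiv> oss_vk_len S \<eta>"

abbreviation observed_ket where "observed_ket vk \<equiv> obar_observed_ket \<eta> (\<omega> vk)"

text \<open>Shares its type with \<open>real_phase\<close>, so that \<open>com_step\<close> and the
  proof that it is isometric cover both phases.\<close>

definition ideal_phase :: "bool list \<Rightarrow> bool list \<Rightarrow> bitvec \<Rightarrow> bitvec \<Rightarrow> complex" where
  "ideal_phase vk w0 = obar_dual_sign \<eta> (\<omega> vk)"

definition real_phase :: "bool list \<Rightarrow> bool list \<Rightarrow> bitvec \<Rightarrow> bitvec \<Rightarrow> complex" where
  "real_phase vk w0 y v = phase_sign (ck_D ck vk (take sig_len w0) y v)"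

text \<open>The phases can differ only where the signature of 0 is rejected. There \<bottom> is read
  as 1, which still has modulus 1, so the actual commitment is isometric on every branch.\<close>

lemma real_phase_eq:
  "real_phase vk w0 = (if oss_accepts S \<eta> O' vk False (take sig_len w0)
     then ideal_phase vk w0 else (\<lambda>y v. 1))"
  by (auto simp: fun_eq_iff real_phase_def ideal_phase_def obar_dual_sign_def ck_def phase_sign_def)

lemma phase_norm:
  "ideal_phase vk w0 y v * cnj (ideal_phase vk w0 y v) = 1"
  "real_phase vk w0 y v * cnj (real_phase vk w0 y v) = 1"
  by (simp_all add: real_phase_eq ideal_phase_def obar_dual_sign_def)

lemma obar_run_of_vk:
  assumes "length vk = vk_len"
  obtains \<pi> A b where "\<omega> vk = (\<pi>, A, b)" "obar_run \<eta> \<pi> A b"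
proof -
  obtain \<pi> A b where "\<omega> vk = (\<pi>, A, b)" by (cases "\<omega> vk")
  then show thesis
    using that coins[OF assms] \<eta>_pos by (auto simp: obar_run_def)
qed

lemma
  assumes vk: "length vk = vk_len" and z: "\<And>y v. z y v * cnj (z y v) = 1"
  shows observed_fin: "qfin (observed_ket vk c z)"
    and observed_norm: "qnorm2 (observed_ket vk c z) = 1"
    and observed_supp: "(y, u, x, b') \<in> qsupp (observed_ket vk c z) \<Longrightarrow>
      y \<in> carrier_vec r \<and> u \<in> carrier_vec n"
    and observed_prob: "qprob (observed_ket vk c z) {(y, u, x, b'). y \<in> Y}
      = (\<Sum>y\<in>carrier_vec r. of_bool (y \<in> Y) / 2 ^ r)"
    and observed_bind: "qbind (observed_ket vk c z) K = do {
      (y, u, x) \<leftarrow> obar_gen_ket \<eta> (ck_P ck vk) (ck_Pinv ck vk);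
      u' \<leftarrow> correct_ket c (z y) u;
      K (y, u', x, u $ 0 = 1) }"
proof -
  obtain \<pi> A b where w: "\<omega> vk = (\<pi>, A, b)" and run: "obar_run \<eta> \<pi> A b"
    using obar_run_of_vk[OF vk] by blast
  show "qfin (observed_ket vk c z)"
    using obar_run.observed_fin[OF run z] by (simp add: w)
  show "qnorm2 (observed_ket vk c z) = 1"
    using obar_run.observed_norm[OF run z] by (simp add: w)
  show "y \<in> carrier_vec r \<and> u \<in> carrier_vec n" if "(y, u, x, b') \<in> qsupp (observed_ket vk c z)"
    using obar_run.observed_supp[where z = z, OF run z] that unfolding w by blast
  show "qprob (observed_ket vk c z) {(y, u, x, b'). y \<in> Y}
      = (\<Sum>y\<in>carrier_vec r. of_bool (y \<in> Y) / 2 ^ r)"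
    using obar_run.observed_prob[OF run z] by (simp add: w)
  show "qbind (observed_ket vk c z) K = do {
      (y, u, x) \<leftarrow> obar_gen_ket \<eta> (ck_P ck vk) (ck_Pinv ck vk);
      u' \<leftarrow> correct_ket c (z y) u;
      K (y, u', x, u $ 0 = 1) }"
    using obar_run.observed_bind[OF run z] by (simp add: w ck_def)
qed

lemma observed_amplitude:
  assumes vk: "length vk = vk_len" and nz: "\<not> zero_row \<eta> (\<omega> vk) y"
  shows "observed_ket vk c (ideal_phase vk w0) (y, u, x, b')
    = (if y \<in> carrier_vec r \<and> x = 0\<^sub>v n then 1 / sqrt (2 ^ n) else 0)
      * of_bool (u \<in> coset_S_bit \<eta> (\<omega> vk) y c)"
proof -
  obtain \<pi> A b where w: "\<omega> vk = (\<pi>, A, b)" and run: "obar_run \<eta> \<pi> A b"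
    using obar_run_of_vk[OF vk] by blast
  show ?thesis
    using obar_run.observed_amplitude[OF run] nz by (simp add: w ideal_phase_def)
qed

type_synonym com_label = "commitment \<times> bitvec \<times> garbage"

definition com_label :: "((bool list \<times> bool list) \<times> bool list \<times> bool list)
    \<times> (bitvec \<times> bitvec \<times> bitvec \<times> bool) \<Rightarrow> com_label" where
  "com_label = (\<lambda>(((vk, g), wr, w1), (y, u, x, b')).
     ((vk, take sig_len w1, y), u, (g, x, b', wr, drop sig_len w1)))"

lemma com_label_inj: "inj com_label"
proof (rule injI)
  fix p q assume eq: "com_label p = com_label q"
  obtain vk g wr w1 y u x b' where p: "p = (((vk, g), wr, w1), (y, u, x, b'))"
    by (metis prod.exhaust)
  obtain vk' g' wr' w1' y' u' x' b'' where q: "q = (((vk', g'), wr', w1'), (y', u', x', b''))"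
    by (metis prod.exhaust)
  have "take sig_len w1 = take sig_len w1'" "drop sig_len w1 = drop sig_len w1'"
    using eq by (simp_all add: p q com_label_def)
  then have "w1 = w1'"
    by (metis append_take_drop_id)
  then show "p = q" using eq by (simp add: p q com_label_def)
qed

definition com_step :: "(bool list \<Rightarrow> bool list \<Rightarrow> bitvec \<Rightarrow> bitvec \<Rightarrow> complex) \<Rightarrow> bool \<Rightarrow>
    bool list \<times> bool list \<times> bool list \<Rightarrow> com_label ket" where
  "com_step \<zeta> c = (\<lambda>(vk, g, w0). do {
     q \<leftarrow> observed_ket vk c (\<zeta> vk w0);
     p \<leftarrow> resign_ket w0;
     qreturn (com_label (((vk, g), p), q))
   })"

definition ideal_ket :: "bool \<Rightarrow> com_label ket" where
  "ideal_ket c = do {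
     (vk, g, w1) \<leftarrow> signed_ket True;
     q \<leftarrow> observed_ket vk c (ideal_phase vk []);
     qreturn (com_label (((vk, g), unsigned_rest, w1), q))
   }"

context
  fixes \<zeta> :: "bool list \<Rightarrow> bool list \<Rightarrow> bitvec \<Rightarrow> bitvec \<Rightarrow> complex"
  assumes \<zeta>: "\<And>vk w0 y v. \<zeta> vk w0 y v * cnj (\<zeta> vk w0 y v) = 1"
begin

lemma com_step_fin: "a \<in> qsupp (signed_ket False) \<Longrightarrow> qfin (com_step \<zeta> c a)"
  using signed_supp[of _ _ _ False] resign_fin observed_fin[of _ "\<zeta> _ _"] \<zeta>
  by (cases a) (auto simp: com_step_def intro!: qfin_bind)

text \<open>Different \<open>w0\<close> may come with different phases, and the resulting coset
  states may overlap. Orthogonality comes from \<open>resign_ket\<close>, which keeps distinct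
  \<open>w0\<close> apart; the overlap is multiplied by 0.\<close>

lemma com_step_inner:
  assumes a: "a \<in> qsupp (signed_ket False)" "a' \<in> qsupp (signed_ket False)"
  shows "qinner (com_step \<zeta> c a) (com_step \<zeta> c a') = (if a = a' then 1 else 0)"
proof -
  obtain vk g w0 vk' g' w0' where aa: "a = (vk, g, w0)" "a' = (vk', g', w0')"
    by (cases a; cases a')
  have vk: "length vk = vk_len" "length vk' = vk_len"
    and w: "w0 \<in> sign_labels False" "w0' \<in> sign_labels False"
    using a signed_supp unfolding aa by blast+
  let ?V = "\<lambda>vk g w0 q. qbind (resign_ket w0) (\<lambda>p. qreturn (com_label (((vk, g), p), q)))"
  have V: "qinner (?V vk g w0 q) (?V vk' g' w0' q') = (if q = q' then of_bool (a = a') else 0)" for q q'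
  proof -
    have "qinner (?V vk g w0 q) (?V vk' g' w0' q')
        = (if vk = vk' \<and> g = g' \<and> q = q' then 1 else 0) * qinner (resign_ket w0) (resign_ket w0')"
      by (rule qinner_bind) (use resign_fin w in \<open>auto simp: inj_eq[OF com_label_inj]\<close>)
    then show ?thesis using resign_inner[OF w] by (simp add: aa)
  qed
  have "qinner (com_step \<zeta> c a) (com_step \<zeta> c a')
      = of_bool (a = a') * qinner (observed_ket vk c (\<zeta> vk w0)) (observed_ket vk' c (\<zeta> vk' w0'))"
    unfolding com_step_def aa prod.case
    by (rule qinner_bind)
      (use observed_fin[OF vk(1) \<zeta>] observed_fin[OF vk(2) \<zeta>] resign_fin w V in \<open>auto intro!: qfin_bind simp: aa\<close>)
  also have "\<dots> = (if a = a' then 1 else 0)"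
    using observed_norm[OF vk(1) \<zeta>] by (auto simp: aa qinner_self)
  finally show ?thesis .
qed

end

lemma com_ket_eq: "com_ket S \<eta> ck c = qbind (signed_ket False) (com_step real_phase c)"
proof -
  define C where "C vk g w0 = (do {
      (y, u, x) \<leftarrow> obar_gen_ket \<eta> (ck_P ck vk) (ck_Pinv ck vk);
      u' \<leftarrow> correct_ket c (real_phase vk w0 y) u;
      w \<leftarrow> unsign_ket w0;
      w1 \<leftarrow> sign1_ket w;
      qreturn (com_label (((vk, g), drop (oss_sk_len S \<eta>) w, w1), (y, u', x, u $ 0 = 1))) })"
    for vk g w0
  have "com_ket S \<eta> ck c = qbind (oss_gen_ket S \<eta> O') (\<lambda>(vk, sk, g).
     qbind (oss_sign_ket S \<eta> O' False (oss_sign_init S \<eta> False sk)) (\<lambda>w0. C vk g w0))"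
    by (simp add: com_ket_def C_def Let_def ck_O correct_ket_def real_phase_def
        unsign_ket_def sign1_ket_def com_label_def cong: if_cong)
  also have "\<dots> = qbind (signed_ket False) (\<lambda>(vk, g, w0). C vk g w0)"
    by (simp add: signed_bind)
  also have "\<dots> = qbind (signed_ket False) (com_step real_phase c)"
  proof (rule qbind_cong)
    fix a assume a: "a \<in> qsupp (signed_ket False)"
    obtain vk g w0 where aa: "a = (vk, g, w0)" by (cases a)
    have vk: "length vk = vk_len" and w: "w0 \<in> sign_labels False"
      using a signed_supp unfolding aa by blast+
    show "(case a of (vk, g, w0) \<Rightarrow> C vk g w0) = com_step real_phase c a"
      unfolding aa com_step_def prod.case C_def
      by (subst observed_bind[OF vk phase_norm(2)]) (simp add: resign_bind[OF w])
  qed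
  finally show ?thesis .
qed

text \<open>With the ideal phase the correction does not touch the signature register, so the signing of
  0 is undone exactly.\<close>

lemma ideal_ket_eq: "ideal_ket c = qbind (signed_ket False) (com_step ideal_phase c)"
proof -
  let ?s = "\<lambda>m sk. oss_sign_ket S \<eta> O' m (oss_sign_init S \<eta> m sk)"
  have "qbind (signed_ket False) (com_step ideal_phase c)
      = qbind (oss_gen_ket S \<eta> O') (\<lambda>(vk, sk, g). qbind (?s False sk) (\<lambda>w0.
          qbind (observed_ket vk c (ideal_phase vk [])) (\<lambda>q. qbind (resign_ket w0)
            (\<lambda>p. qreturn (com_label (((vk, g), p), q))))))"
    by (simp add: signed_bind com_step_def ideal_phase_def)
  also have "\<dots> = qbind (oss_gen_ket S \<eta> O') (\<lambda>(vk, sk, g). qbind (?s True sk) (\<lambda>w1.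
      qbind (observed_ket vk c (ideal_phase vk []))
        (\<lambda>q. qreturn (com_label (((vk, g), unsigned_rest, w1), q)))))"
  proof (rule qbind_cong, clarify)
    fix vk sk g assume a: "(vk, sk, g) \<in> qsupp (oss_gen_ket S \<eta> O')"
    then have sk: "length sk = oss_sk_len S \<eta>" using gen_supp by blast
    let ?o = "observed_ket vk c (ideal_phase vk [])"
    have "qbind (?s False sk) (\<lambda>w0. qbind ?o (\<lambda>q. qbind (resign_ket w0)
            (\<lambda>p. qreturn (com_label (((vk, g), p), q)))))
        = qbind ?o (\<lambda>q. qbind (?s False sk) (\<lambda>w0. qbind (resign_ket w0)
            (\<lambda>p. qreturn (com_label (((vk, g), p), q)))))"
      by (rule qbind_commute)
    also have "\<dots> = qbind ?o (\<lambda>q. qbind (?s True sk)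
            (\<lambda>w1. qreturn (com_label (((vk, g), unsigned_rest, w1), q))))"
      by (simp only: sign_resign[OF sk])
    also have "\<dots> = qbind (?s True sk) (\<lambda>w1. qbind ?o
            (\<lambda>q. qreturn (com_label (((vk, g), unsigned_rest, w1), q))))"
      by (rule qbind_commute)
    finally show "qbind (?s False sk) (\<lambda>w0. qbind ?o (\<lambda>q. qbind (resign_ket w0)
            (\<lambda>p. qreturn (com_label (((vk, g), p), q)))))
      = qbind (?s True sk) (\<lambda>w1. qbind ?o
            (\<lambda>q. qreturn (com_label (((vk, g), unsigned_rest, w1), q))))" .
  qed
  also have "\<dots> = ideal_ket c"
    by (simp add: ideal_ket_def signed_bind)
  finally show ?thesis by simp
qed

lemma com_fin: "qfin (com_ket S \<eta> ck c)"
  unfolding com_ket_eq by (intro qfin_bind signed_fin com_step_fin phase_norm)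

lemma com_norm: "qnorm2 (com_ket S \<eta> ck c) = 1"
  unfolding com_ket_eq
  using com_step_fin[of real_phase, OF phase_norm(2)] com_step_inner[of real_phase, OF phase_norm(2)]
  by (subst qnorm2_bind) (simp_all add: signed_fin signed_norm)

lemma ideal_fin: "qfin (ideal_ket c)"
  unfolding ideal_ket_eq by (intro qfin_bind signed_fin com_step_fin phase_norm)

lemma ideal_norm: "qnorm2 (ideal_ket c) = 1"
  unfolding ideal_ket_eq
  using com_step_fin[of ideal_phase, OF phase_norm(1)] com_step_inner[of ideal_phase, OF phase_norm(1)]
  by (subst qnorm2_bind) (simp_all add: signed_fin signed_norm)

lemma com_supp:
  assumes "(cm, u, g) \<in> qsupp (com_ket S \<eta> ck c)"
  shows "u \<in> carrier_vec n"
proof -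
  obtain a where a: "a \<in> qsupp (signed_ket False)" "(cm, u, g) \<in> qsupp (com_step real_phase c a)"
    using subsetD[OF qsupp_bind assms[unfolded com_ket_eq]] by auto
  obtain vk g' w0 where aa: "a = (vk, g', w0)" by (cases a)
  have vk: "length vk = vk_len" using a signed_supp unfolding aa by blast
  obtain q where q: "q \<in> qsupp (observed_ket vk c (real_phase vk w0))"
    "(cm, u, g) \<in> qsupp (qbind (resign_ket w0) (\<lambda>p. qreturn (com_label (((vk, g'), p), q))))"
    using subsetD[OF qsupp_bind a(2)[unfolded com_step_def aa prod.case]] by auto
  obtain p where "(cm, u, g) = com_label (((vk, g'), p), q)"
    using subsetD[OF qsupp_bind q(2)] by auto
  then show ?thesis
    using q(1) observed_supp[OF vk phase_norm(2)]
    by (cases p; cases q) (auto simp: com_label_def)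
qed

text \<open>The weight of the rejected labels in \<open>signed_ket False\<close> is the correctness
  error for message 0 under this oracle.\<close>

lemma com_ideal_diff:
  "qnorm2 (\<lambda>a. com_ket S \<eta> ck c a - ideal_ket c a) \<le> 4 * qprob (signed_ket False) (- accepted False)"
  unfolding com_ket_eq ideal_ket_eq
proof (rule qnorm2_bind_diff_le[OF signed_fin])
  fix a assume "a \<notin> - accepted False"
  then show "com_step real_phase c a = com_step ideal_phase c a"
    by (cases a) (simp add: com_step_def accepted_def real_phase_eq)
qed (use com_step_fin com_step_inner phase_norm in auto)

section \<open>Error weights of the idealised commitment\<close>

definition ideal_label :: "(bool list \<times> bool list \<times> bool list) \<times> (bitvec \<times> bitvec \<times> bitvec \<times> bool) \<Rightarrow> com_label" where
  "ideal_label = (\<lambda>((vk, g, w1), q). com_label (((vk, g), unsigned_rest, w1), q))"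

lemma ideal_label_inj: "inj ideal_label"
  using com_label_inj by (intro injI) (auto simp: ideal_label_def inj_eq)

lemma ideal_ket_label: "ideal_ket c = qbind (signed_ket True)
    (\<lambda>a. qbind (observed_ket (fst a) c (ideal_phase (fst a) [])) (\<lambda>q. qreturn (ideal_label (a, q))))"
  by (simp add: ideal_ket_def ideal_label_def case_prod_unfold)

lemma observed_signed:
  assumes "a \<in> qsupp (signed_ket True)"
  shows "length (fst a) = vk_len" "qfin (observed_ket (fst a) c (ideal_phase (fst a) []))"
proof -
  show vk: "length (fst a) = vk_len"
    using assms signed_supp by (cases a) auto
  show "qfin (observed_ket (fst a) c (ideal_phase (fst a) []))"
    by (rule observed_fin[OF vk phase_norm(1)])
qed

definition sig_valid :: "com_label set" where
  "sig_valid = {((vk, \<sigma>, y), u, g). oss_accepts S \<eta> O' vk True \<sigma>}"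

definition good_row :: "com_label set" where
  "good_row = {((vk, \<sigma>, y), u, g). \<not> zero_row \<eta> (\<omega> vk) y}"

text \<open>Written as an explicit average because the weights of \<open>signed_ket True\<close> do
  not involve \<omega>; the expectation over the key of the pseudorandom function can therefore be
  taken term by term.\<close>

definition row_error :: real where
  "row_error = (\<Sum>(vk, g, w1)\<in>qsupp (signed_ket True). (cmod (signed_ket True (vk, g, w1)))\<^sup>2
     * (\<Sum>y\<in>carrier_vec r. of_bool (zero_row \<eta> (\<omega> vk) y) / 2 ^ r))"

lemma ideal_good_row: "qprob (ideal_ket c) (- good_row) = row_error"
proof -
  have "qprob (ideal_ket c) (- good_row) = (\<Sum>a\<in>qsupp (signed_ket True). (cmod (signed_ket True a))\<^sup>2
      * qprob (observed_ket (fst a) c (ideal_phase (fst a) [])) {q. ideal_label (a, q) \<in> - good_row})"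
    unfolding ideal_ket_label using observed_signed
    by (intro qprob_bind_label signed_fin ideal_label_inj)
  also have "\<dots> = row_error"
    unfolding row_error_def
  proof (intro sum.cong refl)
    fix a assume a: "a \<in> qsupp (signed_ket True)"
    obtain vk g w1 where aa: "a = (vk, g, w1)" by (cases a)
    have "{q. ideal_label (a, q) \<in> - good_row} = {(y, u, x, b'). y \<in> {y. zero_row \<eta> (\<omega> vk) y}}"
      by (auto simp: aa ideal_label_def com_label_def good_row_def)
    then show "(cmod (signed_ket True a))\<^sup>2
        * qprob (observed_ket (fst a) c (ideal_phase (fst a) [])) {q. ideal_label (a, q) \<in> - good_row}
      = (case a of (vk, g, w1) \<Rightarrow> (cmod (signed_ket True (vk, g, w1)))\<^sup>2
          * (\<Sum>y\<in>carrier_vec r. of_bool (zero_row \<eta> (\<omega> vk) y) / 2 ^ r))"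
      using observed_prob[where z = "ideal_phase vk []" and Y = "{y. zero_row \<eta> (\<omega> vk) y}",
          OF observed_signed(1)[OF a] phase_norm(1)] by (simp add: aa)
  qed
  finally show ?thesis .
qed

lemma ideal_sig_valid: "qprob (ideal_ket c) sig_valid = qprob (signed_ket True) (accepted True)"
proof -
  have "qprob (ideal_ket c) sig_valid = (\<Sum>a\<in>qsupp (signed_ket True). (cmod (signed_ket True a))\<^sup>2
      * qprob (observed_ket (fst a) c (ideal_phase (fst a) [])) {q. ideal_label (a, q) \<in> sig_valid})"
    unfolding ideal_ket_label using observed_signed
    by (intro qprob_bind_label signed_fin ideal_label_inj)
  also have "\<dots> = (\<Sum>a\<in>qsupp (signed_ket True). if a \<in> accepted True then (cmod (signed_ket True a))\<^sup>2 else 0)"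
  proof (intro sum.cong refl)
    fix a assume a: "a \<in> qsupp (signed_ket True)"
    obtain vk g w1 where aa: "a = (vk, g, w1)" by (cases a)
    have "{q. ideal_label (a, q) \<in> sig_valid} = (if a \<in> accepted True then UNIV else {})"
      by (auto simp: aa ideal_label_def com_label_def sig_valid_def accepted_def)
    then show "(cmod (signed_ket True a))\<^sup>2
        * qprob (observed_ket (fst a) c (ideal_phase (fst a) [])) {q. ideal_label (a, q) \<in> sig_valid}
      = (if a \<in> accepted True then (cmod (signed_ket True a))\<^sup>2 else 0)"
      using observed_norm[OF observed_signed(1)[OF a] phase_norm(1)]
      by (simp add: qprob_def[of _ "{}"])
  qed
  also have "\<dots> = qprob (signed_ket True) (accepted True)"
    by (simp add: qprob_def sum.inter_restrict signed_fin)
  finally show ?thesis .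
qed

definition good_ket :: "bool \<Rightarrow> com_label ket" where
  "good_ket c = qrestrict good_row (ideal_ket c)"

lemma good_fin: "qfin (good_ket c)"
  by (simp add: good_ket_def ideal_fin)

lemma good_norm_le: "qnorm2 (good_ket c) \<le> 1"
proof -
  have "qprob (ideal_ket c) good_row \<le> qnorm2 (ideal_ket c)"
    by (rule qprob_mono[OF ideal_fin]) simp
  then show ?thesis by (simp add: good_ket_def ideal_norm)
qed

text \<open>The 8 and the 2 arise when the factor 2 of \<open>qnorm2_triangle\<close> meets the 4 of
  \<open>com_ideal_diff\<close> and the projected weight.\<close>

lemma com_good_diff:
  "qnorm2 (\<lambda>a. com_ket S \<eta> ck c a - good_ket c a)
    \<le> 8 * qprob (signed_ket False) (- accepted False) + 2 * row_error"
proof -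
  have "(\<lambda>a. ideal_ket c a - good_ket c a) = qrestrict (- good_row) (ideal_ket c)"
    by (auto simp: good_ket_def qrestrict_def fun_eq_iff)
  then have "qnorm2 (\<lambda>a. ideal_ket c a - good_ket c a) = row_error"
    by (simp add: ideal_good_row)
  then show ?thesis
    using qnorm2_triangle[OF com_fin ideal_fin good_fin, of c c c] com_ideal_diff[of c] by linarith
qed

lemma good_sig_valid_ge:
  "1 - qprob (signed_ket True) (- accepted True) - row_error \<le> qprob (good_ket c) sig_valid"
proof -
  have "qprob (good_ket c) sig_valid = qprob (ideal_ket c) (good_row \<inter> sig_valid)"
    unfolding qprob_def good_ket_def qsupp_restrict
    by (intro sum.cong) (auto simp: qrestrict_def)
  moreover have "qprob (ideal_ket c) sig_valid
      \<le> qprob (ideal_ket c) (good_row \<inter> sig_valid) + qprob (ideal_ket c) (- good_row)"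
  proof -
    have "qprob (ideal_ket c) sig_valid \<le> qprob (ideal_ket c) (good_row \<inter> sig_valid \<union> - good_row)"
      by (rule qprob_mono[OF ideal_fin]) blast
    also have "\<dots> = qprob (ideal_ket c) (good_row \<inter> sig_valid) + qprob (ideal_ket c) (- good_row)"
      by (rule qprob_disjoint[OF ideal_fin]) blast
    finally show ?thesis .
  qed
  moreover have "qprob (signed_ket True) (accepted True) = 1 - qprob (signed_ket True) (- accepted True)"
    unfolding signed_norm[of True, symmetric] by (rule qprob_compl[OF signed_fin])
  ultimately show ?thesis
    by (simp add: ideal_good_row ideal_sig_valid)
qed

text \<open>Up to an amplitude that does not depend on the committed bit, the good part of the commitment
  to \<open>c\<close> is the uniform superposition over the half \<open>S\<^bsub>y,c\<^esub>\<close> of the coset.\<close>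

lemma good_amplitude:
  obtains \<tau> where "\<And>vk \<sigma> y c u g. good_ket c ((vk, \<sigma>, y), u, g)
      = \<tau> ((vk, \<sigma>, y), g) * of_bool (u \<in> coset_S_bit \<eta> (\<omega> vk) y c)"
    and "\<And>vk \<sigma> y g. \<tau> ((vk, \<sigma>, y), g) \<noteq> 0 \<Longrightarrow>
      length vk = vk_len \<and> y \<in> carrier_vec r \<and> \<not> zero_row \<eta> (\<omega> vk) y"
proof -
  \<comment> \<open>The factor has to be found before the bit and \<open>u\<close> are known. Both
    claims are put into one predicate of a label and a candidate value, so that a single choice
    yields \<tau>.\<close>
  define P where "P k t \<longleftrightarrow> (\<forall>c u. good_ket c (fst k, u, snd k)
      = t * of_bool (u \<in> coset_S_bit \<eta> (\<omega> (fst (fst k))) (snd (snd (fst k))) c))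
    \<and> (t \<noteq> 0 \<longrightarrow> length (fst (fst k)) = vk_len \<and> snd (snd (fst k)) \<in> carrier_vec r
        \<and> \<not> zero_row \<eta> (\<omega> (fst (fst k))) (snd (snd (fst k))))"
    for k :: "commitment \<times> garbage" and t
  have "\<exists>t. P k t" for k
  proof -
    obtain vk \<sigma> y g x b' wr \<sigma>' where k: "k = ((vk, \<sigma>, y), (g, x, b', wr, \<sigma>'))"
      by (metis prod.exhaust)
    show ?thesis
    proof (cases "zero_row \<eta> (\<omega> vk) y")
      case True
      then have "P k 0"
        by (simp add: P_def k good_ket_def qrestrict_def good_row_def)
      then show ?thesis by blast
    next
      case nz: False
      have good: "good_ket c (fst k, u, snd k) = ideal_ket c (fst k, u, snd k)" for c u
        using nz by (simp add: k good_ket_def qrestrict_def good_row_def)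
      show ?thesis
      proof (cases "wr = unsigned_rest \<and> (\<exists>w1. \<sigma> = take sig_len w1 \<and> \<sigma>' = drop sig_len w1)")
        case True
        then obtain w1 where w1: "wr = unsigned_rest" "\<sigma> = take sig_len w1" "\<sigma>' = drop sig_len w1"
          by blast
        let ?a = "(vk, g, w1)"
        let ?t = "signed_ket True ?a * (if y \<in> carrier_vec r \<and> x = 0\<^sub>v n then 1 / sqrt (2 ^ n) else 0)"
        have lab: "(fst k, u, snd k) = ideal_label (?a, (y, u, x, b'))" for u
          by (simp add: k ideal_label_def com_label_def w1)
        have amp: "ideal_ket c (fst k, u, snd k)
            = signed_ket True ?a * observed_ket vk c (ideal_phase vk []) (y, u, x, b')" for c u
          unfolding lab ideal_ket_label using observed_signed
          by (subst bind_label_amplitude[OF signed_fin _ ideal_label_inj]) auto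
        show ?thesis
        proof (cases "?a \<in> qsupp (signed_ket True)")
          case True
          then have vk: "length vk = vk_len" using signed_supp by blast
          then have "P k ?t"
            unfolding P_def good amp using nz by (simp add: k observed_amplitude[OF vk nz])
          then show ?thesis by blast
        next
          case False
          then have "P k 0"
            unfolding P_def good amp by (simp add: not_in_qsupp)
          then show ?thesis by blast
        qed
      next
        case False
        \<comment> \<open>A label that the ideal commitment cannot produce has amplitude 0, so 0
          serves as the factor.\<close>
        have "(fst k, u, snd k) \<notin> range ideal_label" for u
          using False by (auto simp: k ideal_label_def com_label_def)
        then have "ideal_ket c (fst k, u, snd k) = 0" for c u
          unfolding ideal_ket_label using observed_signed
          by (intro bind_label_amplitude_0 signed_fin ideal_label_inj) auto
        then have "P k 0" by (simp add: P_def good)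
        then show ?thesis by blast
      qed
    qed
  qed
  then obtain \<tau> where \<tau>: "\<And>k. P k (\<tau> k)" by metis
  show thesis
  proof (rule that)
    show "good_ket c ((vk, \<sigma>, y), u, g)
      = \<tau> ((vk, \<sigma>, y), g) * of_bool (u \<in> coset_S_bit \<eta> (\<omega> vk) y c)" for vk \<sigma> y c u g
      using \<tau>[of "((vk, \<sigma>, y), g)"] by (simp add: P_def)
    show "length vk = vk_len \<and> y \<in> carrier_vec r \<and> \<not> zero_row \<eta> (\<omega> vk) y"
      if "\<tau> ((vk, \<sigma>, y), g) \<noteq> 0" for vk \<sigma> y g
      using \<tau>[of "((vk, \<sigma>, y), g)"] that by (simp add: P_def)
  qed
qed

end

section \<open>Decoding probabilities from factorised amplitudes\<close>

lemma qbind_diff: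
  assumes "qfin \<psi>" "qfin \<phi>"
  shows "qbind \<psi> V a - qbind \<phi> V a = qbind (\<lambda>b. \<psi> b - \<phi> b) V a"
proof -
  have X: "finite (qsupp \<psi> \<union> qsupp \<phi>)" using assms by simp
  show ?thesis
    using qbind_superset[OF X, of \<psi> V a] qbind_superset[OF X, of \<phi> V a]
      qbind_superset[OF X qsupp_diff, of V a]
    by (simp add: sum_subtractf left_diff_distrib)
qed

lemma qubit_isometry_qreturn: "qubit_isometry qreturn"
  by unfold_locales simp_all

lemma qubit_isometry_hadamard: "qubit_isometry hadamard"
  by unfold_locales (simp_all add: qinner_hadamard)

text \<open>On \<open>A\<close> the reference state is the amplitude of the direct measurement times
  a factor \<open>h\<close> free of the bit, so its weight there is the target probability times the
  weight of \<open>h\<close>. The perturbation bound transfers this to \<open>V\<close>.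
  \<open>H\<close> speaks of any finite \<open>X\<close> above the supports because \<open>V\<close>
  and \<open>T\<close> have to be summed over a common set.\<close>

lemma prob_decode_ge:
  fixes V T :: "bool \<Rightarrow> 'a ket" and W :: "bool \<Rightarrow> bool ket"
  assumes \<rho>: "density_qubit \<rho>" and V: "qubit_isometry V" and W: "qubit_isometry W"
    and T: "\<And>b. qfin (T b)" "\<And>b. qnorm2 (T b) \<le> 1"
    and d: "\<And>b. qnorm2 (\<lambda>a. V b a - T b a) \<le> d" and t: "0 < t"
    and dec: "\<And>a b. a \<in> A \<Longrightarrow> T b a = W b \<beta> * h a"
    and H: "\<And>X. finite X \<Longrightarrow> (\<And>b. qsupp (T b) \<subseteq> X) \<Longrightarrow> 1 - e \<le> (\<Sum>a\<in>X \<inter> A. (cmod (h a))\<^sup>2)"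
    and e: "0 \<le> e"
  shows "pmf (measure_qubit \<rho> W) \<beta> - (e + 4 * (t + d / t)) \<le> measure_pmf.prob (measure_qubit \<rho> V) A"
proof -
  interpret V: qubit_isometry V by (rule V)
  interpret W: qubit_isometry W by (rule W)
  let ?p = "pmf (measure_qubit \<rho> W) \<beta>"
  define X where "X = (\<Union>b. qsupp (V b)) \<union> (\<Union>b. qsupp (T b))"
  have X: "finite X" using V.fin T(1) by (simp add: X_def)
  have zero: "Re (qubit_form \<rho> (\<lambda>b. V b a)) = 0" if "a \<notin> (\<Union>b. qsupp (V b))" for a
    using that by (simp add: qubit_form_def qsupp_def)
  have prob: "measure_pmf.prob (measure_qubit \<rho> V) A = (\<Sum>a\<in>X \<inter> A. Re (qubit_form \<rho> (\<lambda>b. V b a)))"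
    unfolding V.prob_measure_qubit[OF \<rho>]
  proof (rule sum.mono_neutral_left)
    show "\<forall>a\<in>X \<inter> A - (\<Union>b. qsupp (V b)) \<inter> A. Re (qubit_form \<rho> (\<lambda>b. V b a)) = 0"
      by (intro ballI zero) blast
  qed (use X in \<open>auto simp: X_def\<close>)
  have form: "Re (qubit_form \<rho> (\<lambda>b. T b a)) = ?p * (cmod (h a))\<^sup>2" if "a \<in> A" for a
  proof -
    have "qubit_form \<rho> (\<lambda>b. T b a) = qubit_form \<rho> (\<lambda>b. W b \<beta>) * (h a * cnj (h a))"
      unfolding qubit_form_def sum_distrib_right
      by (intro sum.cong refl) (simp add: dec[OF that] mult_ac)
    also have "h a * cnj (h a) = of_real ((cmod (h a))\<^sup>2)"
      by (simp add: complex_norm_square del: of_real_power)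
    finally show ?thesis
      by (simp add: W.pmf_measure_qubit[OF \<rho>] del: of_real_power)
  qed
  have "?p * (1 - e) \<le> ?p * (\<Sum>a\<in>X \<inter> A. (cmod (h a))\<^sup>2)"
    by (intro mult_left_mono H[OF X]) (unfold X_def, blast, simp)
  also have "\<dots> = (\<Sum>a\<in>X \<inter> A. Re (qubit_form \<rho> (\<lambda>b. T b a)))"
    by (simp add: form sum_distrib_left)
  finally have "?p * (1 - e) \<le> (\<Sum>a\<in>X \<inter> A. Re (qubit_form \<rho> (\<lambda>b. T b a)))" .
  moreover have "\<bar>measure_pmf.prob (measure_qubit \<rho> V) A - (\<Sum>a\<in>X \<inter> A. Re (qubit_form \<rho> (\<lambda>b. T b a)))\<bar>
      \<le> 4 * (t + d / t)"
    unfolding prob using X V.norm by (intro measure_qubit_perturbation \<rho> t V.fin T d) simp_all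
  moreover have "?p * e \<le> e"
    by (rule mult_left_le_one_le[OF e pmf_nonneg pmf_le_1])
  ultimately show ?thesis
    by (simp add: right_diff_distrib)
qed

section \<open>Openings as isometries on the qubit\<close>

context pfc_run
begin

text \<open>The Hadamard transform is unitary on vectors of one fixed dimension, so labels are
  confined to those with \<open>u\<close> of dimension \<open>n\<close>.\<close>

definition post_labels :: "com_label set" where
  "post_labels = {(c, u, g). u \<in> carrier_vec n}"

definition opened_ket :: "(bool \<Rightarrow> com_label \<Rightarrow> 'a ket) \<Rightarrow> bool \<Rightarrow> 'a ket" where
  "opened_ket post b = qbind (com_ket S \<eta> ck b) (post b)"

definition opened_good_ket :: "(bool \<Rightarrow> com_label \<Rightarrow> 'a ket) \<Rightarrow> bool \<Rightarrow> 'a ket" where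
  "opened_good_ket post b = qbind (good_ket b) (post b)"

lemma com_labels: "qsupp (com_ket S \<eta> ck b) \<subseteq> post_labels"
  using com_supp by (auto simp: post_labels_def)

lemma coset_S_carrier:
  assumes "length vk = vk_len" "y \<in> carrier_vec r" "u \<in> coset_S_bit \<eta> (\<omega> vk) y c"
  shows "u \<in> carrier_vec n"
proof -
  obtain \<pi> A b where w: "\<omega> vk = (\<pi>, A, b)" and run: "obar_run \<eta> \<pi> A b"
    using obar_run_of_vk[OF assms(1)] by blast
  show ?thesis
    using obar_run.S_carrier[OF run assms(2)] assms(3) by (simp add: w coset_S_bit_def)
qed

lemma good_labels: "qsupp (good_ket b) \<subseteq> post_labels"
proof
  fix p assume p: "p \<in> qsupp (good_ket b)"
  obtain vk \<sigma> y u g where pp: "p = ((vk, \<sigma>, y), u, g)" by (metis prod.exhaust)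
  obtain \<tau> where \<tau>: "\<And>vk \<sigma> y c u g. good_ket c ((vk, \<sigma>, y), u, g)
      = \<tau> ((vk, \<sigma>, y), g) * of_bool (u \<in> coset_S_bit \<eta> (\<omega> vk) y c)"
    "\<And>vk \<sigma> y g. \<tau> ((vk, \<sigma>, y), g) \<noteq> 0 \<Longrightarrow>
      length vk = vk_len \<and> y \<in> carrier_vec r \<and> \<not> zero_row \<eta> (\<omega> vk) y"
    using good_amplitude by blast
  have "\<tau> ((vk, \<sigma>, y), g) \<noteq> 0" "u \<in> coset_S_bit \<eta> (\<omega> vk) y b"
    using p by (auto simp: pp qsupp_def \<tau>(1) split: if_splits)
  then show "p \<in> post_labels"
    using coset_S_carrier[of vk y u b] \<tau>(2)[of vk \<sigma> y g] by (auto simp: pp post_labels_def)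
qed

definition good_diff_bound :: real where
  "good_diff_bound = 8 * qprob (signed_ket False) (- accepted False) + 2 * row_error"

context
  fixes post :: "bool \<Rightarrow> com_label \<Rightarrow> 'a ket"
  assumes post_fin: "p \<in> post_labels \<Longrightarrow> qfin (post b p)"
    and post_inner: "p \<in> post_labels \<Longrightarrow> p' \<in> post_labels \<Longrightarrow>
      qinner (post b p) (post b' p') = (if p = p' then of_bool (b = b') else 0)"
begin

text \<open>Different bits stay orthogonal because \<open>post\<close> still carries the qubit
  register; the commitments to 0 and 1 need not be orthogonal themselves.\<close>

lemma opened_isometry: "qubit_isometry (opened_ket post)"
proof
  show "qfin (opened_ket post b)" for b
    unfolding opened_ket_def by (intro qfin_bind com_fin post_fin) (rule subsetD[OF com_labels])
  show "qinner (opened_ket post b) (opened_ket post b') = (if b = b' then 1 else 0)" for b b'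
  proof -
    have "qinner (opened_ket post b) (opened_ket post b')
        = of_bool (b = b') * qinner (com_ket S \<eta> ck b) (com_ket S \<eta> ck b')"
      unfolding opened_ket_def
      by (rule qinner_bind[OF com_fin com_fin]) (use com_labels post_fin post_inner in blast)+
    then show ?thesis by (simp add: qinner_self com_norm)
  qed
qed

lemma opened_good_fin: "qfin (opened_good_ket post b)"
  unfolding opened_good_ket_def by (intro qfin_bind good_fin post_fin) (rule subsetD[OF good_labels])

lemma opened_good_norm_le: "qnorm2 (opened_good_ket post b) \<le> 1"
proof -
  have "qnorm2 (opened_good_ket post b) = qnorm2 (good_ket b)"
    unfolding opened_good_ket_def
  proof (rule qnorm2_bind[OF good_fin])
    show "qfin (post b p)" if "p \<in> qsupp (good_ket b)" for p
      by (rule post_fin[OF subsetD[OF good_labels that]])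
    show "qinner (post b p) (post b p') = (if p = p' then 1 else 0)"
      if "p \<in> qsupp (good_ket b)" "p' \<in> qsupp (good_ket b)" for p p'
      by (subst post_inner[OF subsetD[OF good_labels that(1)] subsetD[OF good_labels that(2)]]) simp
  qed
  then show ?thesis using good_norm_le by simp
qed

text \<open>Opening is linear and isometric, so the distance between the commitments carries over
  unchanged.\<close>

lemma opened_diff: "qnorm2 (\<lambda>a. opened_ket post b a - opened_good_ket post b a) \<le> good_diff_bound"
proof -
  let ?\<delta> = "\<lambda>a. com_ket S \<eta> ck b a - good_ket b a"
  have supp: "qsupp ?\<delta> \<subseteq> post_labels"
    using qsupp_diff[of "com_ket S \<eta> ck b" "good_ket b"] com_labels[of b] good_labels[of b] by blast
  have fin: "qfin ?\<delta>"
    by (rule finite_subset[OF qsupp_diff]) (simp add: com_fin good_fin)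
  have "qnorm2 (\<lambda>a. opened_ket post b a - opened_good_ket post b a) = qnorm2 (qbind ?\<delta> (post b))"
    by (simp add: opened_ket_def opened_good_ket_def qbind_diff com_fin good_fin)
  also have "\<dots> = qnorm2 ?\<delta>"
  proof (rule qnorm2_bind[OF fin])
    show "qfin (post b p)" if "p \<in> qsupp ?\<delta>" for p
      by (rule post_fin[OF subsetD[OF supp that]])
    show "qinner (post b p) (post b p') = (if p = p' then 1 else 0)"
      if "p \<in> qsupp ?\<delta>" "p' \<in> qsupp ?\<delta>" for p p'
      by (subst post_inner[OF subsetD[OF supp that(1)] subsetD[OF supp that(2)]]) simp
  qed
  finally show ?thesis
    using com_good_diff[of b] by (simp add: good_diff_bound_def)
qed

lemma prob_opened_ge:
  fixes W :: "bool \<Rightarrow> bool ket"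
  assumes \<rho>: "density_qubit \<rho>" and W: "qubit_isometry W" and t: "0 < t"
    and dec: "\<And>a b. a \<in> A \<Longrightarrow> opened_good_ket post b a = W b \<beta> * h a"
    and H: "\<And>X. finite X \<Longrightarrow> (\<And>b. qsupp (opened_good_ket post b) \<subseteq> X) \<Longrightarrow>
      qprob (good_ket c) sig_valid \<le> (\<Sum>a\<in>X \<inter> A. (cmod (h a))\<^sup>2)"
  shows "pmf (measure_qubit \<rho> W) \<beta>
      - (qprob (signed_ket True) (- accepted True) + row_error + 4 * (t + good_diff_bound / t))
    \<le> measure_pmf.prob (measure_qubit \<rho> (opened_ket post)) A"
proof (rule prob_decode_ge[OF \<rho> opened_isometry W opened_good_fin opened_good_norm_le opened_diff t dec])
  show "0 \<le> qprob (signed_ket True) (- accepted True) + row_error"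
    unfolding ideal_good_row[of False, symmetric] by simp
  show "1 - (qprob (signed_ket True) (- accepted True) + row_error) \<le> (\<Sum>a\<in>X \<inter> A. (cmod (h a))\<^sup>2)"
    if "finite X" "\<And>b. qsupp (opened_good_ket post b) \<subseteq> X" for X
    using H[OF that] good_sig_valid_ge[of c] by linarith
qed

end

type_synonym opened_label = "bool \<times> bitvec \<times> commitment \<times> garbage"

definition postZ :: "bool \<Rightarrow> com_label \<Rightarrow> opened_label ket" where
  "postZ b = (\<lambda>(c, u, g). qreturn (b, u, c, g))"

definition postX :: "bool \<Rightarrow> com_label \<Rightarrow> opened_label ket" where
  "postX b = (\<lambda>(c, u, g). do {
     b' \<leftarrow> hadamard b; u' \<leftarrow> hadamard_vec u; qreturn (b', u', c, g) })"

definition decodesZ :: "bool \<Rightarrow> opened_label set" where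
  "decodesZ \<beta> = {(b, u, (vk, \<sigma>, y), g).
     oss_accepts S \<eta> O' vk True \<sigma> \<and> u \<in> coset_S_bit \<eta> (\<omega> vk) y b \<and> b = \<beta>}"

definition decodesX :: "bool \<Rightarrow> opened_label set" where
  "decodesX \<beta> = {(b, v, (vk, \<sigma>, y), g). oss_accepts S \<eta> O' vk True \<sigma> \<and>
     (v \<in> S_perp \<eta> (\<omega> vk) y \<and> b = \<beta>
      \<or> v \<notin> S_perp \<eta> (\<omega> vk) y \<and> v + unit_vec n 0 \<in> S_perp \<eta> (\<omega> vk) y \<and> b = (\<not> \<beta>))}"

text \<open>In this basis the factor of the bit is \<open>qreturn b \<beta>\<close>. The coset test
  of \<open>decZ\<close> passes on the whole support, as the good state of \<beta> lives on its own
  half; only the signature check remains.\<close>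

lemma probZ_ge:
  assumes \<rho>: "density_qubit \<rho>" and t: "0 < t"
  shows "pmf (measure_qubit \<rho> qreturn) \<beta>
      - (qprob (signed_ket True) (- accepted True) + row_error + 4 * (t + good_diff_bound / t))
    \<le> measure_pmf.prob (measure_qubit \<rho> (opened_ket postZ)) (decodesZ \<beta>)"
proof -
  have fin: "qfin (postZ b p)" for b p by (cases p) (simp add: postZ_def)
  have inner: "qinner (postZ b p) (postZ b' p') = (if p = p' then of_bool (b = b') else 0)" for b b' p p'
    by (cases p; cases p') (auto simp: postZ_def)
  have amp: "opened_good_ket postZ b (b1, u, c, g) = qreturn b b1 * good_ket b (c, u, g)" for b b1 u c g
  proof -
    have "opened_good_ket postZ b (b1, u, c, g)
        = (\<Sum>p\<in>insert (c, u, g) (qsupp (good_ket b)). good_ket b p * postZ b p (b1, u, c, g))"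
      unfolding opened_good_ket_def by (rule qbind_superset) (use good_fin in auto)
    also have "\<dots> = (\<Sum>p\<in>insert (c, u, g) (qsupp (good_ket b)).
        if p = (c, u, g) then good_ket b p * qreturn b b1 else 0)"
    proof (intro sum.cong refl)
      fix p :: com_label
      obtain c' u' g' where p: "p = (c', u', g')" by (metis prod.exhaust)
      show "good_ket b p * postZ b p (b1, u, c, g) = (if p = (c, u, g) then good_ket b p * qreturn b b1 else 0)"
        by (simp add: p postZ_def qreturn_def)
    qed
    also have "\<dots> = good_ket b (c, u, g) * qreturn b b1"
      using good_fin by (subst sum.delta) simp_all
    finally show ?thesis by simp
  qed
  obtain \<tau> where \<tau>: "\<And>vk \<sigma> y c u g. good_ket c ((vk, \<sigma>, y), u, g)
      = \<tau> ((vk, \<sigma>, y), g) * of_bool (u \<in> coset_S_bit \<eta> (\<omega> vk) y c)"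
    and "\<And>vk \<sigma> y g. \<tau> ((vk, \<sigma>, y), g) \<noteq> 0 \<Longrightarrow>
      length vk = vk_len \<and> y \<in> carrier_vec r \<and> \<not> zero_row \<eta> (\<omega> vk) y"
    using good_amplitude by blast
  define h where "h = (\<lambda>(b :: bool, u, c, g). good_ket b (c, u, g))"
  show ?thesis
  proof (rule prob_opened_ge[OF fin inner \<rho> qubit_isometry_qreturn t, where h = h])
    show "opened_good_ket postZ b a = qreturn b \<beta> * h a" if "a \<in> decodesZ \<beta>" for a b
    proof -
      obtain b1 u c g where a: "a = (b1, u, c, g)" by (metis prod.exhaust)
      have "b1 = \<beta>" using that by (auto simp: a decodesZ_def)
      then show ?thesis by (simp add: a amp h_def qreturn_def)
    qed
  next
    fix X assume X: "finite X" "\<And>b. qsupp (opened_good_ket postZ b) \<subseteq> X"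
    let ?f = "\<lambda>(c, u, g). (\<beta>, u, c, g)"
    have inj: "inj_on ?f (qsupp (good_ket \<beta>) \<inter> sig_valid)"
      by (auto intro!: inj_onI)
    have sub: "?f ` (qsupp (good_ket \<beta>) \<inter> sig_valid) \<subseteq> X \<inter> decodesZ \<beta>"
    proof
      fix a assume "a \<in> ?f ` (qsupp (good_ket \<beta>) \<inter> sig_valid)"
      then obtain vk \<sigma> y u g where a: "a = (\<beta>, u, (vk, \<sigma>, y), g)"
        "good_ket \<beta> ((vk, \<sigma>, y), u, g) \<noteq> 0" "oss_accepts S \<eta> O' vk True \<sigma>"
        by (auto simp: qsupp_def sig_valid_def)
      have "opened_good_ket postZ \<beta> a \<noteq> 0"
        using a by (simp add: amp qreturn_def)
      then have "a \<in> X" using X(2)[of \<beta>] by (auto simp: qsupp_def)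
      moreover have "u \<in> coset_S_bit \<eta> (\<omega> vk) y \<beta>"
        using a(2) \<tau> by (auto split: if_splits)
      ultimately show "a \<in> X \<inter> decodesZ \<beta>" using a by (simp add: decodesZ_def)
    qed
    have "qprob (good_ket \<beta>) sig_valid = (\<Sum>a\<in>?f ` (qsupp (good_ket \<beta>) \<inter> sig_valid). (cmod (h a))\<^sup>2)"
      unfolding qprob_def by (subst sum.reindex[OF inj]) (auto simp: h_def intro!: sum.cong)
    also have "\<dots> \<le> (\<Sum>a\<in>X \<inter> decodesZ \<beta>. (cmod (h a))\<^sup>2)"
      using X(1) sub by (intro sum_mono2) auto
    finally show "qprob (good_ket \<beta>) sig_valid \<le> (\<Sum>a\<in>X \<inter> decodesZ \<beta>. (cmod (h a))\<^sup>2)" .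
  qed
qed

end

section \<open>Opening in the Hadamard basis\<close>

context pfc_run
begin

lemma postX_fin: "p \<in> post_labels \<Longrightarrow> qfin (postX b p)"
  by (cases p) (auto simp: postX_def post_labels_def qsupp_hadamard_vec intro!: qfin_bind)

lemma postX_inner:
  assumes "p \<in> post_labels" "p' \<in> post_labels"
  shows "qinner (postX b p) (postX b' p') = (if p = p' then of_bool (b = b') else 0)"
proof -
  obtain c u g c' u' g' where p: "p = (c, u, g)" "p' = (c', u', g')"
    by (metis prod.exhaust)
  have u: "u \<in> carrier_vec n" "u' \<in> carrier_vec n"
    using assms by (auto simp: p post_labels_def)
  let ?V = "\<lambda>c u g v. qbind (hadamard_vec u) (\<lambda>u'. qreturn (v, u', c, g))"
  have fin: "qfin (hadamard_vec u)" "qfin (hadamard_vec u')"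
    using u by (simp_all add: qsupp_hadamard_vec)
  have V: "qinner (?V c u g v) (?V c' u' g' v') = (if v = v' then of_bool ((c, u, g) = (c', u', g')) else 0)"
    for v v'
  proof -
    have "qinner (?V c u g v) (?V c' u' g' v')
        = (if v = v' \<and> c = c' \<and> g = g' then 1 else 0) * qinner (hadamard_vec u) (hadamard_vec u')"
      by (rule qinner_bind) (use fin in auto)
    then show ?thesis
      using qunitaryD(4)[OF qunitary_hadamard_vec u] by simp
  qed
  have "qinner (postX b p) (postX b' p') = of_bool (p = p') * qinner (hadamard b) (hadamard b')"
    unfolding postX_def p prod.case
    by (rule qinner_bind[OF _ _ _ _ V]) (simp_all add: qfin_bind fin)
  then show ?thesis by (simp add: qinner_hadamard)
qed

lemma postX_amplitude:
  assumes "u \<in> carrier_vec n"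
  shows "postX b (c, u, g) (b', v, c', g')
    = (if c = c' \<and> g = g' then hadamard b b' * hadamard_vec u v else 0)"
proof -
  have inner: "qbind (hadamard_vec u) (\<lambda>u'. qreturn (x, u', c, g)) (b', v, c', g')
      = (if x = b' then if c = c' \<and> g = g' then hadamard_vec u v else 0 else 0)" for x
  proof -
    have "qbind (hadamard_vec u) (\<lambda>u'. qreturn (x, u', c, g)) (b', v, c', g')
        = (\<Sum>u'\<in>insert v (carrier_vec n). hadamard_vec u u' * qreturn (x, u', c, g) (b', v, c', g'))"
      using assms by (intro qbind_superset) (auto simp: qsupp_hadamard_vec)
    also have "\<dots> = (\<Sum>u'\<in>insert v (carrier_vec n). if u' = v then
        (if x = b' \<and> c = c' \<and> g = g' then hadamard_vec u u' else 0) else 0)"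
      by (intro sum.cong refl) (auto simp: qreturn_def)
    also have "\<dots> = (if x = b' \<and> c = c' \<and> g = g' then hadamard_vec u v else 0)"
      by (subst sum.delta) simp_all
    finally show ?thesis by simp
  qed
  have "postX b (c, u, g) (b', v, c', g')
      = (\<Sum>x\<in>UNIV. if x = b' then hadamard b x * (if c = c' \<and> g = g' then hadamard_vec u v else 0) else 0)"
    unfolding postX_def prod.case qbind_supp[of "hadamard b"] qsupp_hadamard inner
    by (intro sum.cong refl) simp
  also have "\<dots> = hadamard b b' * (if c = c' \<and> g = g' then hadamard_vec u v else 0)"
    by (subst sum.delta) simp_all
  finally show ?thesis by simp
qed

text \<open>Outside dimension \<open>n\<close> the value 0 matches \<open>hadamard_vec\<close>,
  which vanishes there, so no dimension has to be assumed of a measured \<open>v\<close>.\<close>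

definition coset_fourier :: "bool list \<Rightarrow> bitvec \<Rightarrow> bool \<Rightarrow> bitvec \<Rightarrow> complex" where
  "coset_fourier vk y c v = (if v \<in> carrier_vec n
     then \<Sum>u\<in>coset_S_bit \<eta> (\<omega> vk) y c. hadamard_vec u v else 0)"

lemma
  assumes vk: "length vk = vk_len" and y: "y \<in> carrier_vec r" and nz: "\<not> zero_row \<eta> (\<omega> vk) y"
  shows coset_fourier_dual: "v \<in> S_perp \<eta> (\<omega> vk) y \<Longrightarrow> coset_fourier vk y c v = coset_fourier vk y False v"
    and coset_fourier_not_dual: "v \<notin> S_perp \<eta> (\<omega> vk) y \<Longrightarrow>
      coset_fourier vk y c v = bit_sign (of_bool c) * coset_fourier vk y False v"
    and coset_fourier_eq_0: "v \<notin> S_perp \<eta> (\<omega> vk) y \<Longrightarrow> v + unit_vec n 0 \<notin> S_perp \<eta> (\<omega> vk) y \<Longrightarrow>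
      coset_fourier vk y c v = 0"
proof -
  obtain \<pi> A b where w: "\<omega> vk = (\<pi>, A, b)" and run: "obar_run \<eta> \<pi> A b"
    using obar_run_of_vk[OF vk] by blast
  interpret C: bit_coset "A y" "b y" n "n - r"
    by (rule obar_run.bit_coset[OF run y])
  have row: "row (A y) 0 \<noteq> 0\<^sub>v (n - r)"
    using nz by (simp add: w zero_row_def)
  have S: "coset_S_bit \<eta> (\<omega> vk) y c = C.coset_bit c" for c
    by (simp add: w obar_run.S_bit_eq[OF run y])
  have perp: "v \<in> S_perp \<eta> (\<omega> vk) y \<longleftrightarrow> v \<in> carrier_vec n \<and> C.dual v" for v
    by (simp add: w S_perp_def par_k_def obar_run.D_eq[OF run y])
  have F: "coset_fourier vk y c v = (if v \<in> carrier_vec n then C.fourier c v / sqrt (2 ^ n) else 0)" for c v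
    by (simp add: coset_fourier_def S C.sum_hadamard_vec)
  show "coset_fourier vk y c v = coset_fourier vk y False v" if "v \<in> S_perp \<eta> (\<omega> vk) y"
    using that C.fourier_dual[OF _ row, of v c False] by (simp add: F perp)
  show "coset_fourier vk y c v = bit_sign (of_bool c) * coset_fourier vk y False v"
    if "v \<notin> S_perp \<eta> (\<omega> vk) y"
    using that C.fourier_not_dual[of v c] by (auto simp: F perp)
  show "coset_fourier vk y c v = 0"
    if "v \<notin> S_perp \<eta> (\<omega> vk) y" "v + unit_vec n 0 \<notin> S_perp \<eta> (\<omega> vk) y"
    using that C.fourier_eq_0[of v c] by (auto simp: F perp)
qed

lemma cmod_hadamard: "(cmod (hadamard b b'))\<^sup>2 = 1 / 2"
  by (auto simp: hadamard_def norm_divide power_divide)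

text \<open>A sign \<open>(-1)^b\<close> before the Hadamard gate is a bit flip after it. In this
  way the sign of the transform off the dual becomes the flip that \<open>decX\<close>
  reverses.\<close>

lemma hadamard_sign: "hadamard b b' * bit_sign (of_bool b) = hadamard b (\<not> b')"
  by (cases b; cases b') (simp_all add: hadamard_def)

text \<open>The factor \<open>h\<close> is the transform for bit 0. On the dual both bits share it;
  off the dual the sign of bit 1 is moved into the Hadamard amplitude. For the weight of
  \<open>h\<close> it is enough to look at bit 0: a valid outcome is decoded to \<beta> or to
  \<open>\<not> \<beta>\<close>, and flipping the measured qubit exchanges these cases without
  changing \<open>h\<close>.\<close>

lemma probX_ge:
  assumes \<rho>: "density_qubit \<rho>" and t: "0 < t"
  shows "pmf (measure_qubit \<rho> hadamard) \<beta>
      - (qprob (signed_ket True) (- accepted True) + row_error + 4 * (t + good_diff_bound / t))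
    \<le> measure_pmf.prob (measure_qubit \<rho> (opened_ket postX)) (decodesX \<beta>)"
proof -
  obtain \<tau> where \<tau>: "\<And>vk \<sigma> y c u g. good_ket c ((vk, \<sigma>, y), u, g)
      = \<tau> ((vk, \<sigma>, y), g) * of_bool (u \<in> coset_S_bit \<eta> (\<omega> vk) y c)"
    and \<tau>0: "\<And>vk \<sigma> y g. \<tau> ((vk, \<sigma>, y), g) \<noteq> 0 \<Longrightarrow>
      length vk = vk_len \<and> y \<in> carrier_vec r \<and> \<not> zero_row \<eta> (\<omega> vk) y"
    using good_amplitude by blast
  have amp: "opened_good_ket postX b (b', v, (vk, \<sigma>, y), g)
      = hadamard b b' * (\<tau> ((vk, \<sigma>, y), g) * coset_fourier vk y b v)" for b b' v vk \<sigma> y g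
  proof (cases "\<tau> ((vk, \<sigma>, y), g) = 0")
    case True
    have "good_ket b p * postX b p (b', v, (vk, \<sigma>, y), g) = 0" for p
    proof (cases "p \<in> qsupp (good_ket b)")
      case p: True
      obtain c u g' where pp: "p = (c, u, g')" by (metis prod.exhaust)
      have "u \<in> carrier_vec n"
        using subsetD[OF good_labels p] by (simp add: pp post_labels_def)
      then show ?thesis
        using True \<tau>[of b vk \<sigma> y u g] by (auto simp: pp postX_amplitude)
    qed (simp add: not_in_qsupp)
    then show ?thesis
      using True by (simp add: opened_good_ket_def qbind_supp)
  next
    case False
    from \<tau>0[OF this] have vk: "length vk = vk_len" and y: "y \<in> carrier_vec r"
      and nz: "\<not> zero_row \<eta> (\<omega> vk) y" by auto
    let ?S = "coset_S_bit \<eta> (\<omega> vk) y b"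
    let ?l = "\<lambda>u. ((vk, \<sigma>, y), u, g) :: com_label"
    have S: "u \<in> carrier_vec n" if "u \<in> ?S" for u
      by (rule coset_S_carrier[OF vk y that])
    have "opened_good_ket postX b (b', v, (vk, \<sigma>, y), g)
        = (\<Sum>p\<in>?l ` ?S. good_ket b p * postX b p (b', v, (vk, \<sigma>, y), g))"
      unfolding opened_good_ket_def qbind_supp
    proof (rule sum.mono_neutral_right[OF good_fin])
      show "?l ` ?S \<subseteq> qsupp (good_ket b)"
        using False by (auto simp: qsupp_def \<tau>)
      show "\<forall>p\<in>qsupp (good_ket b) - ?l ` ?S. good_ket b p * postX b p (b', v, (vk, \<sigma>, y), g) = 0"
      proof
        fix p assume p: "p \<in> qsupp (good_ket b) - ?l ` ?S"
        obtain c u g' where pp: "p = (c, u, g')" by (metis prod.exhaust)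
        have u: "u \<in> carrier_vec n"
          using subsetD[OF good_labels, of p b] p by (simp add: pp post_labels_def)
        have "u \<in> ?S" if "c = (vk, \<sigma>, y)" "g' = g"
          using p that \<tau>[of b vk \<sigma> y u g] by (auto simp: pp qsupp_def split: if_splits)
        then have "\<not> (c = (vk, \<sigma>, y) \<and> g' = g)"
          using p by (auto simp: pp)
        then show "good_ket b p * postX b p (b', v, (vk, \<sigma>, y), g) = 0"
          using postX_amplitude[OF u, of b c g' b' v "(vk, \<sigma>, y)" g] by (auto simp: pp)
      qed
    qed
    also have "\<dots> = (\<Sum>u\<in>?S. good_ket b (?l u) * postX b (?l u) (b', v, (vk, \<sigma>, y), g))"
      by (subst sum.reindex) (auto intro!: inj_onI)
    also have "\<dots> = (\<Sum>u\<in>?S. hadamard b b' * (\<tau> ((vk, \<sigma>, y), g) * hadamard_vec u v))"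
      by (intro sum.cong refl) (simp add: \<tau> postX_amplitude[OF S])
    also have "\<dots> = hadamard b b' * (\<tau> ((vk, \<sigma>, y), g) * (\<Sum>u\<in>?S. hadamard_vec u v))"
      by (simp add: sum_distrib_left)
    also have "(\<Sum>u\<in>?S. hadamard_vec u v) = coset_fourier vk y b v"
    proof (cases "v \<in> carrier_vec n")
      case False
      have "hadamard_vec u v = 0" if "u \<in> ?S" for u
        using S[OF that] False by (auto simp: hadamard_vec_def)
      then show ?thesis using False by (simp add: coset_fourier_def)
    qed (simp add: coset_fourier_def)
    finally show ?thesis .
  qed
  define h where "h = (\<lambda>(b' :: bool, v, (vk, \<sigma> :: bool list, y), g). \<tau> ((vk, \<sigma>, y), g) * coset_fourier vk y False v)"
  have dec: "opened_good_ket postX b a = hadamard b \<beta> * h a" if "a \<in> decodesX \<beta>" for a b \<beta>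
  proof -
    obtain b' v vk \<sigma> y g where a: "a = (b', v, (vk, \<sigma>, y), g)" by (metis prod.exhaust)
    show ?thesis
    proof (cases "\<tau> ((vk, \<sigma>, y), g) = 0")
      case True
      then show ?thesis by (simp add: a amp h_def)
    next
      case False
      note y = \<tau>0[OF False, THEN conjunct1] \<tau>0[OF False, THEN conjunct2, THEN conjunct1]
        \<tau>0[OF False, THEN conjunct2, THEN conjunct2]
      show ?thesis
      proof (cases "v \<in> S_perp \<eta> (\<omega> vk) y")
        case True
        moreover from this have "b' = \<beta>" using that by (simp add: a decodesX_def)
        ultimately show ?thesis
          using coset_fourier_dual[OF y True, of b] by (simp add: a amp h_def)
      next
        case False
        moreover from this have b': "\<beta> = (\<not> b')" using that by (auto simp: a decodesX_def)
        ultimately show ?thesis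
          using coset_fourier_not_dual[OF y False, of b] hadamard_sign[of b b', symmetric]
          by (simp add: a amp h_def mult_ac)
      qed
    qed
  qed
  define A where "A \<beta> = qsupp (opened_good_ket postX False) \<inter> decodesX \<beta>" for \<beta>
  have fin: "qfin (opened_good_ket postX False)"
    by (rule opened_good_fin[OF postX_fin postX_inner])
  then have finA: "finite (A \<beta>)" for \<beta> by (simp add: A_def)
  define flip where "flip = (\<lambda>(b' :: bool, a :: bitvec \<times> commitment \<times> garbage). (\<not> b', a))"
  have flip_A: "flip a \<in> A (\<not> \<beta>)" if "a \<in> A \<beta>" for a \<beta>
  proof -
    obtain b' v vk \<sigma> y g where a: "a = (b', v, (vk, \<sigma>, y), g)" by (metis prod.exhaust)
    have h0: "hadamard False b \<noteq> 0" for b by (simp add: hadamard_def)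
    have "flip a \<in> decodesX (\<not> \<beta>)"
      using that by (auto simp: A_def a flip_def decodesX_def)
    moreover have "flip a \<in> qsupp (opened_good_ket postX False)"
      using that h0 by (simp add: A_def a flip_def qsupp_def amp)
    ultimately show ?thesis by (simp add: A_def)
  qed
  have h_flip: "h (flip a) = h a" for a
    by (auto simp: h_def flip_def split: prod.splits)
  have flip_flip: "flip (flip a) = a" for a by (simp add: flip_def split: prod.splits)
  have sym: "(\<Sum>a\<in>A \<beta>. (cmod (h a))\<^sup>2) = (\<Sum>a\<in>A (\<not> \<beta>). (cmod (h a))\<^sup>2)" for \<beta>
    by (rule sum.reindex_bij_witness[of _ flip flip])
      (use flip_A[of _ \<beta>] flip_A[of _ "\<not> \<beta>"] in \<open>auto simp: flip_flip h_flip\<close>)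
  have total: "qprob (good_ket False) sig_valid \<le> (\<Sum>a\<in>A \<beta>. (cmod (h a))\<^sup>2)" for \<beta>
  proof -
    let ?valid = "{(b', v, (vk, \<sigma>, y), g). oss_accepts S \<eta> O' vk True \<sigma>} :: opened_label set"
    have sub: "qsupp (opened_good_ket postX False) \<inter> ?valid \<subseteq> A \<beta> \<union> A (\<not> \<beta>)"
    proof
      fix a assume a0: "a \<in> qsupp (opened_good_ket postX False) \<inter> ?valid"
      obtain b' v vk \<sigma> y g where a: "a = (b', v, (vk, \<sigma>, y), g)" by (metis prod.exhaust)
      have nz: "\<tau> ((vk, \<sigma>, y), g) \<noteq> 0" "coset_fourier vk y False v \<noteq> 0"
        using a0 by (auto simp: a qsupp_def amp)
      note y = \<tau>0[OF nz(1), THEN conjunct1] \<tau>0[OF nz(1), THEN conjunct2, THEN conjunct1]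
        \<tau>0[OF nz(1), THEN conjunct2, THEN conjunct2]
      \<comment> \<open>A nonzero transform excludes the case off both shifts, so
        \<open>decX\<close> cannot fail here once the signature is valid.\<close>
      have "v \<in> S_perp \<eta> (\<omega> vk) y \<or> v + unit_vec n 0 \<in> S_perp \<eta> (\<omega> vk) y"
        using coset_fourier_eq_0[OF y, of v False] nz(2) by blast
      then show "a \<in> A \<beta> \<union> A (\<not> \<beta>)"
        using a0 by (auto simp: A_def a decodesX_def)
    qed
    have "qprob (good_ket False) sig_valid = qprob (opened_good_ket postX False) ?valid"
      unfolding opened_good_ket_def
    proof (rule qprob_bind_preserved[OF good_fin, symmetric])
      fix p assume p: "p \<in> qsupp (good_ket False)"
      obtain vk \<sigma> y u g where pp: "p = ((vk, \<sigma>, y), u, g)" by (metis prod.exhaust)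
      show "qfin (postX False p)"
        by (rule postX_fin[OF subsetD[OF good_labels p]])
      have u: "u \<in> carrier_vec n"
        using subsetD[OF good_labels p] by (simp add: pp post_labels_def)
      have supp: "qsupp (postX False p) \<subseteq> {(b', v, c, g'). c = (vk, \<sigma>, y)}"
        by (auto simp: qsupp_def pp postX_amplitude[OF u] split: if_splits)
      show "qsupp (postX False p) \<subseteq> ?valid" if "p \<in> sig_valid"
        using supp that by (auto simp: pp sig_valid_def)
      show "qsupp (postX False p) \<inter> ?valid = {}" if "p \<notin> sig_valid"
        using supp that by (auto simp: pp sig_valid_def)
      show "qinner (postX False p) (postX False p') = (if p = p' then 1 else 0)"
        if "p' \<in> qsupp (good_ket False)" for p'
        by (subst postX_inner[OF subsetD[OF good_labels p] subsetD[OF good_labels that]]) simp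
    qed
    also have "\<dots> \<le> (\<Sum>a\<in>A \<beta> \<union> A (\<not> \<beta>). (cmod (opened_good_ket postX False a))\<^sup>2)"
      unfolding qprob_def using finA sub by (intro sum_mono2) auto
    \<comment> \<open>Each Hadamard amplitude has squared modulus one half; the two equal sums over
      \<open>A \<beta>\<close> and \<open>A (\<not> \<beta>)\<close> make up for it.\<close>
    also have "\<dots> = (\<Sum>a\<in>A \<beta> \<union> A (\<not> \<beta>). (cmod (h a))\<^sup>2 / 2)"
    proof (intro sum.cong refl)
      fix a assume "a \<in> A \<beta> \<union> A (\<not> \<beta>)"
      then obtain \<beta>' where "a \<in> decodesX \<beta>'" by (auto simp: A_def)
      from dec[OF this, of False]
      show "(cmod (opened_good_ket postX False a))\<^sup>2 = (cmod (h a))\<^sup>2 / 2"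
        by (simp add: norm_mult power_mult_distrib cmod_hadamard)
    qed
    also have "\<dots> \<le> (\<Sum>a\<in>A \<beta>. (cmod (h a))\<^sup>2 / 2) + (\<Sum>a\<in>A (\<not> \<beta>). (cmod (h a))\<^sup>2 / 2)"
      using sum.union_inter[OF finA finA, of "\<lambda>a. (cmod (h a))\<^sup>2 / 2" \<beta> "\<not> \<beta>"]
        sum_nonneg[of "A \<beta> \<inter> A (\<not> \<beta>)" "\<lambda>a. (cmod (h a))\<^sup>2 / 2"] by simp
    also have "\<dots> = (\<Sum>a\<in>A \<beta>. (cmod (h a))\<^sup>2)"
      using sym[of \<beta>] by (simp flip: sum_divide_distrib)
    finally show ?thesis .
  qed
  show ?thesis
  proof (rule prob_opened_ge[OF postX_fin postX_inner \<rho> qubit_isometry_hadamard t dec])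
    fix X assume X: "finite X" "\<And>b. qsupp (opened_good_ket postX b) \<subseteq> X"
    have "(\<Sum>a\<in>A \<beta>. (cmod (h a))\<^sup>2) \<le> (\<Sum>a\<in>X \<inter> decodesX \<beta>. (cmod (h a))\<^sup>2)"
      using X(1) X(2)[of False] by (intro sum_mono2) (auto simp: A_def)
    then show "qprob (good_ket False) sig_valid \<le> (\<Sum>a\<in>X \<inter> decodesX \<beta>. (cmod (h a))\<^sup>2)"
      using total[of \<beta>] by linarith
  qed
qed

end

section \<open>Averaging over the keys\<close>

lemma set_pmf_uniform_bits [simp]: "set_pmf (uniform_bits l) = bits_of_length l"
proof -
  have "bits_of_length l \<noteq> {}" using Ex_list_of_length[of l] by auto
  then show ?thesis unfolding uniform_bits_def by (rule set_pmf_of_set) simp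
qed

text \<open>A bound that is affine in the error passes to the mean by linearity alone; this is what
  the free weight \<open>t\<close> was kept for.\<close>

lemma expectation_ge:
  fixes f g :: "'a \<Rightarrow> real"
  assumes fin: "finite (set_pmf p)" and le: "\<And>x. x \<in> set_pmf p \<Longrightarrow> c - k * g x \<le> f x"
    and g: "measure_pmf.expectation p g \<le> e" and k: "0 \<le> k"
  shows "c - k * e \<le> measure_pmf.expectation p f"
proof -
  have int: "integrable (measure_pmf p) h" for h :: "'a \<Rightarrow> real"
    by (rule integrable_measure_pmf_finite[OF fin])
  have "c - k * e \<le> c - k * measure_pmf.expectation p g"
    using g k by (simp add: mult_left_mono)
  also have "\<dots> = measure_pmf.expectation p (\<lambda>x. c - k * g x)"
    by (simp add: int)
  also have "\<dots> \<le> measure_pmf.expectation p f"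
    using le by (intro integral_mono_AE int) (simp add: AE_measure_pmf_iff)
  finally show ?thesis .
qed

lemma expectation_of_bool: "measure_pmf.expectation p (\<lambda>x. of_bool (P x)) = measure_pmf.prob p {x. P x}"
proof -
  have "(\<lambda>x. of_bool (P x) :: real) = indicator {x. P x}"
    by (auto simp: fun_eq_iff indicator_def)
  then show ?thesis by simp
qed

context
  fixes S :: oss and F :: prf_family and \<eta> :: nat
  assumes run: "oss_run S \<eta>" and \<eta>: "0 < \<eta>"
    and coins: "\<And>\<kappa> vk. length \<kappa> = prf_key_len F \<eta> \<Longrightarrow> length vk = oss_vk_len S \<eta> \<Longrightarrow>
      prf_eval F \<eta> \<kappa> vk \<in> obar_coin_space \<eta>"
begin

abbreviation oss_fun where "oss_fun R1 \<equiv> oss_oracle S \<eta> R1"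

definition sign_error :: "bool \<Rightarrow> bool list \<Rightarrow> real" where
  "sign_error m R1 = qprob (oss_run.signed_ket S \<eta> (oss_fun R1) m) (- oss_run.accepted S \<eta> (oss_fun R1) m)"

definition key_row_error :: "bool list \<Rightarrow> bool list \<Rightarrow> real" where
  "key_row_error R1 \<kappa> = pfc_run.row_error S \<eta> (oss_fun R1) (prf_eval F \<eta> \<kappa>)"

lemma pfc_run_keys: "length \<kappa> = prf_key_len F \<eta> \<Longrightarrow> pfc_run S \<eta> (prf_eval F \<eta> \<kappa>)"
  using run coins \<eta> by (simp add: pfc_run_def pfc_run_axioms_def)

lemma pfc_gen_eq:
  assumes "length \<kappa> = prf_key_len F \<eta>"
  shows "pfc_gen S F \<eta> (R1, \<kappa>) = (pfc_run.ck S \<eta> (oss_fun R1) (prf_eval F \<eta> \<kappa>), (R1, \<kappa>))"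
  unfolding pfc_run.ck_def[OF pfc_run_keys[OF assms]] by (simp add: pfc_gen_def Let_def)

lemma expectation_sign_error:
  "measure_pmf.expectation (uniform_bits (oss_coins S \<eta>)) (sign_error m) = 1 - pmf (oss_honest S \<eta> m) True"
proof -
  have int: "integrable (measure_pmf (uniform_bits (oss_coins S \<eta>))) h" for h :: "bool list \<Rightarrow> real"
    by (rule integrable_measure_pmf_finite) simp
  have "sign_error m = (\<lambda>R1. 1 - qprob (oss_run.signed_ket S \<eta> (oss_fun R1) m) (oss_run.accepted S \<eta> (oss_fun R1) m))"
  proof (rule ext)
    fix R1
    show "sign_error m R1 = 1 - qprob (oss_run.signed_ket S \<eta> (oss_fun R1) m) (oss_run.accepted S \<eta> (oss_fun R1) m)"
    using qprob_compl[OF oss_run.signed_fin[OF run], of "oss_fun R1" m "oss_run.accepted S \<eta> (oss_fun R1) m"]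
      by (simp add: sign_error_def oss_run.signed_norm[OF run])
  qed
  then show ?thesis
    unfolding oss_honest_eq[OF run] by (simp add: int)
qed

text \<open>For fixed \<open>R1\<close> the distribution of \<open>vk\<close> does not depend on the
  key of the function, so the expectation moves inside the sums over \<open>vk\<close> and
  \<open>y\<close>. There the worst-case bound applies to each term, and the weights sum to
  1.\<close>

lemma expectation_key_row_error_le:
  assumes \<epsilon>: "\<And>vk y. length vk = oss_vk_len S \<eta> \<Longrightarrow> y \<in> carrier_vec (par_r \<eta>) \<Longrightarrow>
      measure_pmf.prob (uniform_bits (prf_key_len F \<eta>)) {\<kappa>. zero_row \<eta> (prf_eval F \<eta> \<kappa> vk) y} \<le> \<epsilon>"
  shows "measure_pmf.expectation (uniform_bits (prf_key_len F \<eta>)) (key_row_error R1) \<le> \<epsilon>"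
proof -
  let ?U = "uniform_bits (prf_key_len F \<eta>)"
  let ?\<psi> = "oss_run.signed_ket S \<eta> (oss_fun R1) True"
  have int: "integrable (measure_pmf ?U) f" for f :: "bool list \<Rightarrow> real"
    by (intro integrable_measure_pmf_finite) simp
  have "measure_pmf.expectation ?U (key_row_error R1)
      = measure_pmf.expectation ?U (\<lambda>\<kappa>. \<Sum>(vk, g, w1)\<in>qsupp ?\<psi>. (cmod (?\<psi> (vk, g, w1)))\<^sup>2
          * (\<Sum>y\<in>carrier_vec (par_r \<eta>). of_bool (zero_row \<eta> (prf_eval F \<eta> \<kappa> vk) y) / 2 ^ par_r \<eta>))"
    by (intro integral_cong_AE)
      (auto simp: AE_measure_pmf_iff key_row_error_def pfc_run.row_error_def[OF pfc_run_keys])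
  also have "\<dots> = (\<Sum>(vk, g, w1)\<in>qsupp ?\<psi>. (cmod (?\<psi> (vk, g, w1)))\<^sup>2
      * (\<Sum>y\<in>carrier_vec (par_r \<eta>). measure_pmf.prob ?U {\<kappa>. zero_row \<eta> (prf_eval F \<eta> \<kappa> vk) y} / 2 ^ par_r \<eta>))"
    by (simp add: int case_prod_unfold expectation_of_bool)
  also have "\<dots> \<le> (\<Sum>(vk, g, w1)\<in>qsupp ?\<psi>. (cmod (?\<psi> (vk, g, w1)))\<^sup>2 * \<epsilon>)"
  proof (rule sum_mono, clarify)
    fix vk g w1 assume "(vk, g, w1) \<in> qsupp ?\<psi>"
    then have vk: "length vk = oss_vk_len S \<eta>"
      using oss_run.signed_supp[OF run] by blast
    have "(\<Sum>y\<in>carrier_vec (par_r \<eta>). measure_pmf.prob ?U {\<kappa>. zero_row \<eta> (prf_eval F \<eta> \<kappa> vk) y} / 2 ^ par_r \<eta>)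
        \<le> (\<Sum>y\<in>(carrier_vec (par_r \<eta>) :: bitvec set). \<epsilon> / 2 ^ par_r \<eta>)"
      using \<epsilon>[OF vk] by (intro sum_mono divide_right_mono) auto
    also have "\<dots> = \<epsilon>" by (simp add: card_carrier_vec)
    finally show "(cmod (?\<psi> (vk, g, w1)))\<^sup>2 * (\<Sum>y\<in>carrier_vec (par_r \<eta>).
        measure_pmf.prob ?U {\<kappa>. zero_row \<eta> (prf_eval F \<eta> \<kappa> vk) y} / 2 ^ par_r \<eta>)
      \<le> (cmod (?\<psi> (vk, g, w1)))\<^sup>2 * \<epsilon>"
      by (intro mult_left_mono) auto
  qed
  also have "\<dots> = qnorm2 ?\<psi> * \<epsilon>"
    by (simp add: qprob_def sum_distrib_right case_prod_unfold)
  also have "\<dots> = \<epsilon>" by (simp add: oss_run.signed_norm[OF run])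
  finally show ?thesis .
qed

lemma PFCZ_pmf_ge:
  assumes \<kappa>: "length \<kappa> = prf_key_len F \<eta>" and \<rho>: "density_qubit \<rho>" and t: "0 < t"
  shows "pmf (measure_qubit \<rho> qreturn) \<beta> - (sign_error True R1 + key_row_error R1 \<kappa>
      + 4 * (t + (8 * sign_error False R1 + 2 * key_row_error R1 \<kappa>) / t))
    \<le> pmf (case pfc_gen S F \<eta> (R1, \<kappa>) of (CK, dk) \<Rightarrow> do {
        (b, u, c, g) \<leftarrow> measure_qubit \<rho> (com_qubit_ket S \<eta> CK);
        return_pmf (decZ S F \<eta> dk c (b, u)) }) (Some \<beta>)"
proof -
  interpret pfc_run S \<eta> "oss_fun R1" "prf_eval F \<eta> \<kappa>" by (rule pfc_run_keys[OF \<kappa>])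
  have ket: "com_qubit_ket S \<eta> ck = opened_ket postZ"
    by (auto simp: com_qubit_ket_def opened_ket_def postZ_def fun_eq_iff)
  have "{a. (case a of (b, u, c, g) \<Rightarrow> decZ S F \<eta> (R1, \<kappa>) c (b, u)) = Some \<beta>} = decodesZ \<beta>"
    by (auto simp: decZ_def decodesZ_def split: if_splits)
  then show ?thesis
    using probZ_ge[OF \<rho> t, of \<beta>]
    by (simp add: pfc_gen_eq[OF \<kappa>] ket case_prod_unfold map_pmf_def[symmetric] pmf_map vimage_def
        sign_error_def key_row_error_def good_diff_bound_def)
qed

lemma PFCX_pmf_ge:
  assumes \<kappa>: "length \<kappa> = prf_key_len F \<eta>" and \<rho>: "density_qubit \<rho>" and t: "0 < t"
  shows "pmf (measure_qubit \<rho> hadamard) \<beta> - (sign_error True R1 + key_row_error R1 \<kappa>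
      + 4 * (t + (8 * sign_error False R1 + 2 * key_row_error R1 \<kappa>) / t))
    \<le> pmf (case pfc_gen S F \<eta> (R1, \<kappa>) of (CK, dk) \<Rightarrow> do {
        (b, u, c, g) \<leftarrow> measure_qubit \<rho> (\<lambda>b. do {
          (b, u, c, g) \<leftarrow> com_qubit_ket S \<eta> CK b;
          b' \<leftarrow> hadamard b;
          u' \<leftarrow> hadamard_vec u;
          qreturn (b', u', c, g)
        });
        return_pmf (decX S F \<eta> dk c (b, u)) }) (Some \<beta>)"
proof -
  interpret pfc_run S \<eta> "oss_fun R1" "prf_eval F \<eta> \<kappa>" by (rule pfc_run_keys[OF \<kappa>])
  have ket: "(\<lambda>b. do {
          (b, u, c, g) \<leftarrow> com_qubit_ket S \<eta> ck b;
          b' \<leftarrow> hadamard b;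
          u' \<leftarrow> hadamard_vec u;
          qreturn (b', u', c, g)
        }) = opened_ket postX"
  proof (rule ext)
    fix b
    let ?K = "\<lambda>(b, u, c, g). qbind (hadamard b) (\<lambda>b'. qbind (hadamard_vec u) (\<lambda>u'. qreturn (b', u', c, g)))"
    have "qbind (com_qubit_ket S \<eta> ck b) ?K
        = qbind (com_ket S \<eta> ck b) (\<lambda>p. qbind (case p of (c, u, g) \<Rightarrow> qreturn (b, u, c, g)) ?K)"
      unfolding com_qubit_ket_def by (intro qbind_assoc com_fin) (simp split: prod.splits)
    also have "\<dots> = opened_ket postX b"
      by (simp add: opened_ket_def postX_def case_prod_unfold)
    finally show "qbind (com_qubit_ket S \<eta> ck b) ?K = opened_ket postX b" .
  qed
  have "{a. (case a of (b, u, c, g) \<Rightarrow> decX S F \<eta> (R1, \<kappa>) c (b, u)) = Some \<beta>} = decodesX \<beta>"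
    by (auto simp: decX_def decodesX_def Let_def split: if_splits)
  then show ?thesis
    unfolding pfc_gen_eq[OF \<kappa>] prod.case ket using probX_ge[OF \<rho> t, of \<beta>]
    by (simp add: case_prod_unfold map_pmf_def[symmetric] pmf_map vimage_def
        sign_error_def key_row_error_def good_diff_bound_def)
qed

text \<open>One \<open>t\<close> serves all keys. The bound for each key is affine in its errors, so
  the averages are taken one after the other: over the key of the function for the zero rows, then
  over the setup coins for the signatures.\<close>

lemma tv_dist_keys_le:
  fixes p :: "bool pmf"
  assumes inner: "\<And>R1 \<kappa> \<beta>. length \<kappa> = prf_key_len F \<eta> \<Longrightarrow>
      pmf p \<beta> - (sign_error True R1 + key_row_error R1 \<kappa>
        + 4 * (t + (8 * sign_error False R1 + 2 * key_row_error R1 \<kappa>) / t))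
      \<le> pmf (G (pfc_gen S F \<eta> (R1, \<kappa>))) (Some \<beta>)"
    and \<epsilon>: "\<And>vk y. length vk = oss_vk_len S \<eta> \<Longrightarrow> y \<in> carrier_vec (par_r \<eta>) \<Longrightarrow>
      measure_pmf.prob (uniform_bits (prf_key_len F \<eta>)) {\<kappa>. zero_row \<eta> (prf_eval F \<eta> \<kappa> vk) y} \<le> \<epsilon>"
    and t: "0 < t"
  defines "a m \<equiv> 1 - pmf (oss_honest S \<eta> m) True"
  shows "tv_dist (map_pmf Some p) (bind_pmf (pfc_keys S F \<eta>) G)
    \<le> 2 * (a True + \<epsilon> + 4 * (t + (8 * a False + 2 * \<epsilon>) / t))"
proof (rule tv_dist_Some_le)
  fix \<beta>
  let ?U = "uniform_bits (prf_key_len F \<eta>)" and ?R = "uniform_bits (oss_coins S \<eta>)"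
  let ?f = "\<lambda>R1 \<kappa>. pmf (G (pfc_gen S F \<eta> (R1, \<kappa>))) (Some \<beta>)"
  have pmf: "pmf (bind_pmf (pfc_keys S F \<eta>) G) (Some \<beta>)
      = measure_pmf.expectation ?R (\<lambda>R1. measure_pmf.expectation ?U (?f R1))"
    by (simp add: pfc_keys_def bind_assoc_pmf bind_return_pmf pmf_bind)
  \<comment> \<open>\<open>1 + 8 / t\<close> collects the row error itself and its share
    \<open>4 * 2 / t\<close> in the perturbation bound.\<close>
  have in1: "(pmf p \<beta> - (sign_error True R1 + 4 * (t + 8 * sign_error False R1 / t))) - (1 + 8 / t) * \<epsilon>
      \<le> measure_pmf.expectation ?U (?f R1)" for R1
  proof (rule expectation_ge)
    show "pmf p \<beta> - (sign_error True R1 + 4 * (t + 8 * sign_error False R1 / t))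
        - (1 + 8 / t) * key_row_error R1 \<kappa> \<le> ?f R1 \<kappa>" if "\<kappa> \<in> set_pmf ?U" for \<kappa>
    proof -
      have "length \<kappa> = prf_key_len F \<eta>" using that by simp
      from inner[OF this, of \<beta> R1] show ?thesis
        by (simp add: algebra_simps add_divide_distrib)
    qed
    show "measure_pmf.expectation ?U (key_row_error R1) \<le> \<epsilon>"
      by (rule expectation_key_row_error_le[OF \<epsilon>])
  qed (use t in simp_all)
  \<comment> \<open>\<open>32 / t\<close> is \<open>4 * 8 / t\<close>, the share of the rejected
    signatures of 0.\<close>
  have "(pmf p \<beta> - (4 * t + (1 + 8 / t) * \<epsilon>)) - 1 * (a True + 32 / t * a False)
      \<le> measure_pmf.expectation ?R (\<lambda>R1. measure_pmf.expectation ?U (?f R1))"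
  proof (rule expectation_ge)
    show "(pmf p \<beta> - (4 * t + (1 + 8 / t) * \<epsilon>)) - 1 * (sign_error True R1 + 32 / t * sign_error False R1)
        \<le> measure_pmf.expectation ?U (?f R1)" for R1
      using in1[of R1] by (simp add: algebra_simps)
    show "measure_pmf.expectation ?R (\<lambda>R1. sign_error True R1 + 32 / t * sign_error False R1)
        \<le> a True + 32 / t * a False"
    proof -
      have int: "integrable (measure_pmf ?R) h" for h :: "bool list \<Rightarrow> real"
        by (rule integrable_measure_pmf_finite) simp
      show ?thesis by (simp add: int expectation_sign_error a_def)
    qed
  qed simp_all
  then show "pmf p \<beta> - (a True + \<epsilon> + 4 * (t + (8 * a False + 2 * \<epsilon>) / t))
      \<le> pmf (bind_pmf (pfc_keys S F \<eta>) G) (Some \<beta>)"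
    unfolding pmf by (simp add: algebra_simps add_divide_distrib)
next
  have "0 \<le> measure_pmf.prob (uniform_bits (prf_key_len F \<eta>))
      {\<kappa>. zero_row \<eta> (prf_eval F \<eta> \<kappa> (replicate (oss_vk_len S \<eta>) False)) (0\<^sub>v (par_r \<eta>))}"
    by simp
  also have "\<dots> \<le> \<epsilon>" by (rule \<epsilon>) simp_all
  finally show "0 \<le> a True + \<epsilon> + 4 * (t + (8 * a False + 2 * \<epsilon>) / t)"
    using t pmf_le_1[of "oss_honest S \<eta> True" True] pmf_le_1[of "oss_honest S \<eta> False" True]
    by (simp add: a_def)
qed

end

lemma oss_efficient_run: "oss_efficient S \<Longrightarrow> oss_run S \<eta>"
  by unfold_locales (auto simp: oss_efficient_def qpt_def)

lemma poly_bounded_vk_len: "oss_efficient S \<Longrightarrow> poly_bounded (oss_vk_len S)"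
proof -
  assume S: "oss_efficient S"
  then have "poly_bounded (\<lambda>\<eta>. qc_wires (oss_gen S \<eta>) + length (qc_gates (oss_gen S \<eta>)))"
    by (auto simp: oss_efficient_def qpt_def)
  then show ?thesis
    by (rule poly_bounded_mono) (use oss_run.gen_wires[OF oss_efficient_run[OF S]] in
      \<open>metis add_leD1 trans_le_add1\<close>)
qed

theorem theorem4p7:
  fixes S :: oss and F :: prf_family and \<rho> :: "nat \<Rightarrow> complex mat"
  assumes "one_shot_signature S"
    and "pseudorandom_function (oss_vk_len S) F"
    and "\<And>\<eta>. density_qubit (\<rho> \<eta>)"
  shows "negl (\<lambda>\<eta>. tv_dist (measZ (\<rho> \<eta>)) (PFCZ S F \<eta> (\<rho> \<eta>)))
       \<and> negl (\<lambda>\<eta>. tv_dist (measX (\<rho> \<eta>)) (PFCX S F \<eta> (\<rho> \<eta>)))"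
proof -
  have eff: "oss_efficient S" and correct: "oss_correct S"
    using assms(1) by (auto simp: one_shot_signature_def)
  note run = oss_efficient_run[OF eff]
  obtain \<epsilon> where \<epsilon>: "negl \<epsilon>" and \<epsilon>_ge: "\<And>\<eta> vk y. 0 < \<eta> \<Longrightarrow> length vk = oss_vk_len S \<eta> \<Longrightarrow>
      y \<in> carrier_vec (par_r \<eta>) \<Longrightarrow>
      measure_pmf.prob (uniform_bits (prf_key_len F \<eta>)) {\<kappa>. zero_row \<eta> (prf_eval F \<eta> \<kappa> vk) y} \<le> \<epsilon> \<eta>"
    using prf_zero_row_negl[OF assms(2) poly_bounded_vk_len[OF eff]] by blast
  define a where "a m \<eta> = 1 - pmf (oss_honest S \<eta> m) True" for m \<eta>
  have a: "negl (a m)" for m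
    using correct by (simp add: oss_correct_def a_def[abs_def])
  have a_nonneg: "0 \<le> a m \<eta>" for m \<eta> by (simp add: a_def pmf_le_1)
  have coins: "prf_eval F \<eta> \<kappa> vk \<in> obar_coin_space \<eta>"
    if "length \<kappa> = prf_key_len F \<eta>" "length vk = oss_vk_len S \<eta>" for \<eta> \<kappa> vk
    using assms(2) that by (auto simp: pseudorandom_function_def)
  have \<epsilon>_nonneg: "0 \<le> \<epsilon> \<eta>" if "0 < \<eta>" for \<eta>
    using order.trans[OF measure_nonneg
        \<epsilon>_ge[OF that, of "replicate (oss_vk_len S \<eta>) False" "0\<^sub>v (par_r \<eta>)"]] by simp
  \<comment> \<open>The bound on the averaged squared distance. The last summand keeps
    \<open>D\<close> positive even if both errors are 0, so that its root can serve as
    \<open>t\<close>.\<close>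
  define D where "D \<eta> = 8 * a False \<eta> + 2 * \<epsilon> \<eta> + 1 / 2 ^ \<eta>" for \<eta>
  \<comment> \<open>With \<open>t\<close> the root of \<open>D\<close>, both \<open>t\<close> and
    the quotient by \<open>t\<close> are at most that root, which gives
    \<open>4 * 2 = 8\<close>.\<close>
  define bound where "bound \<eta> = 2 * (a True \<eta> + \<epsilon> \<eta> + 8 * sqrt \<bar>D \<eta>\<bar>)" for \<eta>
  have "negl D"
    unfolding D_def[abs_def] by (intro negl_add negl_cmult a \<epsilon> negl_inverse_power2)
  then have "negl bound"
    unfolding bound_def[abs_def] by (intro negl_cmult negl_add a \<epsilon> negl_sqrt)
  have D_pos: "0 < D \<eta>" if "0 < \<eta>" for \<eta>
    using a_nonneg[of False \<eta>] \<epsilon>_nonneg[OF that] by (simp add: D_def add_nonneg_pos)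
  have t: "2 * (a True \<eta> + \<epsilon> \<eta> + 4 * (sqrt (D \<eta>) + (8 * a False \<eta> + 2 * \<epsilon> \<eta>) / sqrt (D \<eta>))) \<le> bound \<eta>"
    if "0 < \<eta>" for \<eta>
  proof -
    define q where "q = (8 * a False \<eta> + 2 * \<epsilon> \<eta>) / sqrt (D \<eta>)"
    have "q \<le> D \<eta> / sqrt (D \<eta>)"
      unfolding q_def using D_pos[OF that] by (intro divide_right_mono) (simp_all add: D_def)
    also have "\<dots> = sqrt (D \<eta>)" using D_pos[OF that] by (simp add: real_div_sqrt)
    finally show ?thesis using D_pos[OF that] unfolding q_def[symmetric] by (simp add: bound_def)
  qed
  have negl: "negl (\<lambda>\<eta>. tv_dist (P \<eta>) (Q \<eta>))"
    if "\<And>\<eta>. 0 < \<eta> \<Longrightarrow> tv_dist (P \<eta>) (Q \<eta>)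
      \<le> 2 * (a True \<eta> + \<epsilon> \<eta> + 4 * (sqrt (D \<eta>) + (8 * a False \<eta> + 2 * \<epsilon> \<eta>) / sqrt (D \<eta>)))"
    for P Q :: "nat \<Rightarrow> bool option pmf"
  proof (rule negl_mono[OF \<open>negl bound\<close>])
    show "\<forall>\<^sub>F \<eta> in sequentially. \<bar>tv_dist (P \<eta>) (Q \<eta>)\<bar> \<le> \<bar>bound \<eta>\<bar>"
      \<comment> \<open>At security parameter 0 all dimensions are 0 and there is no first row;
        negligibility only looks at large parameters.\<close>
      using eventually_gt_at_top[of 0]
    proof eventually_elim
      case (elim \<eta>)
      then show ?case
        using that[of \<eta>] t[of \<eta>] tv_dist_nonneg[of "P \<eta>" "Q \<eta>"] by linarith
    qed
  qed
  show ?thesis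
  proof
    show "negl (\<lambda>\<eta>. tv_dist (measZ (\<rho> \<eta>)) (PFCZ S F \<eta> (\<rho> \<eta>)))"
    proof (rule negl)
      fix \<eta> :: nat assume \<eta>: "0 < \<eta>"
      show "tv_dist (measZ (\<rho> \<eta>)) (PFCZ S F \<eta> (\<rho> \<eta>))
        \<le> 2 * (a True \<eta> + \<epsilon> \<eta> + 4 * (sqrt (D \<eta>) + (8 * a False \<eta> + 2 * \<epsilon> \<eta>) / sqrt (D \<eta>)))"
        unfolding measZ_def PFCZ_def a_def using D_pos[OF \<eta>]
        by (intro tv_dist_keys_le[OF run \<eta> coins PFCZ_pmf_ge[OF run \<eta> coins] \<epsilon>_ge] assms(3)) (simp_all add: \<eta>)
    qed
    show "negl (\<lambda>\<eta>. tv_dist (measX (\<rho> \<eta>)) (PFCX S F \<eta> (\<rho> \<eta>)))"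
    proof (rule negl)
      fix \<eta> :: nat assume \<eta>: "0 < \<eta>"
      show "tv_dist (measX (\<rho> \<eta>)) (PFCX S F \<eta> (\<rho> \<eta>))
        \<le> 2 * (a True \<eta> + \<epsilon> \<eta> + 4 * (sqrt (D \<eta>) + (8 * a False \<eta> + 2 * \<epsilon> \<eta>) / sqrt (D \<eta>)))"
        unfolding measX_def PFCX_def a_def using D_pos[OF \<eta>]
        by (intro tv_dist_keys_le[OF run \<eta> coins PFCX_pmf_ge[OF run \<eta> coins] \<epsilon>_ge] assms(3)) (simp_all add: \<eta>)
    qed
  qed
qed

end
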